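(* Let $\mathbf Y=\{Y_n\}_{n\ge 0}$ be a branching process in i.i.d. random environment with one immigrant in each generation (BPIRE) whose random offspring generating function is geometric with probability 1, i.e. $F(s)=\frac{1}{1+e^{X}(1-s)}$ with $X=\log m(F)$, and which is intermediate subcritical: $-\infty<\mathbf E[X]<0$ and $\mathbf E[Xe^{X}]=0$. Let $\gamma:=\mathbf E[e^{X}]$ and let $\mathbb P$ be the measure under which the environment is i.i.d. with law tilted by $\gamma^{-1}e^{X}$. Assume that with respect to $\mathbb P$ the distribution of $X$ is nonlattice and belongs to the domain of attraction of a two-sided stable law with index $\alpha\in(1,2]$, and let $\rho:=\lim_{n\to\infty}\mathbb P(S_n>0)\in(0,1)$. Let $\mathcal A_i(n)$, $0\le i\le n-1$, be the event that only the $(i,n)$-clan survives in $\mathbf Y$ at moment $n$. Then: 1) for any fixed $N\in\{1,2,\dots\}$ the limit $\lim_{n\to\infty}\mathbf P(\mathcal A_{n-N}(n))=:r_N$ exists and $r_N\in(0,\infty)$; 2) there exist a slowly varying function $l(n)$ and a constant $R\in(0,\infty)$ such that $$\lim_{n-i\to\infty}\gamma^{-(n-i)}(n-i)^{\rho}\,l(n-i)\,\mathbf P(\mathcal A_i(n))=R .$$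
   Context: Setting. $\Delta$ is the space of probability measures on $\mathbb N_0=\{0,1,2,\dots\}$ with the total variation metric (a Polish space). $F$ is a random element of $\Delta$ and $F_1,F_2,\dots$ are independent copies of $F$ (the random environment). For a measure $F$ write $F(s)=\sum_{j\ge0}F(\{j\})s^j$ for its generating function, $m(F)=\sum_{j\ge1}jF(\{j\})$, $X=\log m(F)$. "Geometric with probability 1" means $F(s)=\frac{q}{1-ps}$ with random $p,q\in(0,1)$, $p+q=1$, so that $m(F)=p/q=e^X$ and $F(s)=\frac1{1+e^X(1-s)}$. The associated random walk is $S_0=0$, $S_n=X_1+\dots+X_n$, $X_n=\log m(F_n)$. The BPIRE $\mathbf Y=\{Y_n,\ n\ge0\}$: $Y_0=1$ and, given the environment $F_i=f_i$, $i\ge1$, $\mathbf Y$ is a Markov chain in which, given $Y_{n-1}=y_{n-1}$, $Y_n$ is distributed as $\xi_{n1}+\dots+\xi_{ny_{n-1}}+1$, where $\xi_{n1},\xi_{n2},\dots$ are i.i.d. with distribution $f_n$. That is, the individuals of generation $n-1$ first reproduce independently according to $f_n$, and afterwards one immigrant enters generation $n$. The single individual at time $0$ is regarded as the immigrant of generation $0$. The $(i,n)$-clan is the set of individuals alive at generation $n$ that are descendants of the immigrant which entered the population at generation $i$. Put $Y_n^-:=\xi_{n1}+\dots+\xi_{nY_{n-1}}$ (the population at time $n$ just before the immigrant of generation $n$ arrives). $\mathcal A_i(n)$ is the event that $Y_n^->0$ and all these $Y_n^-$ individuals belong to the $(i,n)$-clan. Change of measure. $\mathbb P$ (with expectation $\mathbb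 E$) is defined by $\mathbb E[\psi(F_1,\dots,F_n,Y_0,\dots,Y_n)]:=\gamma^{-n}\mathbf E[\psi(F_1,\dots,F_n,Y_0,\dots,Y_n)e^{S_n}]$ for all $n$ and bounded measurable $\psi$. Under $\mathbb P$ the $X_n$ are i.i.d. with $\mathbb E[X]=\gamma^{-1}\mathbf E[Xe^X]=0$. The domain-of-attraction assumption means that there is an increasing sequence of positive numbers $c_n=n^{1/\alpha}l_1(n)$, $l_1$ slowly varying, such that $S_n/c_n$ converges in distribution under $\mathbb P$ to the two-sided (i.e. not concentrated on a half-line) stable law of index $\alpha$; in this case the limit $\rho=\lim_{n\to\infty} \mathbb P(S_n>0)$ exists and lies in $(0,1)$. Nonlattice means not concentrated on any set $a+h\mathbb Z$, $h>0$. The limit as $n-i\to\infty$ is over pairs of integers $0\le i<n$, with $i$ allowed to vary arbitrarily with $n$. *)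

theory Defs
  imports "HOL-Probability.Probability"
begin

text \<open>The sigma-algebra of \<open>Delta\<close> is generated by the evaluations \<open>f \<mapsto> f A\<close>. As the underlying
  set is countable, it is the Borel sigma-algebra of the total variation metric.\<close>

abbreviation Delta :: "nat measure measure" where
  "Delta \<equiv> prob_algebra (count_space UNIV)"

definition gen_fun :: "nat measure \<Rightarrow> real \<Rightarrow> real" where
  "gen_fun f s = (\<Sum>j. measure f {j} * s ^ j)"

definition mean_offspring :: "nat measure \<Rightarrow> real" where
  "mean_offspring f = (\<Sum>j. real j * measure f {j})"

definition log_mean :: "nat measure \<Rightarrow> real" where
  "log_mean f = ln (mean_offspring f)"

definition geometric_offspring :: "nat measure \<Rightarrow> bool" where
  "geometric_offspring f \<longleftrightarrow>
     (\<exists>p q. 0 < p \<and> 0 < q \<and> p + q = 1 \<and> (\<forall>s\<in>{0..1}. gen_fun f s = q / (1 - p * s)))"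

text \<open>Deterministic part: \<open>x n k\<close> is the number of children, born into generation \<open>n \<ge> 1\<close>, of the
  individual with label \<open>k\<close> of generation \<open>n - 1\<close>. The individuals of generation \<open>n\<close> carry the
  labels \<open>0, \<dots>, pop x n - 1\<close>: first the children, in the order of their parents, and last the
  immigrant, which has label \<open>pop_pre x n\<close>.\<close>

fun pop :: "(nat \<Rightarrow> nat \<Rightarrow> nat) \<Rightarrow> nat \<Rightarrow> nat" where
  "pop x 0 = 1"
| "pop x (Suc n) = (\<Sum>k<pop x n. x (Suc n) k) + 1"

text \<open>\<open>pop_pre x n\<close> is the population at time \<open>n \<ge> 1\<close> just before the immigrant arrives.\<close>

definition pop_pre :: "(nat \<Rightarrow> nat \<Rightarrow> nat) \<Rightarrow> nat \<Rightarrow> nat" where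
  "pop_pre x n = (\<Sum>k<pop x (n - 1). x n k)"

definition parent :: "(nat \<Rightarrow> nat \<Rightarrow> nat) \<Rightarrow> nat \<Rightarrow> nat \<Rightarrow> nat" where
  "parent x n k = (LEAST j. k < (\<Sum>l\<le>j. x n l))"

text \<open>\<open>origin x n k\<close> is the generation at which the immigrant ancestor of individual \<open>k\<close> of
  generation \<open>n\<close> entered the population.\<close>

fun origin :: "(nat \<Rightarrow> nat \<Rightarrow> nat) \<Rightarrow> nat \<Rightarrow> nat \<Rightarrow> nat" where
  "origin x 0 k = 0"
| "origin x (Suc n) k =
     (if k < pop_pre x (Suc n) then origin x n (parent x (Suc n) k) else Suc n)"

definition clan :: "(nat \<Rightarrow> nat \<Rightarrow> nat) \<Rightarrow> nat \<Rightarrow> nat \<Rightarrow> nat set" where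
  "clan x i n = {k. k < pop x n \<and> origin x n k = i}"

definition only_clan_survives :: "(nat \<Rightarrow> nat \<Rightarrow> nat) \<Rightarrow> nat \<Rightarrow> nat \<Rightarrow> bool" where
  "only_clan_survives x i n \<longleftrightarrow> 0 < pop_pre x n \<and> {..<pop_pre x n} \<subseteq> clan x i n"

definition env_algebra :: "'a measure \<Rightarrow> (nat \<Rightarrow> 'a \<Rightarrow> nat measure) \<Rightarrow> 'a measure" where
  "env_algebra M F =
     vimage_algebra (space M) (\<lambda>\<omega>. \<lambda>n\<in>{1..}. F n \<omega>) (\<Pi>\<^sub>M n\<in>{1..}. Delta)"

text \<open>\<open>L\<close> is the law of the random element of \<open>Delta\<close> of which the \<open>F n\<close>, \<open>n \<ge> 1\<close>, are independent
  copies. The last assumption says that, given the environment, all the offspring numbers are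
  independent and \<open>xi n k\<close> has distribution \<open>F n\<close>.\<close>

locale bpire = prob_space M
  for M :: "'a measure" +
  fixes L :: "nat measure measure"
    and F :: "nat \<Rightarrow> 'a \<Rightarrow> nat measure"
    and xi :: "nat \<Rightarrow> nat \<Rightarrow> 'a \<Rightarrow> nat"
  assumes env_indep: "indep_vars (\<lambda>_. Delta) F {1..}"
    and env_law: "\<And>n. 1 \<le> n \<Longrightarrow> distr M Delta (F n) = L"
    and offspring_measurable: "\<And>n k. 1 \<le> n \<Longrightarrow> xi n k \<in> measurable M (count_space UNIV)"
    and offspring_given_env:
      "\<And>J x. finite J \<Longrightarrow> J \<subseteq> {1..} \<times> UNIV \<Longrightarrow>
         AE \<omega> in M.
           real_cond_exp M (env_algebra M F)
             (indicator {\<omega>' \<in> space M. \<forall>(n, k)\<in>J. xi n k \<omega>' = x n k}) \<omega>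
           = (\<Prod>(n, k)\<in>J. measure (F n \<omega>) {x n k})"

definition clan_event ::
    "'a measure \<Rightarrow> (nat \<Rightarrow> nat \<Rightarrow> 'a \<Rightarrow> nat) \<Rightarrow> nat \<Rightarrow> nat \<Rightarrow> 'a set" where
  "clan_event M xi i n = {\<omega> \<in> space M. only_clan_survives (\<lambda>m k. xi m k \<omega>) i n}"

definition env_gamma :: "nat measure measure \<Rightarrow> real" where
  "env_gamma L = (\<integral>f. exp (log_mean f) \<partial>L)"

definition tilted_law :: "nat measure measure \<Rightarrow> nat measure measure" where
  "tilted_law L = density L (\<lambda>f. ennreal (exp (log_mean f) / env_gamma L))"

text \<open>The law of the environment sequence under the changed measure.\<close>

definition tilted_env :: "nat measure measure \<Rightarrow> (nat \<Rightarrow> nat measure) measure" where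
  "tilted_env L = (\<Pi>\<^sub>M n\<in>{1..}. tilted_law L)"

definition walk :: "nat \<Rightarrow> (nat \<Rightarrow> nat measure) \<Rightarrow> real" where
  "walk n e = (\<Sum>k=1..n. log_mean (e k))"

definition positivity_parameter :: "nat measure measure \<Rightarrow> real" where
  "positivity_parameter L =
     lim (\<lambda>n. measure (tilted_env L) {e \<in> space (tilted_env L). 0 < walk n e})"

definition nonlattice :: "'b measure \<Rightarrow> ('b \<Rightarrow> real) \<Rightarrow> bool" where
  "nonlattice M X \<longleftrightarrow> \<not> (\<exists>a h. 0 < h \<and> (AE \<omega> in M. \<exists>k::int. X \<omega> = a + h * of_int k))"

definition slowly_varying :: "(real \<Rightarrow> real) \<Rightarrow> bool" where
  "slowly_varying l \<longleftrightarrow>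
     l \<in> borel_measurable borel \<and> (\<forall>x>0. 0 < l x) \<and>
     (\<forall>t>0. ((\<lambda>x. l (t * x) / l x) \<longlongrightarrow> 1) at_top)"

text \<open>Nondegenerate stable law of index \<open>\<alpha>\<close>: if \<open>U\<close>, \<open>V\<close> are independent with law \<open>\<mu>\<close>, then
  \<open>a U + b V\<close> is distributed as \<open>(a\<^sup>\<alpha> + b\<^sup>\<alpha>)\<^sup>1\<^sup>/\<^sup>\<alpha> U + d\<close> for some \<open>d\<close>.\<close>

definition stable_law :: "real \<Rightarrow> real measure \<Rightarrow> bool" where
  "stable_law \<alpha> \<mu> \<longleftrightarrow>
     real_distribution \<mu> \<and> (\<forall>a. measure \<mu> {a} \<noteq> 1) \<and>
     (\<forall>a>0. \<forall>b>0. \<exists>d.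
        distr (\<mu> \<Otimes>\<^sub>M \<mu>) borel (\<lambda>(u, v). a * u + b * v)
        = distr \<mu> borel (\<lambda>u. (a powr \<alpha> + b powr \<alpha>) powr (1 / \<alpha>) * u + d))"

definition two_sided :: "real measure \<Rightarrow> bool" where
  "two_sided \<mu> \<longleftrightarrow> (\<forall>a. measure \<mu> {..a} \<noteq> 1 \<and> measure \<mu> {a..} \<noteq> 1)"

definition attracted_to_two_sided_stable :: "nat measure measure \<Rightarrow> real \<Rightarrow> bool" where
  "attracted_to_two_sided_stable L \<alpha> \<longleftrightarrow>
     (\<exists>c l1 \<mu>.
        (\<forall>n\<ge>1. 0 < c n) \<and> mono_on {1..} c \<and>
        slowly_varying l1 \<and> (\<forall>n\<ge>1. c n = real n powr (1 / \<alpha>) * l1 (real n)) \<and>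
        stable_law \<alpha> \<mu> \<and> two_sided \<mu> \<and>
        weak_conv_m (\<lambda>n. distr (tilted_env L) borel (\<lambda>e. walk n e / c n)) \<mu>)"

end

theory Submission
  imports Defs
begin

text \<open>
  For geometric offspring laws the extinction probabilities of the clans telescope, and reversing
  the time gives, with \<open>m = n - i\<close> and \<open>Q\<^sub>k = e\<^bsup>S\<^sub>0\<^esup> + \<dots> + e\<^bsup>S\<^sub>k\<^esup>\<close>,
  \<open>P(A\<^sub>i(n)) = E[e\<^bsup>S\<^sub>m\<^esup> / (Q\<^sub>m\<^sub>-\<^sub>1 Q\<^sub>n)]\<close>.
  Since \<open>E[X e\<^sup>X] = 0\<close> forces \<open>\<gamma> < 1\<close>, the sums \<open>Q\<^sub>n\<close> stay bounded in mean, which gives the first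
  assertion. Tilting the first \<open>m\<close> steps shows that \<open>\<gamma>\<^bsup>-m\<^esup> P(A\<^sub>i(n))\<close> differs from \<open>E[1 / Q\<^sub>m\<^sup>2]\<close>,
  now for the driftless walk, by at most a constant times \<open>E[e\<^bsup>S\<^sub>m\<^esup> / Q\<^sub>m\<^sup>2]\<close>, uniformly in \<open>i\<close>.

  Let \<open>p\<^sub>n\<close> be the probability that the driftless walk stays nonpositive up to time \<open>n\<close>. Spitzer's
  identity \<open>n p\<^sub>n = (\<Sum>k=1..n. P(S\<^sub>k \<le> 0) p\<^sub>n\<^sub>-\<^sub>k)\<close> and \<open>P(S\<^sub>k \<le> 0) \<longlongrightarrow> 1 - \<rho>\<close> give
  \<open>n p\<^sub>n / (p\<^sub>0 + \<dots> + p\<^sub>n\<^sub>-\<^sub>1) \<longlongrightarrow> 1 - \<rho>\<close>, so that \<open>p\<close> is regularly varying with index \<open>-\<rho>\<close>; no Tauberian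
  theorem is needed. The same identity with an exponential weight shows that the Laplace transforms
  of the walk at ladder times are summable and \<open>o(1/n)\<close>. Decomposing paths at their first maximum, and
  then the part after the maximum step by step, writes \<open>E[1 / Q\<^sub>m\<^sup>2]\<close> as convolutions of such
  sequences with \<open>p\<close>, whence \<open>E[1 / Q\<^sub>m\<^sup>2] / p\<^sub>m\<close> converges to a positive limit while
  \<open>E[e\<^bsup>S\<^sub>m\<^esup> / Q\<^sub>m\<^sup>2] = o(p\<^sub>m)\<close>.
\<close>

section \<open>Subset convolution and the combinatorial form of Spitzer's identity\<close>

definition subset_conv :: "('a set \<Rightarrow> real) \<Rightarrow> ('a set \<Rightarrow> real) \<Rightarrow> 'a set \<Rightarrow> real" where
  "subset_conv f g A = (\<Sum>B\<in>Pow A. f B * g (A - B))"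

lemma subset_conv_commute: "subset_conv f g A = subset_conv g f A"
  unfolding subset_conv_def
  by (rule sum.reindex_bij_witness[of _ "\<lambda>B. A - B" "\<lambda>B. A - B"]) (auto simp: double_diff)

lemma subset_conv_assoc:
  assumes "finite A"
  shows "subset_conv (subset_conv f g) h A = subset_conv f (subset_conv g h) A"
proof -
  have fin: "finite (Pow B)" if "B \<subseteq> A" for B
    using assms that finite_subset by blast
  have "subset_conv (subset_conv f g) h A =
      (\<Sum>(B, C)\<in>Sigma (Pow A) Pow. f C * g (B - C) * h (A - B))"
    unfolding subset_conv_def sum_distrib_right
    by (subst sum.Sigma) (use assms fin in auto)
  also have "\<dots> = (\<Sum>(C, D)\<in>Sigma (Pow A) (\<lambda>C. Pow (A - C)). f C * g D * h (A - C - D))"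
    by (rule sum.reindex_bij_witness[of _ "\<lambda>(C, D). (C \<union> D, C)" "\<lambda>(B, C). (C, B - C)"])
       (auto intro!: arg_cong2[of _ _ _ _ "(*)"] arg_cong[of _ _ h] arg_cong[of _ _ g])
  also have "\<dots> = subset_conv f (subset_conv g h) A"
    unfolding subset_conv_def sum_distrib_left
    by (subst sum.Sigma) (use assms in \<open>auto simp: mult.assoc\<close>)
  finally show ?thesis .
qed

lemma subset_conv_cong:
  assumes "\<And>B. B \<subseteq> A \<Longrightarrow> f B = f' B" "\<And>B. B \<subseteq> A \<Longrightarrow> g B = g' B"
  shows "subset_conv f g A = subset_conv f' g' A"
  unfolding subset_conv_def by (intro sum.cong) (auto simp: assms)

lemma subset_conv_add_left: "subset_conv (\<lambda>B. f B + f' B) g A = subset_conv f g A + subset_conv f' g A"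
  by (simp add: subset_conv_def algebra_simps sum.distrib)

lemma subset_conv_diff_left: "subset_conv (\<lambda>B. f B - f' B) g A = subset_conv f g A - subset_conv f' g A"
  by (simp add: subset_conv_def algebra_simps sum_subtractf)

lemma subset_conv_diff_right: "subset_conv f (\<lambda>B. g B - g' B) A = subset_conv f g A - subset_conv f g' A"
  by (simp add: subset_conv_def algebra_simps sum_subtractf)

lemma sum_Pow_by_card:
  assumes "finite A"
  shows "(\<Sum>B\<in>Pow A. f (card B)) = (\<Sum>k\<le>card A. real (card A choose k) * f k)"
proof -
  have "(\<Sum>B\<in>Pow A. f (card B)) = (\<Sum>k\<le>card A. \<Sum>B\<in>{B\<in>Pow A. card B = k}. f (card B))"
    by (rule sum.group[symmetric]) (auto simp: assms card_mono)
  also have "\<dots> = (\<Sum>k\<le>card A. real (card A choose k) * f k)"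
    by (intro sum.cong) (use n_subsets[OF assms] in \<open>auto simp: Pow_def\<close>)
  finally show ?thesis .
qed

locale half_line =
  fixes C :: "real \<Rightarrow> bool"
  assumes add: "C x \<Longrightarrow> C y \<Longrightarrow> C (x + y)"
    and add_not: "\<not> C x \<Longrightarrow> \<not> C y \<Longrightarrow> \<not> C (x + y)"

definition suffixes_in :: "(real \<Rightarrow> bool) \<Rightarrow> real list \<Rightarrow> bool" where
  "suffixes_in C ys \<longleftrightarrow> (\<forall>i<length ys. C (sum_list (drop i ys)))"

definition prefixes_in :: "(real \<Rightarrow> bool) \<Rightarrow> real list \<Rightarrow> bool" where
  "prefixes_in C ys \<longleftrightarrow> (\<forall>i\<in>{1..length ys}. C (sum_list (take i ys)))"

lemma suffixes_in_rev: "suffixes_in C (rev ys) = prefixes_in C ys"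
proof -
  have "suffixes_in C (rev ys) \<longleftrightarrow> (\<forall>i<length ys. C (sum_list (take (length ys - i) ys)))"
    by (simp add: suffixes_in_def drop_rev)
  also have "\<dots> \<longleftrightarrow> prefixes_in C ys"
    unfolding prefixes_in_def
  proof (intro iffI ballI allI impI)
    fix i assume *: "\<forall>i<length ys. C (sum_list (take (length ys - i) ys))" and i: "i \<in> {1..length ys}"
    then have "length ys - i < length ys" by auto
    with * have "C (sum_list (take (length ys - (length ys - i)) ys))" by blast
    with i show "C (sum_list (take i ys))" by simp
  qed auto
  finally show ?thesis .
qed

lemma sum_list_segment:
  fixes ys :: "real list"
  assumes "i \<le> j" "j \<le> length ys"
  shows "sum_list (drop i (take j ys)) = sum_list (take j ys) - sum_list (take i ys)"
proof -
  have "take j ys = take i ys @ drop i (take j ys)"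
    using assms by (metis append_take_drop_id min.absorb1 take_take)
  then have "sum_list (take j ys) = sum_list (take i ys) + sum_list (drop i (take j ys))"
    by (metis sum_list_append)
  then show ?thesis by simp
qed

lemma sum_list_segment':
  fixes ys :: "real list"
  shows "sum_list (take i (drop k ys)) = sum_list (take (k + i) ys) - sum_list (take k ys)"
  by (simp add: take_add)

lemma (in half_line) split_at_extremum:
  fixes ys :: "real list"
  shows "\<exists>!k. k \<le> length ys \<and> suffixes_in C (take k ys) \<and> prefixes_in (\<lambda>x. \<not> C x) (drop k ys)"
proof -
  define T where "T i = sum_list (take i ys)" for i
  have suf: "suffixes_in C (take k ys) \<longleftrightarrow> (\<forall>i<k. C (T k - T i))" if "k \<le> length ys" for k
    using that by (auto simp: suffixes_in_def sum_list_segment T_def)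
  have pre: "prefixes_in (\<lambda>x. \<not> C x) (drop k ys) \<longleftrightarrow> (\<forall>j. k < j \<and> j \<le> length ys \<longrightarrow> \<not> C (T j - T k))"
    if "k \<le> length ys" for k
    unfolding prefixes_in_def sum_list_segment' T_def[symmetric]
  proof (safe, goal_cases)
    case (1 j)
    then have "\<not> C (T (k + (j - k)) - T k)" by (metis (no_types) One_nat_def Suc_leI atLeastAtMost_iff diff_le_mono length_drop zero_less_diff)
    with 1 show ?case by simp
  qed (use that in auto)
  define K where "K = {k. k \<le> length ys \<and> suffixes_in C (take k ys)}"
  have "0 \<in> K" "finite K" by (auto simp: K_def suffixes_in_def)
  define k where "k = Max K"
  have k: "k \<in> K" unfolding k_def using \<open>0 \<in> K\<close> \<open>finite K\<close> by (intro Max_in) auto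
  then have kl: "k \<le> length ys" and ks: "\<And>i. i < k \<Longrightarrow> C (T k - T i)"
    using suf by (auto simp: K_def)
  have "\<not> C (T j - T k)" if "k < j" "j \<le> length ys" for j
    using that
  proof (induction j rule: less_induct)
    case (less j)
    show ?case
    proof
      assume C: "C (T j - T k)"
      have "C (T j - T i)" if "i < j" for i
      proof (cases i k rule: linorder_cases)
        case less
        then show ?thesis using add[OF C ks[of i]] by simp
      next
        case greater
        then have "\<not> C (T i - T k)" using less that by auto
        then show ?thesis using C add_not[of "T i - T k" "T j - T i"] by auto
      qed (use C in simp)
      then have "j \<in> K" using less.prems suf by (auto simp: K_def)
      then have "j \<le> k" unfolding k_def using \<open>finite K\<close> by simp
      with less.prems show False by simp
    qed
  qed
  then have 1: "k \<le> length ys \<and> suffixes_in C (take k ys) \<and> prefixes_in (\<lambda>x. \<not> C x) (drop k ys)"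
    using k kl pre by (auto simp: K_def)
  show ?thesis
  proof (rule ex1I[where a = k])
    show "k \<le> length ys \<and> suffixes_in C (take k ys) \<and> prefixes_in (\<lambda>x. \<not> C x) (drop k ys)"
      by (rule 1)
  next
    fix l assume l: "l \<le> length ys \<and> suffixes_in C (take l ys) \<and> prefixes_in (\<lambda>x. \<not> C x) (drop l ys)"
    then have "l \<in> K" by (simp add: K_def)
    then have "l \<le> k" unfolding k_def using \<open>finite K\<close> by simp
    moreover have False if "l < k"
      using that ks[of l] l kl pre[of l] by auto
    ultimately show "l = k" by force
  qed
qed

definition suffix_perms :: "(real \<Rightarrow> bool) \<Rightarrow> ('a \<Rightarrow> real) \<Rightarrow> 'a set \<Rightarrow> real" where
  "suffix_perms C x A = real (card {xs\<in>permutations_of_set A. suffixes_in C (map x xs)})"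

definition prefix_perms :: "(real \<Rightarrow> bool) \<Rightarrow> ('a \<Rightarrow> real) \<Rightarrow> 'a set \<Rightarrow> real" where
  "prefix_perms C x A = real (card {xs\<in>permutations_of_set A. prefixes_in C (map x xs)})"

lemma suffix_perms_empty [simp]: "suffix_perms C x {} = 1"
proof -
  have "{xs\<in>permutations_of_set {}. suffixes_in C (map x xs)} = {[]}"
    by (auto simp: suffixes_in_def)
  then show ?thesis by (simp add: suffix_perms_def)
qed

lemma prefix_perms_empty [simp]: "prefix_perms C x {} = 1"
proof -
  have "{xs\<in>permutations_of_set {}. prefixes_in C (map x xs)} = {[]}"
    by (auto simp: prefixes_in_def)
  then show ?thesis by (simp add: prefix_perms_def)
qed

lemma sum_list_permutation:
  fixes x :: "'a \<Rightarrow> real"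
  assumes "xs \<in> permutations_of_set A"
  shows "sum_list (map x xs) = sum x A"
  using assms by (auto simp: permutations_of_set_def sum_list_distinct_conv_sum_set)

lemma suffix_perms_eq_0:
  assumes "\<not> C (sum x A)" "A \<noteq> {}"
  shows "suffix_perms C x A = 0"
proof -
  have "\<not> suffixes_in C (map x xs)" if xs: "xs \<in> permutations_of_set A" for xs
  proof
    assume *: "suffixes_in C (map x xs)"
    have "length xs > 0" using xs assms(2) by (auto simp: permutations_of_set_def)
    with * have "C (sum_list (drop 0 (map x xs)))"
      unfolding suffixes_in_def by fastforce
    then show False using sum_list_permutation[OF xs, of x] assms(1) by simp
  qed
  then have "{xs\<in>permutations_of_set A. suffixes_in C (map x xs)} = {}" by blast
  then show ?thesis by (simp add: suffix_perms_def)
qed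

lemma prefix_perms_eq_0:
  assumes "\<not> C (sum x A)" "A \<noteq> {}"
  shows "prefix_perms C x A = 0"
proof -
  have "\<not> prefixes_in C (map x xs)" if xs: "xs \<in> permutations_of_set A" for xs
  proof
    assume *: "prefixes_in C (map x xs)"
    have "length xs > 0" using xs assms(2) by (auto simp: permutations_of_set_def)
    then have "length xs \<in> {1..length (map x xs)}" by (simp add: Suc_leI)
    with * have "C (sum_list (take (length xs) (map x xs)))"
      unfolding prefixes_in_def by blast
    then show False using sum_list_permutation[OF xs, of x] assms(1) by simp
  qed
  then have "{xs\<in>permutations_of_set A. prefixes_in C (map x xs)} = {}" by blast
  then show ?thesis by (simp add: prefix_perms_def)
qed

lemma (in half_line) subset_conv_suffix_prefix:
  assumes A: "finite A"
  shows "subset_conv (suffix_perms C x) (prefix_perms (\<lambda>t. \<not> C t) x) A = fact (card A)"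
proof -
  let ?S = "\<lambda>B. {xs\<in>permutations_of_set B. suffixes_in C (map x xs)}"
  let ?P = "\<lambda>B. {xs\<in>permutations_of_set B. prefixes_in (\<lambda>t. \<not> C t) (map x xs)}"
  let ?T = "Sigma (Pow A) (\<lambda>B. ?S B \<times> ?P (A - B))"
  have "subset_conv (suffix_perms C x) (prefix_perms (\<lambda>t. \<not> C t) x) A
      = real (\<Sum>B\<in>Pow A. card (?S B \<times> ?P (A - B)))"
    by (simp add: subset_conv_def suffix_perms_def prefix_perms_def card_cartesian_product)
  also have "(\<Sum>B\<in>Pow A. card (?S B \<times> ?P (A - B))) = card ?T"
    by (subst card_SigmaI) (use A in auto)
  also have "card ?T = card (permutations_of_set A)"
  proof (rule bij_betw_same_card[of "\<lambda>(B, us, vs). us @ vs"], unfold bij_betw_def, intro conjI)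
    show "inj_on (\<lambda>(B, us, vs). us @ vs) ?T"
    proof (rule inj_onI, clarsimp, goal_cases)
      case (1 B us vs B' us' vs')
      have eq: "take (length us) (map x (us @ vs)) = map x us" "drop (length us) (map x (us @ vs)) = map x vs" for us vs
        by simp_all
      have k: "length us \<le> length (map x (us @ vs)) \<and> suffixes_in C (take (length us) (map x (us @ vs))) \<and>
          prefixes_in (\<lambda>t. \<not> C t) (drop (length us) (map x (us @ vs)))"
        unfolding eq using \<open>suffixes_in C (map x us)\<close> \<open>prefixes_in (\<lambda>t. \<not> C t) (map x vs)\<close> by simp
      have k': "length us' \<le> length (map x (us @ vs)) \<and> suffixes_in C (take (length us') (map x (us @ vs))) \<and>
          prefixes_in (\<lambda>t. \<not> C t) (drop (length us') (map x (us @ vs)))"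
        unfolding \<open>us @ vs = us' @ vs'\<close> eq
        using \<open>suffixes_in C (map x us')\<close> \<open>prefixes_in (\<lambda>t. \<not> C t) (map x vs')\<close> by simp
      have "length us = length us'"
        using split_at_extremum[of "map x (us @ vs)"] k k' by blast
      then show ?case using 1 by (auto simp: permutations_of_set_def)
    qed
    show "(\<lambda>(B, us, vs). us @ vs) ` ?T = permutations_of_set A"
    proof (intro equalityI subsetI)
      fix xs assume xs: "xs \<in> permutations_of_set A"
      obtain k where k: "k \<le> length (map x xs)" "suffixes_in C (take k (map x xs))"
         "prefixes_in (\<lambda>t. \<not> C t) (drop k (map x xs))"
        using split_at_extremum[of "map x xs"] by blast
      have d: "distinct xs" "set xs = A" using xs by (auto simp: permutations_of_set_def)
      then have "set (take k xs) \<inter> set (drop k xs) = {}" "set (take k xs) \<union> set (drop k xs) = A"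
        by (simp_all add: set_take_disj_set_drop_if_distinct flip: set_append)
      then have "set (drop k xs) = A - set (take k xs)" "set (take k xs) \<subseteq> A" by auto
      then have "(set (take k xs), take k xs, drop k xs) \<in> ?T"
        using d k by (auto simp: permutations_of_set_def take_map drop_map)
      then show "xs \<in> (\<lambda>(B, us, vs). us @ vs) ` ?T"
        by (rule rev_image_eqI) simp
    qed (use A in \<open>auto simp: permutations_of_set_def\<close>)
  qed
  finally show ?thesis using A by simp
qed

definition block_weight :: "(real \<Rightarrow> bool) \<Rightarrow> ('a \<Rightarrow> real) \<Rightarrow> 'a set \<Rightarrow> real" where
  "block_weight C x A = (if A \<noteq> {} \<and> C (sum x A) then fact (card A) else 0)"

text \<open>In the ring of set functions under subset convolution, multiplication by the cardinality is
  a derivation, and the functions supported on \<open>{A. C (sum x A)}\<close> and on its complement form two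
  subrings. Comparing the components of the logarithmic derivative of
  \<open>|A|! = suffix_perms * prefix_perms\<close> in the two subrings gives both factors.\<close>

lemma (in half_line) card_times_suffix_perms:
  fixes x :: "'a \<Rightarrow> real"
  assumes "finite A"
  shows "real (card A) * suffix_perms C x A = subset_conv (block_weight C x) (suffix_perms C x) A"
proof -
  define D where "D = suffix_perms C x"
  define E where "E = prefix_perms (\<lambda>t. \<not> C t) x"
  define K where "K = block_weight C x"
  define K' where "K' = block_weight (\<lambda>t. \<not> C t) x"
  define U where "U = (\<lambda>A::'a set. fact (card A) :: real)"
  define N where "N f = (\<lambda>A::'a set. real (card A) * f A :: real)" for f
  have U: "subset_conv D E A = U A" if "finite A" for A
    using subset_conv_suffix_prefix[OF that, of x] by (simp add: D_def E_def U_def)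
  have deriv: "N (subset_conv f g) A = subset_conv (N f) g A + subset_conv f (N g) A" if "finite A" for f g A
  proof -
    have "real (card A) = real (card B) + real (card (A - B))" if "B \<subseteq> A" for B
      using that \<open>finite A\<close> by (simp add: card_Diff_subset card_mono finite_subset)
    then have "N (subset_conv f g) A = (\<Sum>B\<in>Pow A. (real (card B) + real (card (A - B))) * (f B * g (A - B)))"
      unfolding N_def subset_conv_def sum_distrib_left by (intro sum.cong) auto
    then show ?thesis by (simp add: N_def subset_conv_def algebra_simps sum.distrib)
  qed
  have KU: "subset_conv (\<lambda>A. K A + K' A) U A = N U A" if "finite A" for A
  proof -
    have "subset_conv (\<lambda>A. K A + K' A) U A = (\<Sum>B\<in>Pow A. if card B = 0 then 0 else fact (card B) * fact (card A - card B))"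
      unfolding subset_conv_def
    proof (intro sum.cong refl)
      fix B assume "B \<in> Pow A"
      then have "B \<subseteq> A" "finite B" using that finite_subset by auto
      then show "(K B + K' B) * U (A - B) = (if card B = 0 then 0 else fact (card B) * fact (card A - card B))"
        by (auto simp: K_def K'_def U_def block_weight_def card_Diff_subset)
    qed
    also have "\<dots> = (\<Sum>k\<le>card A. real (card A choose k) * (if k = 0 then 0 else fact k * fact (card A - k)))"
      using sum_Pow_by_card[OF that, of "\<lambda>k. if k = 0 then 0 else fact k * fact (card A - k)"] by simp
    also have "\<dots> = (\<Sum>k\<le>card A. if k = 0 then 0 else fact (card A))"
      by (intro sum.cong refl) (auto simp: binomial_fact)
    also have "\<dots> = (\<Sum>k\<in>{1..card A}. fact (card A))"
      by (rule sum.mono_neutral_cong_right) auto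
    finally show ?thesis by (simp add: N_def U_def)
  qed
  define a where "a = (\<lambda>A. N D A - subset_conv K D A)"
  define b where "b = (\<lambda>A. N E A - subset_conv K' E A)"
  have a_supp: "a A = 0" if "finite A" "\<not> C (sum x A)" for A
  proof -
    have "N D A = 0"
      using suffix_perms_eq_0[of C x A] that by (cases "A = {}") (auto simp: N_def D_def)
    moreover have "K B * D (A - B) = 0" if B: "B \<subseteq> A" for B
    proof (cases "C (sum x B)")
      case True
      have "sum x A = sum x B + sum x (A - B)"
        using B \<open>finite A\<close> by (simp add: sum.subset_diff add.commute)
      with True that \<open>\<not> C (sum x A)\<close> add[of "sum x B" "sum x (A - B)"] have "\<not> C (sum x (A - B))" by auto
      moreover have "A - B \<noteq> {}" using B True \<open>\<not> C (sum x A)\<close> by auto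
      ultimately show ?thesis using suffix_perms_eq_0[of C x "A - B"] by (simp add: D_def)
    qed (simp add: K_def block_weight_def)
    then have "(\<Sum>B\<in>Pow A. K B * D (A - B)) = 0"
      by (intro sum.neutral) auto
    ultimately show ?thesis unfolding a_def subset_conv_def by linarith
  qed
  have b_supp: "b A = 0" if "finite A" "C (sum x A)" for A
  proof -
    have "N E A = 0"
      using prefix_perms_eq_0[of "\<lambda>t. \<not> C t" x A] that by (cases "A = {}") (auto simp: N_def E_def)
    moreover have "K' B * E (A - B) = 0" if B: "B \<subseteq> A" for B
    proof (cases "C (sum x B)")
      case False
      have "sum x A = sum x B + sum x (A - B)"
        using B \<open>finite A\<close> by (simp add: sum.subset_diff add.commute)
      with False that \<open>C (sum x A)\<close> add_not[of "sum x B" "sum x (A - B)"] have "C (sum x (A - B))" by auto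
      moreover have "A - B \<noteq> {}" using B False \<open>C (sum x A)\<close> by auto
      ultimately show ?thesis using prefix_perms_eq_0[of "\<lambda>t. \<not> C t" x "A - B"] by (simp add: E_def)
    qed (simp add: K'_def block_weight_def)
    then have "(\<Sum>B\<in>Pow A. K' B * E (A - B)) = 0"
      by (intro sum.neutral) auto
    ultimately show ?thesis unfolding b_def subset_conv_def by linarith
  qed
  have ab: "subset_conv a E A + subset_conv D b A = 0" if A: "finite A" for A
  proof -
    have fin: "finite B" if "B \<subseteq> A" for B using that A finite_subset by blast
    have "subset_conv D (subset_conv K' E) A = subset_conv (subset_conv K' E) D A"
      by (rule subset_conv_commute)
    also have "\<dots> = subset_conv K' (subset_conv D E) A"
      unfolding subset_conv_assoc[OF A]
      by (intro subset_conv_cong refl subset_conv_commute)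
    also have "\<dots> = subset_conv K' U A"
      by (intro subset_conv_cong refl U fin)
    finally have 1: "subset_conv D (subset_conv K' E) A = subset_conv K' U A" .
    have 2: "subset_conv (subset_conv K D) E A = subset_conv K U A"
      unfolding subset_conv_assoc[OF A] by (intro subset_conv_cong refl U fin)
    have "subset_conv a E A + subset_conv D b A
        = (subset_conv (N D) E A + subset_conv D (N E) A) - (subset_conv K U A + subset_conv K' U A)"
      unfolding a_def b_def subset_conv_diff_left subset_conv_diff_right 1 2 by simp
    also have "\<dots> = N (subset_conv D E) A - subset_conv (\<lambda>A. K A + K' A) U A"
      using deriv[OF A] by (simp add: subset_conv_add_left)
    also have "\<dots> = 0" using KU[OF A] U[OF A] by (simp add: N_def)
    finally show ?thesis .
  qed
  have "finite A \<Longrightarrow> a A = 0 \<and> b A = 0" for A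
  proof (induction "card A" arbitrary: A rule: less_induct)
    case less
    have IH: "a B = 0 \<and> b B = 0" if "B \<subset> A" for B
      using less that by (meson psubset_card_mono finite_subset psubset_imp_subset)
    have "subset_conv a E A = a A * E {}"
    proof -
      have "subset_conv a E A = (\<Sum>B\<in>{A}. a B * E (A - B))"
        unfolding subset_conv_def using less.prems IH
        by (intro sum.mono_neutral_right) auto
      then show ?thesis by simp
    qed
    moreover have "subset_conv D b A = D {} * b A"
    proof -
      have "subset_conv D b A = (\<Sum>B\<in>{{}}. D B * b (A - B))"
        unfolding subset_conv_def
      proof (intro sum.mono_neutral_right ballI)
        fix B assume "B \<in> Pow A - {{}}"
        then have "A - B \<subset> A" by auto
        then show "D B * b (A - B) = 0" using IH by simp
      qed (use less.prems in auto)
      then show ?thesis by simp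
    qed
    ultimately have "a A + b A = 0"
      using ab[OF less.prems] by (simp add: D_def E_def)
    then show ?case using a_supp[OF less.prems] b_supp[OF less.prems] by (cases "C (sum x A)") auto
  qed
  from this[OF assms] show ?thesis by (simp add: a_def N_def D_def K_def)
qed

section \<open>Regularly varying tails\<close>

lemma tendsto_imp_abs_bounded:
  fixes f :: "nat \<Rightarrow> real"
  assumes "f \<longlonglongrightarrow> l"
  shows "\<exists>c>0. \<forall>n. \<bar>f n\<bar> \<le> c"
  using convergent_imp_Bseq[OF convergentI[OF assms]] by (auto simp: Bseq_def)

lemma tendsto_suminf_dominated:
  fixes c :: "nat \<Rightarrow> nat \<Rightarrow> real"
  assumes "\<And>k. (\<lambda>n. c k n) \<longlonglongrightarrow> b k" "\<And>k n. \<bar>c k n\<bar> \<le> h k" "summable h"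
  shows "(\<lambda>n. \<Sum>k. c k n) \<longlonglongrightarrow> suminf b"
  using tannerys_theorem[OF assms(1) _ assms(3)] assms(2) by (simp add: always_eventually)

lemma convolution_tendsto_0:
  fixes g d :: "nat \<Rightarrow> real"
  assumes g: "g \<longlonglongrightarrow> 0" and d: "summable d" "\<And>n. 0 \<le> d n"
  shows "(\<lambda>n. \<Sum>k\<le>n. g k * d (n - k)) \<longlonglongrightarrow> 0"
proof -
  obtain G where G: "\<And>k. \<bar>g k\<bar> \<le> G" 
    using tendsto_imp_abs_bounded[OF g] by blast
  have "(\<lambda>n. \<Sum>j. if j \<le> n then g (n - j) * d j else 0) \<longlonglongrightarrow> (\<Sum>j. 0 * d j)"
  proof (rule tendsto_suminf_dominated[where h = "\<lambda>j. G * d j"], goal_cases)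
    case (1 k)
    have "\<forall>\<^sub>F n in sequentially. g (n - k) * d k = (if k \<le> n then g (n - k) * d k else 0)"
      using eventually_ge_at_top[of k] by eventually_elim simp
    moreover have "(\<lambda>n. g (n - k) * d k) \<longlonglongrightarrow> 0 * d k"
      by (intro tendsto_intros filterlim_compose[OF g] filterlim_minus_const_nat_at_top)
    ultimately show ?case by (rule Lim_transform_eventually[rotated])
  next
    case (2 k n)
    have "G \<ge> 0" using G[of 0] by linarith
    then show ?case using G d by (auto simp: abs_mult intro!: mult_right_mono)
  qed (use d in \<open>auto intro: summable_mult\<close>)
  moreover have "(\<Sum>j. if j \<le> n then g (n - j) * d j else 0) = (\<Sum>k\<le>n. g k * d (n - k))" for n
  proof -
    have "(\<Sum>j. if j \<le> n then g (n - j) * d j else 0) = (\<Sum>j\<le>n. if j \<le> n then g (n - j) * d j else 0)"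
      by (rule suminf_finite) auto
    also have "\<dots> = (\<Sum>k\<le>n. g k * d (n - k))"
      by (rule sum.reindex_bij_witness[of _ "\<lambda>k. n - k" "\<lambda>k. n - k"]) auto
    finally show ?thesis .
  qed
  ultimately show ?thesis by simp
qed

lemma weighted_convolution_tendsto_0:
  fixes d e :: "nat \<Rightarrow> real"
  assumes "summable d" "\<And>n. 0 \<le> d n" "(\<lambda>n. real n * d n) \<longlonglongrightarrow> 0"
    and "summable e" "\<And>n. 0 \<le> e n" "(\<lambda>n. real n * e n) \<longlonglongrightarrow> 0"
  shows "(\<lambda>n. real n * (\<Sum>k\<le>n. d k * e (n - k))) \<longlonglongrightarrow> 0"
proof -
  have "(\<Sum>k\<le>n. real k * e k * d (n - k)) = (\<Sum>k\<le>n. real (n - k) * e (n - k) * d k)" for n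
    by (rule sum.reindex_bij_witness[of _ "\<lambda>k. n - k" "\<lambda>k. n - k"]) auto
  then have "real n * (\<Sum>k\<le>n. d k * e (n - k)) =
      (\<Sum>k\<le>n. real k * d k * e (n - k)) + (\<Sum>k\<le>n. real k * e k * d (n - k))" for n
    unfolding sum_distrib_left by (auto simp: algebra_simps of_nat_diff simp flip: sum.distrib intro!: sum.cong)
  then show ?thesis
    using tendsto_add[OF convolution_tendsto_0[OF assms(3,4,5)] convolution_tendsto_0[OF assms(6,1,2)]] by simp
qed

locale regular_tail =
  fixes p :: "nat \<Rightarrow> real" and a :: real
  assumes p_pos: "0 < p n" and p_dec: "m \<le> n \<Longrightarrow> p n \<le> p m" and a_pos: "0 < a"
    and ratio_lim: "(\<lambda>n. real n * p n / (\<Sum>j<n. p j)) \<longlonglongrightarrow> a"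

lemma convolution_smaller_than_sum:
  fixes g p :: "nat \<Rightarrow> real"
  assumes g: "g \<longlonglongrightarrow> 0" and p: "\<And>n. 0 < p n" "\<And>n. p n \<le> p 0"
    and P: "filterlim (\<lambda>n. \<Sum>j<n. p j) at_top sequentially"
  shows "(\<lambda>n. (\<Sum>k=1..n. g k * p (n - k)) / (\<Sum>j<n. p j)) \<longlonglongrightarrow> 0"
proof (rule LIMSEQ_I)
  fix \<epsilon> :: real assume "0 < \<epsilon>"
  define P where "P n = (\<Sum>j<n. p j)" for n
  obtain G where G: "\<And>k. \<bar>g k\<bar> \<le> G"
    using tendsto_imp_abs_bounded[OF g] by blast
  have G0: "G \<ge> 0" using G[of 0] by linarith
  obtain K where K: "\<And>k. k \<ge> K \<Longrightarrow> \<bar>g k\<bar> < \<epsilon> / 2"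
    using LIMSEQ_D[OF g, of "\<epsilon> / 2"] \<open>0 < \<epsilon>\<close> by auto
  have "\<forall>\<^sub>F n in sequentially. P n > 2 * (G * K * p 0) / \<epsilon> \<and> n \<ge> 1"
    using P unfolding P_def filterlim_at_top_dense
    by (auto intro: eventually_conj eventually_ge_at_top)
  then obtain n0 where n0: "\<And>n. n \<ge> n0 \<Longrightarrow> P n > 2 * (G * K * p 0) / \<epsilon> \<and> n \<ge> 1"
    by (auto simp: eventually_sequentially)
  have "norm ((\<Sum>k=1..n. g k * p (n - k)) / P n - 0) < \<epsilon>" if "n \<ge> n0" for n
  proof -
    have Ppos: "P n > 0" unfolding P_def using n0[OF that] p by (intro sum_pos) (auto simp: lessThan_empty_iff)
    have "\<bar>\<Sum>k=1..n. g k * p (n - k)\<bar> \<le> (\<Sum>k=1..n. \<bar>g k\<bar> * p (n - k))"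
      by (rule order_trans[OF sum_abs]) (use p in \<open>auto simp: abs_mult less_imp_le intro!: sum_mono\<close>)
    also have "\<dots> \<le> (\<Sum>k=1..n. \<epsilon> / 2 * p (n - k) + (if k < K then G * p 0 else 0))"
    proof (intro sum_mono)
      fix k
      show "\<bar>g k\<bar> * p (n - k) \<le> \<epsilon> / 2 * p (n - k) + (if k < K then G * p 0 else 0)"
      proof (cases "k < K")
        case True
        have "\<bar>g k\<bar> * p (n - k) \<le> G * p 0" using G[of k] p[of "n - k"] G0 by (intro mult_mono) auto
        moreover have "0 \<le> \<epsilon> / 2 * p (n - k)" using \<open>0 < \<epsilon>\<close> p(1)[of "n - k"] by simp
        ultimately show ?thesis using True by simp
      next
        case False
        then show ?thesis using K[of k] p(1)[of "n - k"] by (auto intro!: mult_right_mono less_imp_le)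
      qed
    qed
    also have "\<dots> = \<epsilon> / 2 * (\<Sum>k=1..n. p (n - k)) + (\<Sum>k=1..n. if k < K then G * p 0 else 0)"
      by (simp add: sum.distrib sum_distrib_left)
    also have "(\<Sum>k=1..n. p (n - k)) = P n"
      unfolding P_def by (rule sum.reindex_bij_witness[of _ "\<lambda>k. n - k" "\<lambda>k. n - k"]) auto
    also have "(\<Sum>k=1..n. if k < K then G * p 0 else 0) \<le> (\<Sum>k<K. G * p 0)"
    proof -
      have "(\<Sum>k=1..n. if k < K then G * p 0 else 0) = (\<Sum>k\<in>{k\<in>{1..n}. k < K}. G * p 0)"
        by (rule sum.inter_filter[symmetric]) simp
      also have "\<dots> \<le> (\<Sum>k<K. G * p 0)"
        using G0 p(1)[of 0] by (intro sum_mono2) auto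
      finally show ?thesis .
    qed
    also have "(\<Sum>k<K. G * p 0) = G * K * p 0" by simp
    also have "\<epsilon> / 2 * P n + G * K * p 0 < \<epsilon> * P n"
      using n0[OF that] \<open>0 < \<epsilon>\<close> by (simp add: field_simps)
    finally show ?thesis using Ppos by (simp add: field_simps)
  qed
  then show "\<exists>n0. \<forall>n\<ge>n0. norm ((\<Sum>k=1..n. g k * p (n - k)) / (\<Sum>j<n. p j) - 0) < \<epsilon>"
    unfolding P_def by blast
qed

lemma regular_tailI:
  fixes p b :: "nat \<Rightarrow> real"
  assumes p_pos: "\<And>n. 0 < p n" and p_dec: "\<And>m n. m \<le> n \<Longrightarrow> p n \<le> p m" and a: "0 < a"
    and b: "b \<longlonglongrightarrow> a" and rec: "\<And>n. real n * p n = (\<Sum>k=1..n. b k * p (n - k))"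
  shows "regular_tail p a"
proof -
  define P where "P n = (\<Sum>j<n. p j)" for n
  have shift: "(\<Sum>k=1..n. p (n - k)) = P n" for n
    unfolding P_def by (rule sum.reindex_bij_witness[of _ "\<lambda>k. n - k" "\<lambda>k. n - k"]) auto
  have b0: "(\<lambda>k. b k - a) \<longlonglongrightarrow> 0" using b by (simp add: LIM_zero)
  have rec': "real n * p n = (\<Sum>k=1..n. (b k - a) * p (n - k)) + a * P n" for n
    unfolding rec shift[symmetric] by (simp add: algebra_simps sum_subtractf sum_distrib_left)
  have "\<not> summable p"
  proof
    assume s: "summable p"
    have "(\<lambda>n. (\<Sum>k\<le>n. (b k - a) * p (n - k)) - (b 0 - a) * p n) \<longlonglongrightarrow> 0 - (b 0 - a) * 0"
      by (intro tendsto_intros convolution_tendsto_0 b0 s less_imp_le p_pos summable_LIMSEQ_zero)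
    moreover have "(\<Sum>k\<le>n. (b k - a) * p (n - k)) - (b 0 - a) * p n = (\<Sum>k=1..n. (b k - a) * p (n - k))" for n
      by (subst atMost_atLeast0, subst sum.atLeast_Suc_atMost) auto
    ultimately have "(\<lambda>n. \<Sum>k=1..n. (b k - a) * p (n - k)) \<longlonglongrightarrow> 0" by simp
    from tendsto_add[OF this tendsto_mult[OF tendsto_const summable_LIMSEQ[OF s], of a]]
    have lim: "(\<lambda>n. real n * p n) \<longlonglongrightarrow> a * suminf p"
      unfolding rec' P_def by simp
    have "a * suminf p > 0" using a suminf_pos[OF s p_pos] by simp
    then have "\<forall>\<^sub>F n in sequentially. real n * p n > a * suminf p / 2"
      by (intro order_tendstoD[OF lim]) simp
    then have "\<forall>\<^sub>F n in sequentially. norm (inverse (real n)) \<le> 2 / (a * suminf p) * p n"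
      using eventually_gt_at_top[of 0]
      by eventually_elim (use \<open>a * suminf p > 0\<close> in \<open>auto simp: field_simps\<close>)
    then have "summable (\<lambda>n. inverse (real n))"
      by (rule summable_comparison_test_ev) (intro summable_mult s)
    then show False using not_summable_harmonic[where ?'a = real] by (simp add: inverse_eq_divide)
  qed
  have Plim: "filterlim P at_top sequentially"
    unfolding filterlim_at_top
  proof (rule ccontr, clarsimp)
    fix Z assume Z: "\<not> (\<forall>\<^sub>F n in sequentially. Z \<le> P n)"
    have mono: "P m \<le> P n" if "m \<le> n" for m n
      unfolding P_def using that p_pos by (intro sum_mono2) (auto intro: less_imp_le)
    have "P n \<le> Z" for n
    proof (rule ccontr)
      assume "\<not> P n \<le> Z"
      then have "Z \<le> P m" if "m \<ge> n" for m using mono[OF that] by linarith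
      with Z show False by (auto simp: eventually_sequentially)
    qed
    then have "summable p" unfolding P_def
      by (intro summableI_nonneg_bounded[where x = Z]) (auto intro: less_imp_le p_pos)
    with \<open>\<not> summable p\<close> show False by blast
  qed
  have "(\<lambda>n. (\<Sum>k=1..n. (b k - a) * p (n - k)) / P n + a) \<longlonglongrightarrow> 0 + a"
    unfolding P_def using Plim
    by (intro tendsto_intros convolution_smaller_than_sum b0 p_pos p_dec) (auto simp: P_def[abs_def])
  moreover have "\<forall>\<^sub>F n in sequentially. (\<Sum>k=1..n. (b k - a) * p (n - k)) / P n + a = real n * p n / P n"
    using eventually_gt_at_top[of 0]
  proof eventually_elim
    case (elim n)
    then have "P n > 0" unfolding P_def using p_pos by (intro sum_pos) (auto simp: lessThan_empty_iff)
    then show ?case unfolding rec' by (simp add: field_simps)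
  qed
  ultimately have "(\<lambda>n. real n * p n / P n) \<longlonglongrightarrow> a"
    using Lim_transform_eventually by fastforce
  then show ?thesis
    unfolding P_def using p_pos p_dec a by unfold_locales auto
qed

context regular_tail
begin

definition psum :: "nat \<Rightarrow> real" where "psum n = (\<Sum>j<n. p j)"

lemma p_nonzero [simp]: "p n \<noteq> 0"
  using p_pos[of n] by simp

lemma psum_pos: "0 < n \<Longrightarrow> 0 < psum n"
  unfolding psum_def using p_pos by (intro sum_pos) (auto simp: lessThan_empty_iff)

lemma psum_mono: "m \<le> n \<Longrightarrow> psum m \<le> psum n"
  unfolding psum_def using p_pos by (intro sum_mono2) (auto intro: less_imp_le)

lemma psum_Suc: "psum (Suc n) = psum n + p n"
  by (simp add: psum_def)

lemma psum_ge: "real n * p n \<le> psum n"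
proof -
  have "(\<Sum>j<n. p n) \<le> (\<Sum>j<n. p j)" by (intro sum_mono p_dec) auto
  then show ?thesis by (simp add: psum_def)
qed

lemma ratio_lim': "(\<lambda>n. real n * p n / psum n) \<longlonglongrightarrow> a"
  using ratio_lim by (simp add: psum_def)

lemma psum_le: "\<exists>c>0. \<forall>n\<ge>1. psum n \<le> c * (real n * p n)"
proof -
  have "(\<lambda>n. inverse (real n * p n / psum n)) \<longlonglongrightarrow> inverse a"
    using a_pos by (intro tendsto_intros ratio_lim') auto
  then obtain c where c: "c > 0" "\<And>n. \<bar>inverse (real n * p n / psum n)\<bar> \<le> c"
    using tendsto_imp_abs_bounded by blast
  have "psum n \<le> c * (real n * p n)" if "n \<ge> 1" for n
    using c(2)[of n] psum_pos[of n] p_pos[of n] that by (simp add: field_simps abs_mult)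
  with c(1) show ?thesis by blast
qed

lemma tendsto_smaller_than_tail:
  assumes "(\<lambda>n. real n * x n) \<longlonglongrightarrow> 0"
  shows "(\<lambda>n. x n / p n) \<longlonglongrightarrow> 0"
proof -
  obtain c where c: "c > 0" "\<And>n. n \<ge> 1 \<Longrightarrow> psum n \<le> c * (real n * p n)" using psum_le by blast
  show ?thesis
  proof (rule Lim_null_comparison)
    show "(\<lambda>n. c / p 0 * \<bar>real n * x n\<bar>) \<longlonglongrightarrow> 0"
      using tendsto_mult[OF tendsto_const tendsto_rabs[OF assms], of "c / p 0"] by simp
    show "\<forall>\<^sub>F n in sequentially. norm (x n / p n) \<le> c / p 0 * \<bar>real n * x n\<bar>"
      using eventually_ge_at_top[of 1]
    proof eventually_elim
      case (elim n)
      have "p 0 \<le> psum n" using psum_mono[OF elim] by (simp add: psum_def)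
      also have "\<dots> \<le> c * (real n * p n)" using c elim by simp
      finally have "1 / p n \<le> c * real n / p 0"
        using p_pos[of n] p_pos[of 0] by (simp add: field_simps)
      then have "\<bar>x n\<bar> * (1 / p n) \<le> \<bar>x n\<bar> * (c * real n / p 0)"
        by (intro mult_left_mono) auto
      then show ?case using p_pos[of n] by (simp add: abs_mult mult_ac)
    qed
  qed
qed

lemma p_over_psum: "(\<lambda>n. p n / psum n) \<longlonglongrightarrow> 0"
proof -
  have "(\<lambda>n. real n * p n / psum n * (1 / real n)) \<longlonglongrightarrow> a * 0"
    by (intro tendsto_mult ratio_lim' lim_1_over_n)
  moreover have "\<forall>\<^sub>F n in sequentially. real n * p n / psum n * (1 / real n) = p n / psum n"
    using eventually_gt_at_top[of 0] by eventually_elim simp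
  ultimately show ?thesis using Lim_transform_eventually by fastforce
qed

lemma psum_ratio: "(\<lambda>n. psum (Suc n) / psum n) \<longlonglongrightarrow> 1"
proof -
  have "(\<lambda>n. 1 + p n / psum n) \<longlonglongrightarrow> 1 + 0"
    by (intro tendsto_intros p_over_psum)
  moreover have "\<forall>\<^sub>F n in sequentially. 1 + p n / psum n = psum (Suc n) / psum n"
    using eventually_gt_at_top[of 0]
  proof eventually_elim
    case (elim n)
    show ?case using psum_pos[OF elim] by (simp add: psum_Suc field_simps)
  qed
  ultimately show ?thesis using Lim_transform_eventually by fastforce
qed

lemma p_ratio_Suc: "(\<lambda>n. p n / p (Suc n)) \<longlonglongrightarrow> 1"
proof -
  have "(\<lambda>n. (real n * p n / psum n) / (real (Suc n) * p (Suc n) / psum (Suc n))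
      * (real (Suc n) / real n) / (psum (Suc n) / psum n)) \<longlonglongrightarrow> a / a * 1 / 1"
    using a_pos by (intro tendsto_intros ratio_lim' LIMSEQ_Suc[OF ratio_lim'] psum_ratio LIMSEQ_Suc_n_over_n) auto
  moreover have "\<forall>\<^sub>F n in sequentially. (real n * p n / psum n) / (real (Suc n) * p (Suc n) / psum (Suc n))
      * (real (Suc n) / real n) / (psum (Suc n) / psum n) = p n / p (Suc n)"
    using eventually_gt_at_top[of 0]
  proof eventually_elim
    case (elim n)
    then have "psum n \<noteq> 0" "psum (Suc n) \<noteq> 0" using psum_pos[of n] psum_pos[of "Suc n"] by auto
    then show ?case using elim p_pos[of "Suc n"] by (simp add: divide_simps)
  qed
  ultimately show ?thesis using a_pos Lim_transform_eventually by fastforce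
qed

lemma p_ratio_shift: "(\<lambda>n. p (n - k) / p n) \<longlonglongrightarrow> 1"
proof (induction k)
  case 0
  have "p n / p n = 1" for n using p_pos[of n] by simp
  then show ?case by simp
next
  case (Suc k)
  have "(\<lambda>n. p (n - Suc 0) / p n) \<longlonglongrightarrow> 1"
    using p_ratio_Suc by (subst filterlim_sequentially_Suc[symmetric]) simp
  then have 1: "(\<lambda>n. p (n - k - Suc 0) / p (n - k)) \<longlonglongrightarrow> 1"
    by (rule filterlim_compose[OF _ filterlim_minus_const_nat_at_top])
  have "p (n - k - Suc 0) / p (n - k) * (p (n - k) / p n) = p (n - Suc k) / p n" for n
    using p_pos[of "n - k"] by simp
  then show ?case using tendsto_mult[OF 1 Suc] by simp
qed

lemma doubling: "\<exists>c>0. \<forall>n. p (n div 2) \<le> c * p n"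
proof -
  obtain c where c: "c > 0" "\<And>n. n \<ge> 1 \<Longrightarrow> psum n \<le> c * (real n * p n)" using psum_le by blast
  let ?C = "3 * c + p 0 / p 1 + 1"
  have pos: "0 \<le> 3 * c" "0 \<le> p 0 / p 1" using c(1) p_pos[of 0] p_pos[of 1] by auto
  have "p (n div 2) \<le> ?C * p n" for n
  proof (cases "n \<ge> 2")
    case True
    define m where "m = n div 2"
    have m: "m \<ge> 1" "n \<le> 3 * m" "m \<le> n" using True by (auto simp: m_def)
    have "real m * p m \<le> psum n" using psum_ge[of m] psum_mono[OF m(3)] by linarith
    also have "\<dots> \<le> c * (real n * p n)" using c(2) True by simp
    also have "\<dots> \<le> c * (real (3 * m) * p n)"
      using c(1) m(2) p_pos[of n] by (intro mult_left_mono mult_right_mono) auto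
    finally have "p m \<le> 3 * c * p n" using m(1) by (simp add: field_simps)
    also have "\<dots> \<le> ?C * p n" using pos p_pos[of n] by (intro mult_right_mono) auto
    finally show ?thesis by (simp add: m_def)
  next
    case False
    then consider "n = 0" | "n = 1" by linarith
    then show ?thesis
    proof cases
      case 1
      have "1 * p 0 \<le> ?C * p 0" using pos p_pos[of 0] by (intro mult_right_mono) auto
      with 1 show ?thesis by simp
    next
      case 2
      have "p 0 / p 1 * p 1 \<le> ?C * p 1" using pos p_pos[of 1] c(1) by (intro mult_right_mono) auto
      with 2 show ?thesis using p_pos[of 1] by simp
    qed
  qed
  moreover have "?C > 0" using pos by linarith
  ultimately show ?thesis by blast
qed

lemma convolution_tail_tendsto:
  fixes c :: "nat \<Rightarrow> nat \<Rightarrow> real"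
  assumes e: "summable e" "\<And>n. 0 \<le> e n" "(\<lambda>n. real n * e n) \<longlonglongrightarrow> 0"
    and bound: "\<And>j n. j \<le> n \<Longrightarrow> \<bar>c j n\<bar> \<le> e j * p (n - j)"
    and lim: "\<And>j. (\<lambda>n. c j n / p n) \<longlonglongrightarrow> b j"
  shows "(\<lambda>n. (\<Sum>j\<le>n. c j n) / p n) \<longlonglongrightarrow> suminf b"
proof -
  obtain C where C: "C > 0" "\<And>n. p (n div 2) \<le> C * p n" using doubling by blast
  obtain K where K: "K > 0" "\<And>n. n \<ge> 1 \<Longrightarrow> psum n \<le> K * (real n * p n)" using psum_le by blast
  define r where "r n = (\<Sum>j\<in>{j\<in>{..n}. n < 2 * j}. c j n / p n)" for n
  have 1: "(\<lambda>n. \<Sum>j. if 2 * j \<le> n then c j n / p n else 0) \<longlonglongrightarrow> suminf b"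
  proof (rule tendsto_suminf_dominated[where h = "\<lambda>j. C * e j"], goal_cases)
    case (1 j)
    have "\<forall>\<^sub>F n in sequentially. c j n / p n = (if 2 * j \<le> n then c j n / p n else 0)"
      using eventually_ge_at_top[of "2 * j"] by eventually_elim simp
    with lim[of j] show ?case by (rule Lim_transform_eventually)
  next
    case (2 j n)
    show ?case
    proof (cases "2 * j \<le> n")
      case True
      have "\<bar>c j n\<bar> \<le> e j * p (n - j)" using True by (intro bound) auto
      also have "p (n - j) \<le> p (n div 2)" using True by (intro p_dec) auto
      also note C(2)[of n]
      finally have "\<bar>c j n\<bar> \<le> e j * (C * p n)" using e(2)[of j] by (simp add: mult_left_mono)
      then show ?thesis using True p_pos[of n] by (simp add: abs_mult field_simps)
    qed (use C e(2) in auto)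
  qed (use e in \<open>auto intro: summable_mult\<close>)
  have 2: "r \<longlonglongrightarrow> 0"
  proof (rule LIMSEQ_I)
    fix \<epsilon> :: real assume "\<epsilon> > 0"
    define \<eta> where "\<eta> = \<epsilon> / (2 * (K + 1)) / 2"
    have \<eta>: "\<eta> > 0" using \<open>\<epsilon> > 0\<close> K by (simp add: \<eta>_def)
    obtain J where J: "\<And>j. j \<ge> J \<Longrightarrow> real j * e j < \<eta>"
      using LIMSEQ_D[OF e(3) \<eta>] by force
    have "norm (r n - 0) < \<epsilon>" if n: "n \<ge> 2 * J + 1" for n
    proof -
      have "\<bar>c j n / p n\<bar> \<le> 2 * \<eta> / real n * p (n - j) / p n" if j: "j \<le> n" "n < 2 * j" for j
      proof -
        have "real n * e j \<le> (2 * real j) * e j" using j e(2)[of j] by (intro mult_right_mono) auto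
        also have "\<dots> \<le> 2 * \<eta>" using J[of j] j n by auto
        finally have "e j \<le> 2 * \<eta> / real n" using n by (simp add: field_simps)
        then have "\<bar>c j n\<bar> \<le> 2 * \<eta> / real n * p (n - j)"
          using bound[OF j(1)] p_pos[of "n - j"] by (meson mult_right_mono less_imp_le order_trans)
        then have "\<bar>c j n\<bar> / p n \<le> 2 * \<eta> / real n * p (n - j) / p n"
          using p_pos[of n] by (intro divide_right_mono) auto
        then show ?thesis using p_pos[of n] by (simp add: abs_mult)
      qed
      then have "\<bar>r n\<bar> \<le> (\<Sum>j\<in>{j\<in>{..n}. n < 2 * j}. 2 * \<eta> / real n * p (n - j) / p n)"
        unfolding r_def by (intro order_trans[OF sum_abs] sum_mono) auto
      also have "\<dots> \<le> (\<Sum>j\<le>n. 2 * \<eta> / real n * p (n - j) / p n)"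
        using \<eta> p_pos by (intro sum_mono2) (auto simp: less_imp_le)
      also have "\<dots> = 2 * \<eta> / real n / p n * (\<Sum>j\<le>n. p (n - j))"
        by (simp add: sum_distrib_left)
      also have "(\<Sum>j\<le>n. p (n - j)) = psum n + p n"
      proof -
        have "(\<Sum>j\<le>n. p (n - j)) = (\<Sum>j<Suc n. p j)"
          by (rule sum.reindex_bij_witness[of _ "\<lambda>k. n - k" "\<lambda>k. n - k"]) auto
        then show ?thesis by (simp add: psum_def)
      qed
      also have "2 * \<eta> / real n / p n * (psum n + p n) \<le> 2 * \<eta> / real n / p n * ((K + 1) * (real n * p n))"
      proof (rule mult_left_mono)
        have "p n \<le> real n * p n" using n p_pos[of n] by simp
        then show "psum n + p n \<le> (K + 1) * (real n * p n)" using K(2)[of n] n by (simp add: algebra_simps)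
      qed (use \<eta> p_pos[of n] in auto)
      also have "\<dots> = 2 * \<eta> * (K + 1)" using n by simp
      also have "\<dots> = \<epsilon> / 2"
      proof -
        have "K + 1 \<noteq> 0" using K(1) by simp
        then show ?thesis by (simp add: \<eta>_def divide_simps)
      qed
      finally show ?thesis using \<open>\<epsilon> > 0\<close> by simp
    qed
    then show "\<exists>n0. \<forall>n\<ge>n0. norm (r n - 0) < \<epsilon>" by blast
  qed
  have "(\<Sum>j. if 2 * j \<le> n then c j n / p n else 0) + r n = (\<Sum>j\<le>n. c j n) / p n" for n
  proof -
    have "(\<Sum>j. if 2 * j \<le> n then c j n / p n else 0) = (\<Sum>j\<le>n. if 2 * j \<le> n then c j n / p n else 0)"
      by (rule suminf_finite) auto
    moreover have "r n = (\<Sum>j\<le>n. if n < 2 * j then c j n / p n else 0)"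
      unfolding r_def by (rule sum.inter_filter) simp
    ultimately show ?thesis
      by (auto simp: sum_divide_distrib simp flip: sum.distrib intro!: sum.cong)
  qed
  then show ?thesis using tendsto_add[OF 1 2] by simp
qed

lemma convolution_tail_le:
  assumes e: "summable e" "\<And>n. 0 \<le> e n" "(\<lambda>n. real n * e n) \<longlonglongrightarrow> 0"
  shows "\<exists>C>0. \<forall>n. (\<Sum>j\<le>n. e j * p (n - j)) \<le> C * p n"
proof -
  have "(\<lambda>n. (\<Sum>j\<le>n. e j * p (n - j)) / p n) \<longlonglongrightarrow> (\<Sum>j. e j * 1)"
  proof (rule convolution_tail_tendsto[OF e])
    show "\<bar>e j * p (n - j)\<bar> \<le> e j * p (n - j)" for j n
      using e(2)[of j] p_pos[of "n - j"] by simp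
    show "(\<lambda>n. e j * p (n - j) / p n) \<longlonglongrightarrow> e j * 1" for j
      using tendsto_mult[OF tendsto_const p_ratio_shift, of "e j" j] by simp
  qed
  then obtain C where C: "C > 0" "\<And>n. \<bar>(\<Sum>j\<le>n. e j * p (n - j)) / p n\<bar> \<le> C"
    using tendsto_imp_abs_bounded by blast
  have "(\<Sum>j\<le>n. e j * p (n - j)) \<le> C * p n" for n
    using abs_le_D1[OF C(2)[of n]] p_pos[of n] by (simp add: field_simps)
  with C(1) show ?thesis by blast
qed

definition slow_exponent :: "nat \<Rightarrow> real" where
  "slow_exponent k = real k * (ln (psum (Suc k)) - ln (psum k)) - a"

lemma slow_exponent_tendsto: "slow_exponent \<longlonglongrightarrow> 0"
proof -
  define x where "x k = p k / psum k" for k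
  have kx: "(\<lambda>k. real k * x k) \<longlonglongrightarrow> a" using ratio_lim' by (simp add: x_def)
  have x0: "x \<longlonglongrightarrow> 0" using p_over_psum by (simp add: x_def[abs_def])
  have eq: "slow_exponent k = real k * ln (1 + x k) - a" "x k > 0" if "k > 0" for k
  proof -
    have "psum (Suc k) = psum k * (1 + x k)"
      using psum_pos[OF that] by (simp add: x_def psum_Suc field_simps)
    moreover show "x k > 0" using psum_pos[OF that] p_pos[of k] by (simp add: x_def)
    ultimately show "slow_exponent k = real k * ln (1 + x k) - a"
      using psum_pos[OF that] by (simp add: slow_exponent_def ln_mult)
  qed
  show ?thesis
  proof (rule tendsto_sandwich)
    show "\<forall>\<^sub>F k in sequentially. real k * x k - real k * x k * x k - a \<le> slow_exponent k"
      using eventually_gt_at_top[of 0] order_tendstoD(2)[OF x0 zero_less_one]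
    proof eventually_elim
      case (elim k)
      have "x k - (x k)\<^sup>2 \<le> ln (1 + x k)"
        using elim eq(2)[of k] by (intro ln_one_plus_pos_lower_bound) auto
      then have "real k * (x k - (x k)\<^sup>2) \<le> real k * ln (1 + x k)" by (intro mult_left_mono) auto
      then show ?case using eq(1)[OF elim(1)] by (simp add: algebra_simps power2_eq_square)
    qed
    show "\<forall>\<^sub>F k in sequentially. slow_exponent k \<le> real k * x k - a"
      using eventually_gt_at_top[of 0]
    proof eventually_elim
      case (elim k)
      have "ln (1 + x k) \<le> x k" using eq(2)[OF elim] by (intro ln_add_one_self_le_self) auto
      then have "real k * ln (1 + x k) \<le> real k * x k" by (intro mult_left_mono) auto
      then show ?case using eq(1)[OF elim] by simp
    qed
    show "(\<lambda>k. real k * x k - a) \<longlonglongrightarrow> 0" using kx by (simp add: LIM_zero)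
    have "(\<lambda>k. real k * x k - real k * x k * x k - a) \<longlonglongrightarrow> a - a * 0 - a"
      by (intro tendsto_intros kx x0)
    then show "(\<lambda>k. real k * x k - real k * x k * x k - a) \<longlonglongrightarrow> 0" by simp
  qed
qed

definition slow_factor :: "real \<Rightarrow> real" where
  "slow_factor x = exp (- (\<Sum>k=1..nat \<lfloor>x\<rfloor>. slow_exponent k / real k))"

lemma slow_exponent_sum_diff_le:
  assumes K: "\<And>k. k \<ge> K \<Longrightarrow> \<bar>slow_exponent k\<bar> \<le> \<eta>" and "K \<le> m" "m \<le> n"
  shows "\<bar>(\<Sum>k=1..n. slow_exponent k / real k) - (\<Sum>k=1..m. slow_exponent k / real k)\<bar> \<le> \<eta> * (harm n - harm m)"
  using \<open>m \<le> n\<close>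
proof (induction n rule: dec_induct)
  case (step n)
  have "\<bar>slow_exponent (Suc n) / real (Suc n)\<bar> \<le> \<eta> / real (Suc n)"
    using K[of "Suc n"] step \<open>K \<le> m\<close> by (simp add: divide_right_mono del: of_nat_Suc)
  moreover have "\<eta> * (harm (Suc n) - harm m) = \<eta> * (harm n - harm m) + \<eta> / real (Suc n)"
    by (simp add: harm_Suc algebra_simps divide_inverse)
  moreover have "(\<Sum>k=1..Suc n. slow_exponent k / real k) = (\<Sum>k=1..n. slow_exponent k / real k) + slow_exponent (Suc n) / real (Suc n)"
    by simp
  ultimately show ?case using step.IH by linarith
qed simp

end

lemma nat_floor_ratio_tendsto: "((\<lambda>x::real. real (nat \<lfloor>x\<rfloor>) / x) \<longlongrightarrow> 1) at_top"
proof (rule tendsto_sandwich)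
  show "\<forall>\<^sub>F x::real in at_top. 1 - 1 / x \<le> real (nat \<lfloor>x\<rfloor>) / x"
    using eventually_gt_at_top[of 0]
  proof eventually_elim
    case (elim x)
    have "x - 1 \<le> real (nat \<lfloor>x\<rfloor>)" using elim by linarith
    then have "(x - 1) / x \<le> real (nat \<lfloor>x\<rfloor>) / x" using elim by (intro divide_right_mono) auto
    then show ?case using elim by (simp add: diff_divide_distrib)
  qed
  show "\<forall>\<^sub>F x::real in at_top. real (nat \<lfloor>x\<rfloor>) / x \<le> 1"
    using eventually_gt_at_top[of 0]
    by eventually_elim (simp add: divide_le_eq)
  have "((\<lambda>x::real. 1 - 1 / x) \<longlongrightarrow> 1 - 0) at_top"
    by (intro tendsto_intros tendsto_divide_0[OF tendsto_const] filterlim_at_top_imp_at_infinity filterlim_ident)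
  then show "((\<lambda>x::real. 1 - 1 / x) \<longlongrightarrow> 1) at_top" by simp
qed simp

lemma filterlim_nat_floor_at_top: "filterlim (\<lambda>x::real. nat \<lfloor>x\<rfloor>) at_top at_top"
  unfolding filterlim_at_top
proof
  fix Z :: nat
  show "\<forall>\<^sub>F x::real in at_top. Z \<le> nat \<lfloor>x\<rfloor>"
    using eventually_ge_at_top[of "real Z"] by eventually_elim linarith
qed

lemma harm_floor_diff_tendsto:
  assumes "t > 0"
  shows "((\<lambda>x::real. harm (nat \<lfloor>t * x\<rfloor>) - harm (nat \<lfloor>x\<rfloor>)) \<longlongrightarrow> ln t) at_top"
proof -
  have tx: "filterlim (\<lambda>x. t * x) at_top at_top"
    using assms by (intro filterlim_tendsto_pos_mult_at_top[OF tendsto_const] filterlim_ident)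
  have 1: "((\<lambda>x::real. harm (nat \<lfloor>x\<rfloor>) - ln (real (nat \<lfloor>x\<rfloor>))) \<longlongrightarrow> euler_mascheroni) at_top"
    by (rule filterlim_compose[OF euler_mascheroni_LIMSEQ filterlim_nat_floor_at_top])
  have 2: "((\<lambda>x::real. ln (real (nat \<lfloor>x\<rfloor>) / x)) \<longlongrightarrow> ln 1) at_top"
    by (intro tendsto_ln nat_floor_ratio_tendsto) auto
  have "((\<lambda>x::real. (harm (nat \<lfloor>t * x\<rfloor>) - ln (real (nat \<lfloor>t * x\<rfloor>))) - (harm (nat \<lfloor>x\<rfloor>) - ln (real (nat \<lfloor>x\<rfloor>)))
      + (ln (real (nat \<lfloor>t * x\<rfloor>) / (t * x)) - ln (real (nat \<lfloor>x\<rfloor>) / x)) + ln t)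
      \<longlongrightarrow> euler_mascheroni - euler_mascheroni + (ln 1 - ln 1) + ln t) at_top"
    by (intro tendsto_intros 1 2 filterlim_compose[OF 1 tx] filterlim_compose[OF 2 tx])
  moreover have "\<forall>\<^sub>F x::real in at_top. (harm (nat \<lfloor>t * x\<rfloor>) - ln (real (nat \<lfloor>t * x\<rfloor>))) - (harm (nat \<lfloor>x\<rfloor>) - ln (real (nat \<lfloor>x\<rfloor>)))
      + (ln (real (nat \<lfloor>t * x\<rfloor>) / (t * x)) - ln (real (nat \<lfloor>x\<rfloor>) / x)) + ln t = harm (nat \<lfloor>t * x\<rfloor>) - harm (nat \<lfloor>x\<rfloor>)"
    using eventually_gt_at_top[of 0] eventually_ge_at_top[of 1]
      filterlim_at_top_dense[THEN iffD1, OF tx, rule_format, of 1]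
  proof eventually_elim
    case (elim x)
    have "real (nat \<lfloor>t * x\<rfloor>) > 0" "real (nat \<lfloor>x\<rfloor>) > 0" using elim by linarith+
    moreover have "ln (u / (t * x)) = ln u - (ln t + ln x)" "ln (u / x) = ln u - ln x" if "u > 0" for u
      using elim assms that by (simp_all add: ln_div ln_mult)
    ultimately have "ln (real (nat \<lfloor>t * x\<rfloor>) / (t * x)) = ln (real (nat \<lfloor>t * x\<rfloor>)) - (ln t + ln x)"
        "ln (real (nat \<lfloor>x\<rfloor>) / x) = ln (real (nat \<lfloor>x\<rfloor>)) - ln x"
      by blast+
    then show ?case by simp
  qed
  ultimately show ?thesis using Lim_transform_eventually by fastforce
qed

context regular_tail
begin

lemma slowly_varying_slow_factor: "slowly_varying slow_factor"
  unfolding slowly_varying_def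
proof (intro conjI allI impI)
  have "(\<lambda>n. exp (- (\<Sum>k=1..n. slow_exponent k / real k))) \<in> borel_measurable (count_space UNIV)" by simp
  moreover have "(\<lambda>x::real. nat \<lfloor>x\<rfloor>) \<in> measurable borel (count_space UNIV)" by measurable
  ultimately show "slow_factor \<in> borel_measurable borel"
    unfolding slow_factor_def[abs_def] by (rule measurable_compose[rotated])
  show "0 < slow_factor x" for x by (simp add: slow_factor_def)
  fix t :: real assume t: "0 < t"
  define D where "D x = (\<Sum>k=1..nat \<lfloor>x\<rfloor>. slow_exponent k / real k)" for x :: real
  have tx: "filterlim (\<lambda>x. t * x) at_top at_top"
    using t by (intro filterlim_tendsto_pos_mult_at_top[OF tendsto_const] filterlim_ident)
  have "((\<lambda>x. D (t * x) - D x) \<longlongrightarrow> 0) at_top"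
  proof (rule tendstoI)
    fix \<epsilon> :: real assume \<epsilon>: "0 < \<epsilon>"
    define B where "B = \<bar>ln t\<bar> + 1"
    have B: "B > 0" by (simp add: B_def)
    obtain K where K: "\<And>k. k \<ge> K \<Longrightarrow> \<bar>slow_exponent k\<bar> \<le> \<epsilon> / (2 * B)"
      using LIMSEQ_D[OF slow_exponent_tendsto, of "\<epsilon> / (2 * B)"] \<epsilon> B by (auto intro: less_imp_le)
    have "\<forall>\<^sub>F x in at_top. \<bar>harm (nat \<lfloor>t * x\<rfloor>) - harm (nat \<lfloor>x\<rfloor>)\<bar> < B"
      by (intro order_tendstoD(2)[OF tendsto_rabs[OF harm_floor_diff_tendsto[OF t]]]) (simp add: B_def)
    then show "\<forall>\<^sub>F x in at_top. dist (D (t * x) - D x) 0 < \<epsilon>"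
      using filterlim_at_top[THEN iffD1, OF filterlim_nat_floor_at_top, rule_format, of K]
        filterlim_at_top[THEN iffD1, OF filterlim_compose[OF filterlim_nat_floor_at_top tx], rule_format, of K]
    proof eventually_elim
      case (elim x)
      have "\<bar>D (t * x) - D x\<bar> \<le> \<epsilon> / (2 * B) * \<bar>harm (nat \<lfloor>t * x\<rfloor>) - harm (nat \<lfloor>x\<rfloor>)\<bar>"
      proof (cases "nat \<lfloor>x\<rfloor> \<le> nat \<lfloor>t * x\<rfloor>")
        case True
        then show ?thesis
          using slow_exponent_sum_diff_le[OF K elim(2) True] harm_mono[OF True, where ?'a = real] by (simp add: D_def)
      next
        case False
        then have le: "nat \<lfloor>t * x\<rfloor> \<le> nat \<lfloor>x\<rfloor>" by simp
        then show ?thesis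
          using slow_exponent_sum_diff_le[OF K elim(3) le] harm_mono[OF le, where ?'a = real]
          by (simp add: D_def abs_minus_commute)
      qed
      also have "\<dots> \<le> \<epsilon> / (2 * B) * B"
        using elim(1) \<epsilon> B by (intro mult_left_mono) auto
      also have "\<dots> < \<epsilon>" using \<epsilon> B by simp
      finally show ?case by simp
    qed
  qed
  then have "((\<lambda>x. exp (- (D (t * x) - D x))) \<longlongrightarrow> exp (- 0)) at_top"
    by (intro tendsto_intros)
  then show "((\<lambda>x. slow_factor (t * x) / slow_factor x) \<longlongrightarrow> 1) at_top"
    by (simp add: slow_factor_def D_def exp_diff exp_minus field_simps)
qed

lemma slow_factor_tail_tendsto:
  "\<exists>c>0. (\<lambda>n. real n powr (1 - a) * slow_factor (real n) * p n) \<longlonglongrightarrow> c"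
proof (intro exI conjI)
  define h :: "nat \<Rightarrow> real" where "h n = harm n - ln (real n)" for n
  have h: "h \<longlonglongrightarrow> euler_mascheroni" unfolding h_def[abs_def] by (rule euler_mascheroni_LIMSEQ)
  have lnP: "ln (psum (Suc n)) = ln (p 0) + a * harm n + (\<Sum>k=1..n. slow_exponent k / real k)" for n
  proof (induction n)
    case 0
    then show ?case by (simp add: psum_def harm_def)
  next
    case (Suc n)
    have "slow_exponent (Suc n) / real (Suc n) = ln (psum (Suc (Suc n))) - ln (psum (Suc n)) - a / real (Suc n)"
      by (simp add: slow_exponent_def field_simps del: of_nat_Suc)
    then show ?case using Suc by (simp add: harm_Suc algebra_simps divide_inverse)
  qed
  show "0 < a * p 0 * exp (a * euler_mascheroni)" using a_pos p_pos by simp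
  have "(\<lambda>n. (real n * p n / psum n) / (psum (Suc n) / psum n) * (p 0 * exp (a * h n))) \<longlonglongrightarrow>
      a / 1 * (p 0 * exp (a * euler_mascheroni))"
    by (intro tendsto_intros ratio_lim' psum_ratio h) auto
  moreover have "\<forall>\<^sub>F n in sequentially. (real n * p n / psum n) / (psum (Suc n) / psum n) * (p 0 * exp (a * h n))
     = real n powr (1 - a) * slow_factor (real n) * p n"
    using eventually_gt_at_top[of 0]
  proof eventually_elim
    case (elim n)
    define D where "D = (\<Sum>k=1..n. slow_exponent k / real k)"
    have "psum (Suc n) = exp (ln (psum (Suc n)))" using psum_pos[of "Suc n"] by simp
    also have "\<dots> = p 0 * exp (a * harm n) * exp D"
      unfolding lnP using p_pos[of 0] by (simp add: exp_add D_def)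
    finally have P: "psum (Suc n) = p 0 * exp (a * harm n) * exp D" .
    have "(real n * p n / psum n) / (psum (Suc n) / psum n) = real n * p n / psum (Suc n)"
      using psum_pos[OF elim] by simp
    also have "\<dots> * (p 0 * exp (a * h n)) = real n * p n * exp (- (a * ln (real n))) * exp (- D)"
      unfolding P h_def by (simp add: right_diff_distrib exp_diff exp_minus field_simps)
    also have "real n * p n * exp (- (a * ln (real n))) * exp (- D) = real n powr (1 - a) * slow_factor (real n) * p n"
    proof -
      have "real n * exp (- (a * ln (real n))) = real n powr (1 - a)"
        using elim by (simp add: powr_def exp_minus exp_diff left_diff_distrib divide_inverse)
      then show ?thesis by (simp add: slow_factor_def D_def)
    qed
    finally show ?case .
  qed
  ultimately show "(\<lambda>n. real n powr (1 - a) * slow_factor (real n) * p n) \<longlonglongrightarrow> a * p 0 * exp (a * euler_mascheroni)"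
    using Lim_transform_eventually[where l = "a / 1 * (p 0 * exp (a * euler_mascheroni))"] by (simp add: mult.assoc)
qed

end

section \<open>Random walks with independent identically distributed steps\<close>

definition partial_sum :: "(nat \<Rightarrow> real) \<Rightarrow> nat \<Rightarrow> real" where
  "partial_sum \<omega> n = (\<Sum>i<n. \<omega> i)"

definition ladder :: "(real \<Rightarrow> bool) \<Rightarrow> (nat \<Rightarrow> real) \<Rightarrow> nat \<Rightarrow> bool" where
  "ladder C \<omega> n \<longleftrightarrow> (\<forall>i\<in>{..<n}. C (partial_sum \<omega> n - partial_sum \<omega> i))"

definition stays :: "(real \<Rightarrow> bool) \<Rightarrow> (nat \<Rightarrow> real) \<Rightarrow> nat \<Rightarrow> bool" where
  "stays C \<omega> n \<longleftrightarrow> (\<forall>i\<in>{1..n}. C (partial_sum \<omega> i))"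

lemma partial_sum_0 [simp]: "partial_sum \<omega> 0 = 0"
  by (simp add: partial_sum_def)

lemma partial_sum_Suc: "partial_sum \<omega> (Suc n) = partial_sum \<omega> n + \<omega> n"
  by (simp add: partial_sum_def)

lemma partial_sum_cong: "(\<And>i. i < n \<Longrightarrow> \<omega> i = \<omega>' i) \<Longrightarrow> partial_sum \<omega> n = partial_sum \<omega>' n"
  by (simp add: partial_sum_def)

lemma partial_sum_shift: "partial_sum (\<lambda>i. \<omega> (k + i)) j = partial_sum \<omega> (k + j) - partial_sum \<omega> k"
  by (induction j) (simp_all add: partial_sum_Suc)

lemma partial_sum_comb_seq_le: "j \<le> k \<Longrightarrow> partial_sum (comb_seq k \<omega> \<omega>') j = partial_sum \<omega> j"
  by (intro partial_sum_cong) (simp add: comb_seq_def)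

lemma comb_seq_shift: "(\<lambda>i. comb_seq k \<omega> \<omega>' (k + i)) = \<omega>'"
  by (simp add: comb_seq_def)

lemma partial_sum_comb_seq_add:
  "partial_sum (comb_seq k \<omega> \<omega>') (k + j) = partial_sum \<omega> k + partial_sum \<omega>' j"
  using partial_sum_shift[of "comb_seq k \<omega> \<omega>'" k j]
  by (simp add: comb_seq_shift partial_sum_comb_seq_le)

lemma take_upt_map: "j \<le> n \<Longrightarrow> sum_list (take j (map \<omega> [0..<n])) = partial_sum \<omega> j"
  by (simp add: take_map partial_sum_def interv_sum_list_conv_sum_set_nat atLeast0LessThan)

lemma map_nth_upt: "length xs = n \<Longrightarrow> map (\<lambda>i. \<omega> (xs ! i)) [0..<n] = map \<omega> xs"
  by (rule nth_equalityI) auto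

lemma suffixes_in_upt: "suffixes_in C (map \<omega> [0..<n]) = ladder C \<omega> n"
proof -
  have "sum_list (drop i (map \<omega> [0..<n])) = partial_sum \<omega> n - partial_sum \<omega> i" if "i < n" for i
    using sum_list_segment[of i n "map \<omega> [0..<n]"] that take_upt_map[of n n \<omega>] take_upt_map[of i n \<omega>] by simp
  then show ?thesis by (auto simp: suffixes_in_def ladder_def)
qed

lemma prefixes_in_upt: "prefixes_in C (map \<omega> [0..<n]) = stays C \<omega> n"
  by (simp add: prefixes_in_def stays_def take_upt_map)

lemma stays_shift_upt: "prefixes_in C (drop k (map \<omega> [0..<n])) = stays C (\<lambda>i. \<omega> (k + i)) (n - k)"
proof -
  have "drop k (map \<omega> [0..<n]) = map (\<lambda>i. \<omega> (k + i)) [0..<n - k]"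
    by (rule nth_equalityI) auto
  then show ?thesis by (simp add: prefixes_in_upt)
qed

lemma (in half_line) sum_ladder_stays:
  "(\<Sum>k\<le>n. of_bool (ladder C \<omega> k) * of_bool (stays (\<lambda>x. \<not> C x) (\<lambda>i. \<omega> (k + i)) (n - k))) = (1 :: real)"
proof -
  obtain k where k: "k \<le> n" "ladder C \<omega> k" "stays (\<lambda>x. \<not> C x) (\<lambda>i. \<omega> (k + i)) (n - k)"
    and uniq: "\<And>l. l \<le> n \<Longrightarrow> ladder C \<omega> l \<Longrightarrow> stays (\<lambda>x. \<not> C x) (\<lambda>i. \<omega> (l + i)) (n - l) \<Longrightarrow> l = k"
  proof -
    have *: "take l (map \<omega> [0..<n]) = map \<omega> [0..<l]" if "l \<le> n" for l
      using that by (simp add: take_map)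
    obtain k where "k \<le> n \<and> ladder C \<omega> k \<and> stays (\<lambda>x. \<not> C x) (\<lambda>i. \<omega> (k + i)) (n - k)"
      "\<And>l. l \<le> n \<and> ladder C \<omega> l \<and> stays (\<lambda>x. \<not> C x) (\<lambda>i. \<omega> (l + i)) (n - l) \<Longrightarrow> l = k"
      using split_at_extremum[of "map \<omega> [0..<n]"]
      unfolding stays_shift_upt length_map length_upt diff_zero Ex1_def
      by (metis "*" suffixes_in_upt)
    then show thesis using that by blast
  qed
  have "(\<Sum>l\<le>n. of_bool (ladder C \<omega> l) * of_bool (stays (\<lambda>x. \<not> C x) (\<lambda>i. \<omega> (l + i)) (n - l)))
      = (\<Sum>l\<le>n. if l = k then 1 else 0 :: real)"
  proof (intro sum.cong refl)
    fix l assume "l \<in> {..n}"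
    then have "ladder C \<omega> l \<and> stays (\<lambda>x. \<not> C x) (\<lambda>i. \<omega> (l + i)) (n - l) \<longleftrightarrow> l = k"
      using k uniq by blast
    then show "of_bool (ladder C \<omega> l) * of_bool (stays (\<lambda>x. \<not> C x) (\<lambda>i. \<omega> (l + i)) (n - l)) = (if l = k then 1 else 0 :: real)"
      by (cases "l = k") auto
  qed
  also have "\<dots> = 1" using k by simp
  finally show ?thesis .
qed

lemma half_line_pos: "half_line (\<lambda>x. 0 < x)"
  by unfold_locales auto

lemma half_line_nonpos: "half_line (\<lambda>x. x \<le> 0)"
  by unfold_locales auto

locale iid_walk =
  fixes \<nu> :: "real measure"
  assumes prob_\<nu>: "prob_space \<nu>" and sets_\<nu> [measurable_cong]: "sets \<nu> = sets borel"

sublocale iid_walk \<subseteq> sequence_space \<nu>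
  by (intro sequence_space.intro product_prob_space.intro product_prob_space_axioms.intro
      product_sigma_finite.intro prob_\<nu> prob_space_imp_sigma_finite)

context iid_walk
begin

abbreviation paths :: "(nat \<Rightarrow> real) measure" where
  "paths \<equiv> \<Pi>\<^sub>M i\<in>(UNIV::nat set). \<nu>"

lemma space_paths [simp]: "space paths = UNIV"
  using sets_eq_imp_space_eq[OF sets_\<nu>] by (auto simp: space_PiM)

lemma measure_paths_UNIV [simp]: "measure paths UNIV = 1"
  using P.prob_space by simp

lemma measurable_partial_sum [measurable]: "(\<lambda>\<omega>. partial_sum \<omega> n) \<in> borel_measurable paths"
  unfolding partial_sum_def by measurable

lemma measurable_ladder [measurable]:
  assumes [measurable]: "Measurable.pred borel C"
  shows "Measurable.pred paths (\<lambda>\<omega>. ladder C \<omega> n)"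
  unfolding ladder_def by measurable

lemma measurable_stays [measurable]:
  assumes [measurable]: "Measurable.pred borel C"
  shows "Measurable.pred paths (\<lambda>\<omega>. stays C \<omega> n)"
  unfolding stays_def by measurable

lemma integrable_bounded:
  fixes f :: "(nat \<Rightarrow> real) \<Rightarrow> real"
  assumes "f \<in> borel_measurable paths" "\<And>\<omega>. \<bar>f \<omega>\<bar> \<le> B"
  shows "integrable paths f"
  using assms by (intro P.integrable_const_bound[where B = B]) auto

lemma integral_comb_seq:
  fixes f :: "(nat \<Rightarrow> real) \<Rightarrow> real"
  assumes f [measurable]: "f \<in> borel_measurable paths" and B: "\<And>\<omega>. \<bar>f \<omega>\<bar> \<le> B"
  shows "(\<integral>\<omega>. f \<omega> \<partial>paths) = (\<integral>\<omega>. (\<integral>\<omega>'. f (comb_seq k \<omega> \<omega>') \<partial>paths) \<partial>paths)"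
proof -
  interpret PP: pair_prob_space paths paths ..
  have "(\<integral>\<omega>. f \<omega> \<partial>paths) = (\<integral>\<omega>. f \<omega> \<partial>distr (paths \<Otimes>\<^sub>M paths) paths (\<lambda>(\<omega>, \<omega>'). comb_seq k \<omega> \<omega>'))"
    by (subst PiM_comb_seq) simp
  also have "\<dots> = (\<integral>z. f (case z of (\<omega>, \<omega>') \<Rightarrow> comb_seq k \<omega> \<omega>') \<partial>(paths \<Otimes>\<^sub>M paths))"
    by (rule integral_distr) (auto intro: measurable_comb_seq f)
  also have "\<dots> = (\<integral>(\<omega>, \<omega>'). f (comb_seq k \<omega> \<omega>') \<partial>(paths \<Otimes>\<^sub>M paths))"
    by (simp add: case_prod_beta')
  also have "\<dots> = (\<integral>\<omega>. (\<integral>\<omega>'. f (comb_seq k \<omega> \<omega>') \<partial>paths) \<partial>paths)"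
  proof -
    have "integrable (paths \<Otimes>\<^sub>M paths) (\<lambda>(\<omega>, \<omega>'). f (comb_seq k \<omega> \<omega>'))"
      using B by (intro PP.integrable_const_bound[where B = B]) (auto simp: case_prod_beta')
    from PP.integral_fst'[OF this] show ?thesis by simp
  qed
  finally show ?thesis .
qed

lemma measurable_reindex: "(\<lambda>\<omega> i. \<omega> (\<pi> i)) \<in> measurable paths paths"
  using sets_eq_imp_space_eq[OF sets_\<nu>]
  by (intro measurable_PiM_single' measurable_component_singleton) auto

lemma integral_reindex:
  fixes f :: "(nat \<Rightarrow> real) \<Rightarrow> real"
  assumes [measurable]: "f \<in> borel_measurable paths" and "inj \<pi>"
  shows "(\<integral>\<omega>. f (\<lambda>i. \<omega> (\<pi> i)) \<partial>paths) = (\<integral>\<omega>. f \<omega> \<partial>paths)"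
proof -
  have "distr paths paths (\<lambda>\<omega> i. \<omega> (\<pi> i)) = paths"
    using distr_PiM_reindex[of UNIV "\<lambda>_. \<nu>" \<pi> UNIV] assms(2) prob_\<nu> by (simp add: restrict_def)
  then have "(\<integral>\<omega>. f \<omega> \<partial>paths) = (\<integral>\<omega>. f \<omega> \<partial>distr paths paths (\<lambda>\<omega> i. \<omega> (\<pi> i)))" by simp
  also have "\<dots> = (\<integral>\<omega>. f (\<lambda>i. \<omega> (\<pi> i)) \<partial>paths)"
    by (rule integral_distr[OF measurable_reindex assms(1)])
  finally show ?thesis by simp
qed

lemma integral_split_product:
  fixes f g :: "(nat \<Rightarrow> real) \<Rightarrow> real"
  assumes [measurable]: "f \<in> borel_measurable paths" "g \<in> borel_measurable paths"
    and B: "\<And>\<omega>. \<bar>f \<omega>\<bar> \<le> B" "\<And>\<omega>. \<bar>g \<omega>\<bar> \<le> B'"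
    and f: "\<And>\<omega> \<omega>'. f (comb_seq k \<omega> \<omega>') = f \<omega>"
  shows "(\<integral>\<omega>. f \<omega> * g (\<lambda>i. \<omega> (k + i)) \<partial>paths) = (\<integral>\<omega>. f \<omega> \<partial>paths) * (\<integral>\<omega>. g \<omega> \<partial>paths)"
proof -
  have [measurable]: "(\<lambda>\<omega>. g (\<lambda>i. \<omega> (k + i))) \<in> borel_measurable paths"
    by (rule measurable_compose[OF _ assms(2)]) (rule measurable_reindex)
  have "(\<integral>\<omega>. f \<omega> * g (\<lambda>i. \<omega> (k + i)) \<partial>paths) = (\<integral>\<omega>. (\<integral>\<omega>'. f \<omega> * g \<omega>' \<partial>paths) \<partial>paths)"
    by (subst integral_comb_seq[where k = k and B = "B * B'"])
       (auto simp: f comb_seq_shift abs_mult intro!: mult_mono B intro: order_trans[OF abs_ge_zero B(1)])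
  then show ?thesis by simp
qed

lemma integral_perm:
  fixes f :: "(nat \<Rightarrow> real) \<Rightarrow> real"
  assumes xs: "xs \<in> permutations_of_set {..<n}"
    and f: "f \<in> borel_measurable paths" and dep: "\<And>\<omega> \<omega>'. (\<And>i. i < n \<Longrightarrow> \<omega> i = \<omega>' i) \<Longrightarrow> f \<omega> = f \<omega>'"
  shows "(\<integral>\<omega>. f (\<lambda>i. \<omega> (xs ! i)) \<partial>paths) = (\<integral>\<omega>. f \<omega> \<partial>paths)"
proof -
  have d: "distinct xs" "set xs = {..<n}" "length xs = n"
    using xs length_finite_permutations_of_set[OF xs] by (auto dest: permutations_of_setD)
  define \<pi> where "\<pi> i = (if i < n then xs ! i else i)" for i
  have inj: "inj \<pi>"
  proof (rule injI)
    fix i j assume "\<pi> i = \<pi> j"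
    moreover have "xs ! l < n" if "l < n" for l using d that nth_mem[of l xs] by auto
    ultimately show "i = j" using d nth_eq_iff_index_eq[of xs i j]
      by (auto simp: \<pi>_def split: if_splits)
  qed
  have "(\<integral>\<omega>. f (\<lambda>i. \<omega> (xs ! i)) \<partial>paths) = (\<integral>\<omega>. f (\<lambda>i. \<omega> (\<pi> i)) \<partial>paths)"
    by (intro Bochner_Integration.integral_cong refl dep) (simp add: \<pi>_def)
  also have "\<dots> = (\<integral>\<omega>. f \<omega> \<partial>paths)" by (rule integral_reindex[OF f inj])
  finally show ?thesis .
qed

end

locale iid_walk_half_line = iid_walk + half_line +
  assumes C_measurable [measurable]: "Measurable.pred borel C"
  fixes \<kappa> :: real
  assumes weight_le_1: "C x \<Longrightarrow> \<kappa> * x \<le> 0"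
begin

definition ladder_weight :: "nat \<Rightarrow> real" where
  "ladder_weight n = (\<integral>\<omega>. of_bool (ladder C \<omega> n) * exp (\<kappa> * partial_sum \<omega> n) \<partial>paths)"

definition sum_weight :: "nat \<Rightarrow> real" where
  "sum_weight n = (\<integral>\<omega>. of_bool (C (partial_sum \<omega> n)) * exp (\<kappa> * partial_sum \<omega> n) \<partial>paths)"

lemma exp_le_1: "of_bool (C x) * exp (\<kappa> * x) \<le> 1"
  using weight_le_1[of x] by (cases "C x") auto

lemma ladder_imp: "ladder C \<omega> n \<Longrightarrow> n = 0 \<or> C (partial_sum \<omega> n)"
  by (cases "n = 0") (auto simp: ladder_def dest!: bspec[of _ _ 0])

lemma ladder_exp_le_1: "of_bool (ladder C \<omega> n) * exp (\<kappa> * partial_sum \<omega> n) \<le> 1"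
  using ladder_imp[of \<omega> n] weight_le_1 by (cases "ladder C \<omega> n") auto

lemma ladder_weight_nonneg: "0 \<le> ladder_weight n"
  unfolding ladder_weight_def by (intro integral_nonneg_AE) auto

lemma ladder_weight_0: "ladder_weight 0 = 1"
  by (simp add: ladder_weight_def ladder_def)

lemma integral_suffixes_perm:
  assumes xs: "xs \<in> permutations_of_set {..<n}"
  shows "(\<integral>\<omega>. of_bool (suffixes_in C (map \<omega> xs)) * exp (\<kappa> * partial_sum \<omega> n) \<partial>paths) = ladder_weight n"
proof -
  have l: "length xs = n" using length_finite_permutations_of_set[OF xs] by simp
  have "partial_sum (\<lambda>i. \<omega> (xs ! i)) n = partial_sum \<omega> n" for \<omega>
  proof -
    have "partial_sum (\<lambda>i. \<omega> (xs ! i)) n = sum_list (map \<omega> xs)"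
      using take_upt_map[of n n "\<lambda>i. \<omega> (xs ! i)"] map_nth_upt[OF l, of \<omega>] l by simp
    then show ?thesis using sum_list_permutation[OF xs, of \<omega>] by (simp add: partial_sum_def)
  qed
  moreover have "suffixes_in C (map \<omega> xs) = ladder C (\<lambda>i. \<omega> (xs ! i)) n" for \<omega>
    by (simp add: map_nth_upt[OF l] flip: suffixes_in_upt)
  ultimately have "(\<integral>\<omega>. of_bool (suffixes_in C (map \<omega> xs)) * exp (\<kappa> * partial_sum \<omega> n) \<partial>paths)
      = (\<integral>\<omega>. of_bool (ladder C (\<lambda>i. \<omega> (xs ! i)) n) * exp (\<kappa> * partial_sum (\<lambda>i. \<omega> (xs ! i)) n) \<partial>paths)"
    by simp
  also have "\<dots> = ladder_weight n" unfolding ladder_weight_def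
  proof (rule integral_perm[OF xs, where f = "\<lambda>\<omega>. of_bool (ladder C \<omega> n) * exp (\<kappa> * partial_sum \<omega> n)"])
    fix \<omega> \<omega>' :: "nat \<Rightarrow> real" assume "\<And>i. i < n \<Longrightarrow> \<omega> i = \<omega>' i"
    then have "partial_sum \<omega> i = partial_sum \<omega>' i" if "i \<le> n" for i
      using that by (intro partial_sum_cong) auto
    then show "of_bool (ladder C \<omega> n) * exp (\<kappa> * partial_sum \<omega> n) = of_bool (ladder C \<omega>' n) * exp (\<kappa> * partial_sum \<omega>' n)"
      by (simp add: ladder_def)
  qed measurable
  finally show ?thesis .
qed

lemma integral_block_perm:
  assumes B: "B \<subseteq> {..<n}" and vs: "vs \<in> permutations_of_set ({..<n} - B)"
  shows "(\<integral>\<omega>. of_bool (C (sum \<omega> B)) * of_bool (suffixes_in C (map \<omega> vs)) * exp (\<kappa> * partial_sum \<omega> n) \<partial>paths)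
     = sum_weight (card B) * ladder_weight (n - card B)"
proof -
  define k where "k = card B"
  have finB: "finite B" using B finite_subset by blast
  obtain us where us: "us \<in> permutations_of_set B"
    using finB by (metis ex_in_conv permutations_of_set_empty_iff)
  define xs where "xs = us @ vs"
  have xs: "xs \<in> permutations_of_set {..<n}"
    using us vs B by (auto simp: xs_def permutations_of_set_def)
  have l: "length xs = n" using length_finite_permutations_of_set[OF xs] by simp
  have lu: "length us = k" using length_finite_permutations_of_set[OF us] by (simp add: k_def)
  have kn: "k \<le> n" using l lu by (simp add: xs_def)
  define f where "f = (\<lambda>\<omega>. of_bool (C (partial_sum \<omega> k)) * exp (\<kappa> * partial_sum \<omega> k))"
  define g where "g = (\<lambda>\<omega>. of_bool (ladder C \<omega> (n - k)) * exp (\<kappa> * partial_sum \<omega> (n - k)))"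
  have fm [measurable]: "f \<in> borel_measurable paths" "g \<in> borel_measurable paths"
    unfolding f_def g_def by measurable
  have m2 [measurable]: "(\<lambda>\<omega>. g (\<lambda>i. \<omega> (k + i))) \<in> borel_measurable paths"
    by (rule measurable_compose[OF _ fm(2)]) (rule measurable_reindex)
  have eq: "of_bool (C (sum \<omega> B)) * of_bool (suffixes_in C (map \<omega> vs)) * exp (\<kappa> * partial_sum \<omega> n)
      = f (\<lambda>i. \<omega> (xs ! i)) * g (\<lambda>i. \<omega> (xs ! (k + i)))" for \<omega>
  proof -
    have 1: "partial_sum (\<lambda>i. \<omega> (xs ! i)) n = partial_sum \<omega> n"
    proof -
      have "partial_sum (\<lambda>i. \<omega> (xs ! i)) n = sum_list (map \<omega> xs)"
        using take_upt_map[of n n "\<lambda>i. \<omega> (xs ! i)"] map_nth_upt[OF l, of \<omega>] l by simp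
      then show ?thesis using sum_list_permutation[OF xs, of \<omega>] by (simp add: partial_sum_def)
    qed
    have 2: "partial_sum (\<lambda>i. \<omega> (xs ! i)) k = sum \<omega> B"
    proof -
      have "partial_sum (\<lambda>i. \<omega> (xs ! i)) k = partial_sum (\<lambda>i. \<omega> (us ! i)) k"
        by (intro partial_sum_cong) (simp add: xs_def nth_append lu)
      also have "\<dots> = sum_list (map \<omega> us)"
        using take_upt_map[of k k "\<lambda>i. \<omega> (us ! i)"] map_nth_upt[OF lu, of \<omega>] lu by simp
      finally show ?thesis using sum_list_permutation[OF us, of \<omega>] by simp
    qed
    have 3: "map \<omega> vs = map (\<lambda>i. \<omega> (xs ! (k + i))) [0..<n - k]"
      using l lu by (intro nth_equalityI) (auto simp: xs_def nth_append)
    have 4: "partial_sum (\<lambda>i. \<omega> (xs ! (k + i))) (n - k) = partial_sum \<omega> n - sum \<omega> B"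
      using partial_sum_shift[of "\<lambda>i. \<omega> (xs ! i)" k "n - k"] kn 1 2 by simp
    show ?thesis unfolding f_def g_def 2 3 suffixes_in_upt 4
      by (simp add: right_diff_distrib exp_diff)
  qed
  have "(\<integral>\<omega>. of_bool (C (sum \<omega> B)) * of_bool (suffixes_in C (map \<omega> vs)) * exp (\<kappa> * partial_sum \<omega> n) \<partial>paths)
     = (\<integral>\<omega>. f \<omega> * g (\<lambda>i. \<omega> (k + i)) \<partial>paths)"
    unfolding eq
  proof (rule integral_perm[OF xs, where f = "\<lambda>\<omega>. f \<omega> * g (\<lambda>i. \<omega> (k + i))"])
    fix \<omega> \<omega>' :: "nat \<Rightarrow> real" assume *: "\<And>i. i < n \<Longrightarrow> \<omega> i = \<omega>' i"
    then have "partial_sum \<omega> k = partial_sum \<omega>' k" using kn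
      by (intro partial_sum_cong) auto
    moreover have "partial_sum (\<lambda>i. \<omega> (k + i)) j = partial_sum (\<lambda>i. \<omega>' (k + i)) j" if "j \<le> n - k" for j
      using that kn * by (intro partial_sum_cong) auto
    ultimately show "f \<omega> * g (\<lambda>i. \<omega> (k + i)) = f \<omega>' * g (\<lambda>i. \<omega>' (k + i))"
      by (simp add: f_def g_def ladder_def)
  qed measurable
  also have "\<dots> = (\<integral>\<omega>. f \<omega> \<partial>paths) * (\<integral>\<omega>. g \<omega> \<partial>paths)"
  proof (rule integral_split_product[where B = 1 and B' = 1])
    show "\<bar>f \<omega>\<bar> \<le> 1" for \<omega> using exp_le_1 by (simp add: f_def abs_mult)
    show "\<bar>g \<omega>\<bar> \<le> 1" for \<omega> using ladder_exp_le_1 by (simp add: g_def abs_mult)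
    show "f (comb_seq k \<omega> \<omega>') = f \<omega>" for \<omega> \<omega>' by (simp add: f_def partial_sum_comb_seq_le)
  qed measurable
  finally show ?thesis unfolding f_def g_def sum_weight_def ladder_weight_def k_def .
qed

theorem spitzer: "real n * ladder_weight n = (\<Sum>k=1..n. sum_weight k * ladder_weight (n - k))"
proof -
  let ?A = "{..<n}"
  let ?e = "\<lambda>\<omega>. exp (\<kappa> * partial_sum \<omega> n)"
  let ?L = "\<lambda>xs \<omega>. of_bool (suffixes_in C (map \<omega> xs)) * ?e \<omega> :: real"
  let ?R = "\<lambda>B vs \<omega>. of_bool (C (sum \<omega> B)) * of_bool (suffixes_in C (map \<omega> vs)) * ?e \<omega> :: real"
  have suff_meas [measurable]: "Measurable.pred paths (\<lambda>\<omega>. suffixes_in C (map \<omega> xs))" for xs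
  proof -
    have "Measurable.pred paths (\<lambda>\<omega>. \<forall>i\<in>{..<length xs}. C (\<Sum>j\<in>{i..<length xs}. \<omega> (xs ! j)))"
      by measurable
    moreover have "sum_list (drop i (map \<omega> xs)) = (\<Sum>j\<in>{i..<length xs}. \<omega> (xs ! j))" for i and \<omega> :: "nat \<Rightarrow> real"
      by (simp add: sum_list_sum_nth drop_map) (rule sum.reindex_bij_witness[of _ "\<lambda>j. j - i" "\<lambda>j. i + j"]; auto)
    ultimately show ?thesis by (simp add: suffixes_in_def Ball_def)
  qed
  have suffix_perms_eq: "suffix_perms C \<omega> B = (\<Sum>xs\<in>permutations_of_set B. of_bool (suffixes_in C (map \<omega> xs)))" for \<omega> B
    by (simp add: suffix_perms_def of_bool_def sum.If_cases Int_def)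
  have L: "real n * suffix_perms C \<omega> ?A * ?e \<omega> = real n * (\<Sum>xs\<in>permutations_of_set ?A. ?L xs \<omega>)" for \<omega>
    by (simp add: suffix_perms_eq sum_distrib_right mult.assoc)
  have R: "subset_conv (block_weight C \<omega>) (suffix_perms C \<omega>) ?A * ?e \<omega>
      = (\<Sum>B\<in>Pow ?A - {{}}. fact (card B) * (\<Sum>vs\<in>permutations_of_set (?A - B). ?R B vs \<omega>))" for \<omega>
  proof -
    have "subset_conv (block_weight C \<omega>) (suffix_perms C \<omega>) ?A * ?e \<omega>
      = (\<Sum>B\<in>Pow ?A. block_weight C \<omega> B * suffix_perms C \<omega> (?A - B) * ?e \<omega>)"
      by (simp add: subset_conv_def sum_distrib_right)
    also have "\<dots> = (\<Sum>B\<in>Pow ?A - {{}}. block_weight C \<omega> B * suffix_perms C \<omega> (?A - B) * ?e \<omega>)"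
      by (rule sum.mono_neutral_right) (auto simp: block_weight_def)
    also have "\<dots> = (\<Sum>B\<in>Pow ?A - {{}}. fact (card B) * (\<Sum>vs\<in>permutations_of_set (?A - B). ?R B vs \<omega>))"
      by (intro sum.cong refl) (auto simp: block_weight_def suffix_perms_eq sum_distrib_left sum_distrib_right mult_ac)
    finally show ?thesis .
  qed
  have Lint: "integrable paths (?L xs)" if xs: "xs \<in> permutations_of_set ?A" for xs
  proof (rule integrable_bounded[where B = 1])
    fix \<omega>
    show "\<bar>?L xs \<omega>\<bar> \<le> 1"
    proof (cases "suffixes_in C (map \<omega> xs) \<and> xs \<noteq> []")
      case True
      then have "C (sum_list (drop 0 (map \<omega> xs)))" unfolding suffixes_in_def by fastforce
      then have "C (partial_sum \<omega> n)" using sum_list_permutation[OF xs, of \<omega>] by (simp add: partial_sum_def)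
      then show ?thesis using weight_le_1 by (simp add: abs_mult)
    next
      case False
      moreover have "n = 0" if "xs = []" using xs that by (auto simp: permutations_of_set_def lessThan_empty_iff)
      ultimately show ?thesis by auto
    qed
  qed measurable
  have Rint: "integrable paths (?R B vs)" if B: "B \<in> Pow ?A - {{}}" and vs: "vs \<in> permutations_of_set (?A - B)" for B vs
  proof (rule integrable_bounded[where B = 1])
    fix \<omega>
    show "\<bar>?R B vs \<omega>\<bar> \<le> 1"
    proof (cases "C (sum \<omega> B) \<and> suffixes_in C (map \<omega> vs)")
      case True
      have s: "partial_sum \<omega> n = sum \<omega> B + sum \<omega> (?A - B)"
        unfolding partial_sum_def using B by (intro sum.subset_diff[THEN trans] ) (auto simp: add.commute)
      have "C (partial_sum \<omega> n)"
      proof (cases "vs = []")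
        case True
        then have "?A - B = {}" using vs by (auto simp: permutations_of_set_def)
        then have "sum \<omega> (?A - B) = 0" by (metis sum.empty)
        then show ?thesis using s \<open>C (sum \<omega> B) \<and> _\<close> by simp
      next
        case False
        then have "C (sum_list (drop 0 (map \<omega> vs)))" using True unfolding suffixes_in_def by fastforce
        then have "C (sum \<omega> (?A - B))" using sum_list_permutation[OF vs, of \<omega>] by simp
        then show ?thesis using s True add by simp
      qed
      then show ?thesis using weight_le_1 by (simp add: abs_mult)
    qed auto
  qed measurable
  have "real n * (fact n * ladder_weight n) = (\<integral>\<omega>. real n * suffix_perms C \<omega> ?A * ?e \<omega> \<partial>paths)"
  proof -
    have "(\<integral>\<omega>. real n * suffix_perms C \<omega> ?A * ?e \<omega> \<partial>paths) = real n * (\<integral>\<omega>. (\<Sum>xs\<in>permutations_of_set ?A. ?L xs \<omega>) \<partial>paths)"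
      unfolding L by (rule integral_mult_right_zero)
    also have "(\<integral>\<omega>. (\<Sum>xs\<in>permutations_of_set ?A. ?L xs \<omega>) \<partial>paths) = (\<Sum>xs\<in>permutations_of_set ?A. ladder_weight n)"
      by (subst Bochner_Integration.integral_sum[OF Lint], assumption) (intro sum.cong refl integral_suffixes_perm)
    finally show ?thesis by simp
  qed
  also have "\<dots> = (\<integral>\<omega>. subset_conv (block_weight C \<omega>) (suffix_perms C \<omega>) ?A * ?e \<omega> \<partial>paths)"
    using card_times_suffix_perms[of ?A] by simp
  also have "\<dots> = (\<Sum>B\<in>Pow ?A - {{}}. fact (card B) * (\<Sum>vs\<in>permutations_of_set (?A - B). \<integral>\<omega>. ?R B vs \<omega> \<partial>paths))"
    unfolding R using Rint
    by (subst Bochner_Integration.integral_sum)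
       (auto intro!: Bochner_Integration.integrable_sum sum.cong simp: Bochner_Integration.integral_sum)
  also have "\<dots> = (\<Sum>B\<in>Pow ?A - {{}}. fact (card B) * (fact (n - card B) * (sum_weight (card B) * ladder_weight (n - card B))))"
  proof (intro sum.cong refl arg_cong[where f = "\<lambda>x. fact _ * x"])
    fix B assume B: "B \<in> Pow ?A - {{}}"
    then have "finite B" "B \<subseteq> ?A" using finite_subset[of B ?A] by auto
    then have "card (?A - B) = n - card B" by (simp add: card_Diff_subset)
    then show "(\<Sum>vs\<in>permutations_of_set (?A - B). \<integral>\<omega>. ?R B vs \<omega> \<partial>paths)
        = fact (n - card B) * (sum_weight (card B) * ladder_weight (n - card B))"
      using B by (simp add: integral_block_perm)
  qed
  also have "\<dots> = (\<Sum>B\<in>Pow ?A. if card B = 0 then 0 else fact (card B) * (fact (n - card B) * (sum_weight (card B) * ladder_weight (n - card B))))"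
    by (rule sum.mono_neutral_cong_left) (auto simp: finite_subset card_eq_0_iff)
  also have "\<dots> = (\<Sum>k\<le>n. real (n choose k) * (if k = 0 then 0 else fact k * (fact (n - k) * (sum_weight k * ladder_weight (n - k)))))"
    using sum_Pow_by_card[of ?A "\<lambda>k. if k = 0 then 0 else fact k * (fact (n - k) * (sum_weight k * ladder_weight (n - k)))"] by simp
  also have "\<dots> = (\<Sum>k\<le>n. if k = 0 then 0 else fact n * (sum_weight k * ladder_weight (n - k)))"
    by (intro sum.cong refl) (auto simp: binomial_fact)
  also have "\<dots> = (\<Sum>k=1..n. fact n * (sum_weight k * ladder_weight (n - k)))"
    by (rule sum.mono_neutral_cong_right) auto
  also have "\<dots> = fact n * (\<Sum>k=1..n. sum_weight k * ladder_weight (n - k))"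
    by (simp add: sum_distrib_left)
  finally show ?thesis by simp
qed

end

section \<open>Ladder weights\<close>

lemma (in iid_walk) sets_Collect_paths: "Measurable.pred paths Q \<Longrightarrow> {\<omega>. Q \<omega>} \<in> sets paths"
  by (simp add: pred_def)

context iid_walk_half_line
begin

lemma ladder_weight_stays:
  "ladder_weight n = (\<integral>\<omega>. of_bool (stays C \<omega> n) * exp (\<kappa> * partial_sum \<omega> n) \<partial>paths)"
proof -
  have "rev [0..<n] \<in> permutations_of_set {..<n}" by (auto simp: permutations_of_set_def)
  from integral_suffixes_perm[OF this] show ?thesis
    by (simp add: suffixes_in_rev prefixes_in_upt flip: rev_map)
qed

definition first_ladder :: "(nat \<Rightarrow> real) \<Rightarrow> nat \<Rightarrow> bool" where
  "first_ladder \<omega> j \<longleftrightarrow> C (partial_sum \<omega> j) \<and> (\<forall>i\<in>{1..<j}. \<not> C (partial_sum \<omega> i))"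

lemma measurable_first_ladder [measurable]: "Measurable.pred paths (\<lambda>\<omega>. first_ladder \<omega> j)"
  unfolding first_ladder_def by measurable

lemma first_ladder_unique:
  assumes "first_ladder \<omega> i" "first_ladder \<omega> j" "1 \<le> i" "1 \<le> j"
  shows "i = j"
  using assms unfolding first_ladder_def
  by (metis atLeastLessThan_iff linorder_neqE_nat)

lemma sum_first_ladder_le: "(\<Sum>j=1..n. of_bool (first_ladder \<omega> j)) \<le> (1 :: real)"
proof (cases "\<exists>j\<in>{1..n}. first_ladder \<omega> j")
  case True
  then obtain j where j: "j \<in> {1..n}" "first_ladder \<omega> j" by blast
  have "(\<Sum>i=1..n. of_bool (first_ladder \<omega> i)) = (\<Sum>i=1..n. if i = j then 1 else 0 :: real)"
  proof (intro sum.cong refl)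
    fix i assume "i \<in> {1..n}"
    then have "first_ladder \<omega> i \<longleftrightarrow> i = j"
      using first_ladder_unique[of \<omega> i j] j by (metis atLeastAtMost_iff)
    then show "of_bool (first_ladder \<omega> i) = (if i = j then 1 else 0 :: real)" by simp
  qed
  then show ?thesis by simp
next
  case False
  then have "(\<Sum>i=1..n. of_bool (first_ladder \<omega> i)) = (0 :: real)" by (intro sum.neutral) auto
  then show ?thesis by simp
qed

lemma ladder_iff_first_ladder:
  assumes n: "1 \<le> n"
  shows "ladder C \<omega> n \<longleftrightarrow> (\<exists>j\<in>{1..n}. first_ladder \<omega> j \<and> ladder C (\<lambda>i. \<omega> (j + i)) (n - j))"
proof
  assume l: "ladder C \<omega> n"
  then have "C (partial_sum \<omega> n)" using n ladder_imp[of \<omega> n] by auto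
  define j where "j = (LEAST j. 1 \<le> j \<and> C (partial_sum \<omega> j))"
  have j: "1 \<le> j \<and> C (partial_sum \<omega> j)" unfolding j_def
    by (rule LeastI[of _ n]) (use n \<open>C (partial_sum \<omega> n)\<close> in auto)
  have least: "\<not> (1 \<le> i \<and> C (partial_sum \<omega> i))" if "i < j" for i
    using that unfolding j_def by (rule not_less_Least)
  have "j \<le> n" unfolding j_def by (rule Least_le) (use n \<open>C (partial_sum \<omega> n)\<close> in auto)
  moreover have "first_ladder \<omega> j"
    unfolding first_ladder_def using j least by auto
  moreover have "ladder C (\<lambda>i. \<omega> (j + i)) (n - j)"
    using l \<open>j \<le> n\<close> by (auto simp: ladder_def partial_sum_shift)
  ultimately show "\<exists>j\<in>{1..n}. first_ladder \<omega> j \<and> ladder C (\<lambda>i. \<omega> (j + i)) (n - j)"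
    using j by auto
next
  assume "\<exists>j\<in>{1..n}. first_ladder \<omega> j \<and> ladder C (\<lambda>i. \<omega> (j + i)) (n - j)"
  then obtain j where j: "1 \<le> j" "j \<le> n" "first_ladder \<omega> j" "ladder C (\<lambda>i. \<omega> (j + i)) (n - j)" by auto
  have after: "C (partial_sum \<omega> n - partial_sum \<omega> i)" if "j \<le> i" "i < n" for i
    using j(4) j(2) that unfolding ladder_def partial_sum_shift
    by (auto dest!: bspec[of _ _ "i - j"])
  have before: "C (partial_sum \<omega> j - partial_sum \<omega> i)" if "i < j" for i
    using j(3) that add_not[of "partial_sum \<omega> i" "partial_sum \<omega> j - partial_sum \<omega> i"]
    by (cases "i = 0") (auto simp: first_ladder_def)
  show "ladder C \<omega> n" unfolding ladder_def
  proof
    fix i assume i: "i \<in> {..<n}"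
    show "C (partial_sum \<omega> n - partial_sum \<omega> i)"
    proof (cases "j \<le> i")
      case False
      show ?thesis
      proof (cases "j = n")
        case True
        then show ?thesis using before False by auto
      next
        case False2: False
        then show ?thesis using add[OF after[of j] before[of i]] j False by auto
      qed
    qed (use after i in auto)
  qed
qed

lemma of_bool_ladder_eq:
  assumes n: "1 \<le> n"
  shows "of_bool (ladder C \<omega> n) = (\<Sum>j=1..n. of_bool (first_ladder \<omega> j) * of_bool (ladder C (\<lambda>i. \<omega> (j + i)) (n - j)) :: real)"
proof (cases "ladder C \<omega> n")
  case True
  then obtain j where j: "j \<in> {1..n}" "first_ladder \<omega> j" "ladder C (\<lambda>i. \<omega> (j + i)) (n - j)"
    using ladder_iff_first_ladder[OF n] by blast
  have "(\<Sum>i=1..n. of_bool (first_ladder \<omega> i) * of_bool (ladder C (\<lambda>k. \<omega> (i + k)) (n - i)))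
      = (\<Sum>i=1..n. if i = j then 1 else 0 :: real)"
  proof (intro sum.cong refl)
    fix i assume i: "i \<in> {1..n}"
    show "of_bool (first_ladder \<omega> i) * of_bool (ladder C (\<lambda>k. \<omega> (i + k)) (n - i)) = (if i = j then 1 else 0 :: real)"
    proof (cases "i = j")
      case False
      then have "\<not> first_ladder \<omega> i" using first_ladder_unique[of \<omega> i j] j i by auto
      then show ?thesis using False by simp
    qed (use j in simp)
  qed
  then show ?thesis using True j by simp
next
  case False
  then have "(\<Sum>j=1..n. of_bool (first_ladder \<omega> j) * of_bool (ladder C (\<lambda>i. \<omega> (j + i)) (n - j))) = (0 :: real)"
    using ladder_iff_first_ladder[OF n, of \<omega>] by (intro sum.neutral) auto
  then show ?thesis using False by simp
qed

definition first_weight :: "nat \<Rightarrow> real" where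
  "first_weight j = (\<integral>\<omega>. of_bool (first_ladder \<omega> j) * exp (\<kappa> * partial_sum \<omega> j) \<partial>paths)"

lemma first_exp_le_1: "of_bool (first_ladder \<omega> j) * exp (\<kappa> * partial_sum \<omega> j) \<le> 1"
  using weight_le_1 by (cases "first_ladder \<omega> j") (auto simp: first_ladder_def)

lemma ladder_weight_renewal:
  assumes n: "1 \<le> n"
  shows "ladder_weight n = (\<Sum>j=1..n. first_weight j * ladder_weight (n - j))"
proof -
  let ?f = "\<lambda>j \<omega>. of_bool (first_ladder \<omega> j) * exp (\<kappa> * partial_sum \<omega> j) :: real"
  let ?g = "\<lambda>j \<omega>. of_bool (ladder C \<omega> (n - j)) * exp (\<kappa> * partial_sum \<omega> (n - j)) :: real"
  have m [measurable]: "(\<lambda>\<omega>. ?g j (\<lambda>i. \<omega> (j + i))) \<in> borel_measurable paths" for j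
  proof -
    have "?g j \<in> borel_measurable paths" by measurable
    then show ?thesis by (rule measurable_compose[OF measurable_reindex])
  qed
  have b: "\<bar>?f j \<omega>\<bar> \<le> 1" "\<bar>?g j \<omega>\<bar> \<le> 1" for j \<omega>
    using first_exp_le_1 ladder_exp_le_1 by (auto simp: abs_mult)
  have "ladder_weight n = (\<integral>\<omega>. (\<Sum>j=1..n. ?f j \<omega> * ?g j (\<lambda>i. \<omega> (j + i))) \<partial>paths)"
    unfolding ladder_weight_def of_bool_ladder_eq[OF n] sum_distrib_right
  proof (intro Bochner_Integration.integral_cong sum.cong refl)
    fix \<omega> j assume j: "j \<in> {1..n}"
    have "partial_sum \<omega> n = partial_sum \<omega> j + partial_sum (\<lambda>i. \<omega> (j + i)) (n - j)"
      using j by (simp add: partial_sum_shift)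
    then show "of_bool (first_ladder \<omega> j) * of_bool (ladder C (\<lambda>i. \<omega> (j + i)) (n - j)) * exp (\<kappa> * partial_sum \<omega> n) =
      ?f j \<omega> * ?g j (\<lambda>i. \<omega> (j + i))"
      by (simp add: distrib_left exp_add)
  qed
  also have "\<dots> = (\<Sum>j=1..n. \<integral>\<omega>. ?f j \<omega> * ?g j (\<lambda>i. \<omega> (j + i)) \<partial>paths)"
  proof (rule Bochner_Integration.integral_sum)
    fix j
    show "integrable paths (\<lambda>\<omega>. ?f j \<omega> * ?g j (\<lambda>i. \<omega> (j + i)))"
    proof (rule integrable_bounded[where B = "1 * 1"])
      show "\<bar>?f j \<omega> * ?g j (\<lambda>i. \<omega> (j + i))\<bar> \<le> 1 * 1" for \<omega>
        unfolding abs_mult[of "?f j \<omega>"] by (intro mult_mono b) auto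
    qed measurable
  qed
  also have "\<dots> = (\<Sum>j=1..n. first_weight j * ladder_weight (n - j))"
    unfolding first_weight_def ladder_weight_def
  proof (intro sum.cong refl integral_split_product[where B = 1 and B' = 1] b)
    fix j \<omega> \<omega>'
    show "?f j (comb_seq j \<omega> \<omega>') = ?f j \<omega>"
      by (simp add: first_ladder_def partial_sum_comb_seq_le)
  qed measurable
  finally show ?thesis .
qed

lemma sum_first_weight_le:
  "(\<Sum>j=1..n. first_weight j) \<le> 1 - (measure paths {\<omega>. C (\<omega> 0)} - sum_weight 1)"
proof (cases "n = 0")
  case True
  have "measure paths {\<omega>. C (\<omega> 0)} \<le> 1" by (rule P.prob_le_1)
  moreover have "0 \<le> sum_weight 1" unfolding sum_weight_def by (intro integral_nonneg_AE) auto
  ultimately have "0 \<le> 1 - (measure paths {\<omega>. C (\<omega> 0)} - sum_weight 1)" by linarith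
  then show ?thesis using True by simp
next
  case False
  have int: "integrable paths (\<lambda>\<omega>. of_bool (first_ladder \<omega> j) * exp (\<kappa> * partial_sum \<omega> j))" for j
    using first_exp_le_1 by (intro integrable_bounded[where B = 1]) (auto simp: abs_mult)
  have ps1: "partial_sum \<omega> 1 = \<omega> 0" for \<omega> by (simp add: partial_sum_def)
  have int1: "integrable paths (\<lambda>\<omega>. of_bool (C (\<omega> 0)) * exp (\<kappa> * \<omega> 0))"
    using exp_le_1 by (intro integrable_bounded[where B = 1]) (auto simp: abs_mult)
  have int2: "integrable paths (\<lambda>\<omega>. of_bool (C (\<omega> 0)) :: real)"
    by (intro integrable_bounded[where B = 1]) auto
  have "(\<Sum>j=1..n. first_weight j) = (\<integral>\<omega>. (\<Sum>j=1..n. of_bool (first_ladder \<omega> j) * exp (\<kappa> * partial_sum \<omega> j)) \<partial>paths)"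
    unfolding first_weight_def using int by (intro Bochner_Integration.integral_sum[symmetric]) auto
  also have "\<dots> \<le> (\<integral>\<omega>. 1 - (of_bool (C (\<omega> 0)) - of_bool (C (\<omega> 0)) * exp (\<kappa> * \<omega> 0)) \<partial>paths)"
  proof (rule integral_mono)
    fix \<omega>
    have "(\<Sum>j=1..n. of_bool (first_ladder \<omega> j) * exp (\<kappa> * partial_sum \<omega> j)) \<le>
      (\<Sum>j=1..n. of_bool (first_ladder \<omega> j) - (if j = 1 then of_bool (C (\<omega> 0)) - of_bool (C (\<omega> 0)) * exp (\<kappa> * \<omega> 0) else 0))"
    proof (rule sum_mono)
      fix j assume "j \<in> {1..n}"
      have "of_bool (first_ladder \<omega> j) * exp (\<kappa> * partial_sum \<omega> j) \<le> of_bool (first_ladder \<omega> j)"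
        using first_exp_le_1[of \<omega> j] by (cases "first_ladder \<omega> j") auto
      moreover have "first_ladder \<omega> 1 = C (\<omega> 0)" by (simp add: first_ladder_def partial_sum_def)
      ultimately show "of_bool (first_ladder \<omega> j) * exp (\<kappa> * partial_sum \<omega> j) \<le> of_bool (first_ladder \<omega> j)
          - (if j = 1 then of_bool (C (\<omega> 0)) - of_bool (C (\<omega> 0)) * exp (\<kappa> * \<omega> 0) else 0)"
        by (cases "j = 1") (auto simp: partial_sum_def)
    qed
    also have "\<dots> = (\<Sum>j=1..n. of_bool (first_ladder \<omega> j)) - (of_bool (C (\<omega> 0)) - of_bool (C (\<omega> 0)) * exp (\<kappa> * \<omega> 0))"
      using False unfolding sum_subtractf by (simp add: sum.delta)
    also have "\<dots> \<le> 1 - (of_bool (C (\<omega> 0)) - of_bool (C (\<omega> 0)) * exp (\<kappa> * \<omega> 0))"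
      using sum_first_ladder_le[of \<omega> n] by linarith
    finally show "(\<Sum>j=1..n. of_bool (first_ladder \<omega> j) * exp (\<kappa> * partial_sum \<omega> j)) \<le>
        1 - (of_bool (C (\<omega> 0)) - of_bool (C (\<omega> 0)) * exp (\<kappa> * \<omega> 0))" .
  next
    show "integrable paths (\<lambda>\<omega>. \<Sum>j=1..n. of_bool (first_ladder \<omega> j) * exp (\<kappa> * partial_sum \<omega> j))"
      by (intro Bochner_Integration.integrable_sum int)
    show "integrable paths (\<lambda>\<omega>. 1 - (of_bool (C (\<omega> 0)) - of_bool (C (\<omega> 0)) * exp (\<kappa> * \<omega> 0)))"
      by (intro Bochner_Integration.integrable_diff int1 int2) simp
  qed
  also have "\<dots> = 1 - (measure paths {\<omega>. C (\<omega> 0)} - sum_weight 1)"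
  proof -
    have "(\<integral>\<omega>. of_bool (C (\<omega> 0)) \<partial>paths) = (\<integral>\<omega>. indicator {\<omega>. C (\<omega> 0)} \<omega> \<partial>paths :: real)"
      by (intro Bochner_Integration.integral_cong) (auto simp: indicator_def)
    then have "(\<integral>\<omega>. of_bool (C (\<omega> 0)) \<partial>paths) = measure paths {\<omega>. C (\<omega> 0)}" by simp
    then show ?thesis using int1 int2 unfolding sum_weight_def ps1
      by (simp add: Bochner_Integration.integral_diff)
  qed
  finally show ?thesis .
qed

lemma first_weight_nonneg: "0 \<le> first_weight j"
  unfolding first_weight_def by (intro integral_nonneg_AE) auto

lemma summable_ladder_weight:
  assumes \<delta>: "sum_weight 1 < measure paths {\<omega>. C (\<omega> 0)}"
  shows "summable ladder_weight"
proof (rule summableI_nonneg_bounded[OF ladder_weight_nonneg])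
  define \<delta> where "\<delta> = measure paths {\<omega>. C (\<omega> 0)} - sum_weight 1"
  fix N
  have "(\<Sum>n\<le>N. ladder_weight n) = 1 + (\<Sum>n=1..N. ladder_weight n)"
    by (simp add: atMost_atLeast0 sum.atLeast_Suc_atMost ladder_weight_0)
  also have "(\<Sum>n=1..N. ladder_weight n) = (\<Sum>n=1..N. \<Sum>j=1..n. first_weight j * ladder_weight (n - j))"
    by (intro sum.cong ladder_weight_renewal) auto
  also have "\<dots> = (\<Sum>(n, j)\<in>Sigma {1..N} (\<lambda>n. {1..n}). first_weight j * ladder_weight (n - j))"
    by (rule sum.Sigma) auto
  also have "\<dots> = (\<Sum>(j, n)\<in>Sigma {1..N} (\<lambda>j. {..N - j}). first_weight j * ladder_weight n)"
    by (rule sum.reindex_bij_witness[of _ "\<lambda>(j, n). (n + j, j)" "\<lambda>(n, j). (j, n - j)"]) auto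
  also have "\<dots> = (\<Sum>j=1..N. \<Sum>n\<le>N - j. first_weight j * ladder_weight n)"
    by (rule sum.Sigma[symmetric]) auto
  also have "\<dots> \<le> (\<Sum>j=1..N. first_weight j * (\<Sum>n\<le>N. ladder_weight n))"
    unfolding sum_distrib_left using first_weight_nonneg ladder_weight_nonneg
    by (intro sum_mono sum_mono2) auto
  also have "\<dots> = (\<Sum>j=1..N. first_weight j) * (\<Sum>n\<le>N. ladder_weight n)"
    by (simp add: sum_distrib_right)
  also have "\<dots> \<le> (1 - \<delta>) * (\<Sum>n\<le>N. ladder_weight n)"
    using sum_first_weight_le[of N] ladder_weight_nonneg
    by (intro mult_right_mono sum_nonneg) (auto simp: \<delta>_def)
  finally have "\<delta> * (\<Sum>n\<le>N. ladder_weight n) \<le> 1" by (simp add: algebra_simps)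
  then have "(\<Sum>n\<le>N. ladder_weight n) \<le> 1 / \<delta>" using \<delta> by (simp add: \<delta>_def field_simps)
  moreover have "(\<Sum>n<N. ladder_weight n) \<le> (\<Sum>n\<le>N. ladder_weight n)"
    using ladder_weight_nonneg by (intro sum_mono2) auto
  ultimately show "(\<Sum>n<N. ladder_weight n) \<le> 1 / \<delta>" by linarith
qed

lemma ladder_weight_smaller:
  assumes "summable ladder_weight" "sum_weight \<longlonglongrightarrow> 0"
  shows "(\<lambda>n. real n * ladder_weight n) \<longlonglongrightarrow> 0"
proof -
  define g where "g k = (if k = 0 then 0 else sum_weight k)" for k
  have "\<forall>\<^sub>F k in sequentially. sum_weight k = g k"
    using eventually_gt_at_top[of 0] by eventually_elim (simp add: g_def)
  with assms(2) have "g \<longlonglongrightarrow> 0" by (rule Lim_transform_eventually)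
  then have "(\<lambda>n. \<Sum>k\<le>n. g k * ladder_weight (n - k)) \<longlonglongrightarrow> 0"
    by (intro convolution_tendsto_0 assms ladder_weight_nonneg)
  moreover have "(\<Sum>k\<le>n. g k * ladder_weight (n - k)) = real n * ladder_weight n" for n
    unfolding spitzer by (rule sum.mono_neutral_cong_right) (auto simp: g_def)
  ultimately show ?thesis by simp
qed

end

locale spitzer_walk = iid_walk +
  fixes \<rho> :: real
  assumes \<rho>: "0 < \<rho>" "\<rho> < 1"
    and positive_lim: "(\<lambda>n. measure paths {\<omega>. 0 < partial_sum \<omega> n}) \<longlonglongrightarrow> \<rho>"
    and concentration: "\<And>K. (\<lambda>n. measure paths {\<omega>. \<bar>partial_sum \<omega> n\<bar> \<le> K}) \<longlonglongrightarrow> 0"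
begin

lemma AE_all_components:
  assumes [measurable]: "Measurable.pred borel Q" and "measure paths {\<omega>. \<not> Q (\<omega> 0)} = 0"
  shows "AE \<omega> in paths. \<forall>i. Q (\<omega> i)"
proof -
  have "AE \<omega> in paths. Q (\<omega> i)" for i
  proof -
    have "(\<integral>\<omega>. of_bool (\<not> Q (\<omega> (0 + i))) \<partial>paths) = (\<integral>\<omega>. of_bool (\<not> Q (\<omega> 0)) \<partial>paths :: real)"
      using integral_reindex[of "\<lambda>\<omega>. of_bool (\<not> Q (\<omega> 0))" "\<lambda>j. j + i"] by (simp add: inj_def)
    moreover have "(\<integral>\<omega>. of_bool (\<not> Q (\<omega> j)) \<partial>paths) = measure paths {\<omega>. \<not> Q (\<omega> j)}" for j
    proof -
      have "(\<integral>\<omega>. of_bool (\<not> Q (\<omega> j)) \<partial>paths) = (\<integral>\<omega>. indicator {\<omega>. \<not> Q (\<omega> j)} \<omega> \<partial>paths :: real)"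
        by (intro Bochner_Integration.integral_cong) (auto simp: indicator_def)
      then show ?thesis by simp
    qed
    ultimately have "measure paths {\<omega>. \<not> Q (\<omega> i)} = 0" using assms(2) by simp
    moreover have "{\<omega>. \<not> Q (\<omega> i)} \<in> sets paths" by (intro sets_Collect_paths) measurable
    ultimately have "{\<omega>. \<not> Q (\<omega> i)} \<in> null_sets paths"
      by (simp add: P.emeasure_eq_measure null_setsI)
    then show ?thesis by (rule AE_I') auto
  qed
  then show ?thesis by (simp add: AE_all_countable)
qed

lemma positive_step: "0 < measure paths {\<omega>. 0 < \<omega> 0}"
proof (rule ccontr)
  assume "\<not> 0 < measure paths {\<omega>. 0 < \<omega> 0}"
  then have "measure paths {\<omega>. \<not> \<omega> 0 \<le> 0} = 0" by (simp add: not_le zero_less_measure_iff)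
  then have "AE \<omega> in paths. \<forall>i. \<omega> i \<le> 0" by (intro AE_all_components) auto
  then have "AE \<omega> in paths. \<not> 0 < partial_sum \<omega> n" for n
    by eventually_elim (simp add: partial_sum_def sum_nonpos not_less)
  then have "measure paths {\<omega>. 0 < partial_sum \<omega> n} = 0" for n
    by (subst P.prob_eq_0) (auto intro: sets_Collect_paths)
  then have "(\<lambda>n. 0) \<longlonglongrightarrow> \<rho>" using positive_lim by simp
  then show False using \<rho> LIMSEQ_unique[OF _ tendsto_const, of 0 \<rho>] by simp
qed

lemma negative_step: "0 < measure paths {\<omega>. \<omega> 0 < 0}"
proof (rule ccontr)
  assume "\<not> 0 < measure paths {\<omega>. \<omega> 0 < 0}"
  then have "measure paths {\<omega>. \<not> 0 \<le> \<omega> 0} = 0" by (simp add: not_le zero_less_measure_iff)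
  then have nn: "AE \<omega> in paths. \<forall>i. 0 \<le> \<omega> i" by (intro AE_all_components) auto
  have "1 \<le> measure paths {\<omega>. 0 < partial_sum \<omega> n} + measure paths {\<omega>. \<bar>partial_sum \<omega> n\<bar> \<le> 1}" for n
  proof -
    have "AE \<omega> in paths. \<omega> \<in> {\<omega>. 0 < partial_sum \<omega> n} \<union> {\<omega>. \<bar>partial_sum \<omega> n\<bar> \<le> 1}"
      using nn
    proof eventually_elim
      case (elim \<omega>)
      then have "0 \<le> partial_sum \<omega> n" by (simp add: partial_sum_def sum_nonneg)
      then show ?case by auto
    qed
    then have "measure paths ({\<omega>. 0 < partial_sum \<omega> n} \<union> {\<omega>. \<bar>partial_sum \<omega> n\<bar> \<le> 1}) = 1"
      by (subst P.prob_eq_1) (auto intro!: sets.Un sets_Collect_paths)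
    then have "1 = measure paths ({\<omega>. 0 < partial_sum \<omega> n} \<union> {\<omega>. \<bar>partial_sum \<omega> n\<bar> \<le> 1})" by simp
    also have "\<dots> \<le> measure paths {\<omega>. 0 < partial_sum \<omega> n} + measure paths {\<omega>. \<bar>partial_sum \<omega> n\<bar> \<le> 1}"
      by (intro measure_Un_le sets_Collect_paths) measurable
    finally show ?thesis .
  qed
  then have "1 \<le> \<rho> + 0"
    by (intro LIMSEQ_le_const[OF tendsto_add[OF positive_lim concentration]]) auto
  with \<rho> show False by simp
qed

lemma iid_walk_half_line_nonpos: "0 \<le> \<theta> \<Longrightarrow> iid_walk_half_line \<nu> (\<lambda>x. x \<le> 0) \<theta>"
  by (intro iid_walk_half_line.intro iid_walk_axioms half_line_nonpos iid_walk_half_line_axioms.intro)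
     (auto simp: mult_nonneg_nonpos)

lemma iid_walk_half_line_pos: "0 \<le> \<theta> \<Longrightarrow> iid_walk_half_line \<nu> (\<lambda>x. 0 < x) (- \<theta>)"
  by (intro iid_walk_half_line.intro iid_walk_axioms half_line_pos iid_walk_half_line_axioms.intro)
     (auto simp: mult_nonneg_nonneg)

definition tail :: "nat \<Rightarrow> real" where
  "tail n = measure paths {\<omega>. stays (\<lambda>x. x \<le> 0) \<omega> n}"

definition up_weight :: "real \<Rightarrow> nat \<Rightarrow> real" where
  "up_weight \<theta> n = (\<integral>\<omega>. of_bool (ladder (\<lambda>x. 0 < x) \<omega> n) * exp (- \<theta> * partial_sum \<omega> n) \<partial>paths)"

definition down_weight :: "real \<Rightarrow> nat \<Rightarrow> real" where
  "down_weight \<theta> n = (\<integral>\<omega>. of_bool (stays (\<lambda>x. x \<le> 0) \<omega> n) * exp (\<theta> * partial_sum \<omega> n) \<partial>paths)"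

lemma integral_of_bool:
  assumes [measurable]: "Measurable.pred paths Q"
  shows "(\<integral>\<omega>. of_bool (Q \<omega>) \<partial>paths) = measure paths {\<omega>. Q \<omega>}"
proof -
  have "(\<integral>\<omega>. of_bool (Q \<omega>) \<partial>paths) = (\<integral>\<omega>. indicator {\<omega>. Q \<omega>} \<omega> \<partial>paths :: real)"
    by (intro Bochner_Integration.integral_cong) (auto simp: indicator_def)
  then show ?thesis by simp
qed

lemma weights_tendsto_0:
  assumes "0 < \<theta>" and [measurable]: "Measurable.pred borel C" and C: "\<And>x. C x \<Longrightarrow> f x \<le> - \<theta> * \<bar>x\<bar>"
    and [measurable]: "f \<in> borel_measurable borel"
  shows "(\<lambda>n. \<integral>\<omega>. of_bool (C (partial_sum \<omega> n)) * exp (f (partial_sum \<omega> n)) \<partial>paths) \<longlonglongrightarrow> 0"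
proof (rule LIMSEQ_I)
  fix \<epsilon> :: real assume \<epsilon>: "0 < \<epsilon>"
  obtain K where K: "exp (- \<theta> * K) < \<epsilon> / 2" "0 \<le> K"
  proof -
    have "filterlim (\<lambda>K. - \<theta> * K) at_bot at_top"
      using \<open>0 < \<theta>\<close> by (intro filterlim_tendsto_neg_mult_at_bot[OF tendsto_const] filterlim_ident) auto
    then have "((\<lambda>K. exp (- \<theta> * K)) \<longlongrightarrow> 0) at_top"
      by (rule filterlim_compose[OF exp_at_bot])
    then have "\<forall>\<^sub>F K in at_top. exp (- \<theta> * K) < \<epsilon> / 2 \<and> 0 \<le> K"
      using \<epsilon> by (intro eventually_conj order_tendstoD eventually_ge_at_top) auto
    then show thesis using that eventually_happens' trivial_limit_at_top_linorder by blast
  qed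
  obtain N where N: "\<And>n. n \<ge> N \<Longrightarrow> measure paths {\<omega>. \<bar>partial_sum \<omega> n\<bar> \<le> K} < \<epsilon> / 2"
    using LIMSEQ_D[OF concentration[of K], of "\<epsilon> / 2"] \<epsilon> by auto
  have le: "of_bool (C x) * exp (f x) \<le> of_bool (\<bar>x\<bar> \<le> K) + exp (- \<theta> * K)" for x
  proof (cases "C x")
    case True
    show ?thesis
    proof (cases "\<bar>x\<bar> \<le> K")
      case True
      have "exp (f x) \<le> 1" using C[OF \<open>C x\<close>] \<open>0 < \<theta>\<close> by (auto intro: order_trans)
      then show ?thesis using True \<open>C x\<close> by (simp add: add_increasing2)
    next
      case False
      have "f x \<le> - \<theta> * K" using C[OF \<open>C x\<close>] False \<open>0 < \<theta>\<close>
        by (smt (verit) mult_left_mono mult_minus_left)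
      then show ?thesis using False \<open>C x\<close> by simp
    qed
  qed auto
  have "norm ((\<integral>\<omega>. of_bool (C (partial_sum \<omega> n)) * exp (f (partial_sum \<omega> n)) \<partial>paths) - 0) < \<epsilon>" if "n \<ge> N" for n
  proof -
    have "(\<integral>\<omega>. of_bool (C (partial_sum \<omega> n)) * exp (f (partial_sum \<omega> n)) \<partial>paths) \<le>
      (\<integral>\<omega>. of_bool (\<bar>partial_sum \<omega> n\<bar> \<le> K) + exp (- \<theta> * K) \<partial>paths)"
    proof (intro integral_mono le)
      show "integrable paths (\<lambda>\<omega>. of_bool (\<bar>partial_sum \<omega> n\<bar> \<le> K) + exp (- \<theta> * K))"
        by (intro integrable_bounded[where B = "1 + exp (- \<theta> * K)"]) auto
      show "integrable paths (\<lambda>\<omega>. of_bool (C (partial_sum \<omega> n)) * exp (f (partial_sum \<omega> n)))"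
      proof (rule integrable_bounded[where B = "1 + exp (- \<theta> * K)"])
        fix \<omega>
        have "of_bool (\<bar>partial_sum \<omega> n\<bar> \<le> K) \<le> (1 :: real)" by simp
        moreover have "0 \<le> of_bool (C (partial_sum \<omega> n)) * exp (f (partial_sum \<omega> n))" by simp
        ultimately show "\<bar>of_bool (C (partial_sum \<omega> n)) * exp (f (partial_sum \<omega> n))\<bar> \<le> 1 + exp (- \<theta> * K)"
          using le[of "partial_sum \<omega> n"] by linarith
      qed measurable
    qed
    also have "\<dots> = measure paths {\<omega>. \<bar>partial_sum \<omega> n\<bar> \<le> K} + exp (- \<theta> * K)"
      by (subst Bochner_Integration.integral_add)
         (auto intro!: integrable_bounded[where B = 1] simp: integral_of_bool)
    also have "\<dots> < \<epsilon>" using N[OF that] K by simp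
    moreover have "0 \<le> (\<integral>\<omega>. of_bool (C (partial_sum \<omega> n)) * exp (f (partial_sum \<omega> n)) \<partial>paths)"
      by (intro integral_nonneg_AE) auto
    ultimately show ?thesis by simp
  qed
  then show "\<exists>N. \<forall>n\<ge>N. norm ((\<integral>\<omega>. of_bool (C (partial_sum \<omega> n)) * exp (f (partial_sum \<omega> n)) \<partial>paths) - 0) < \<epsilon>" by blast
qed

lemma weight_deficit:
  assumes [measurable]: "Measurable.pred borel C" and k: "\<And>x. C x \<Longrightarrow> \<kappa> * x \<le> 0"
    and pos: "0 < measure paths {\<omega>. C (\<omega> 0) \<and> \<kappa> * \<omega> 0 < 0}"
  shows "(\<integral>\<omega>. of_bool (C (partial_sum \<omega> 1)) * exp (\<kappa> * partial_sum \<omega> 1) \<partial>paths) < measure paths {\<omega>. C (\<omega> 0)}"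
proof -
  have ps1: "partial_sum \<omega> 1 = \<omega> 0" for \<omega> by (simp add: partial_sum_def)
  let ?d = "\<lambda>\<omega>. of_bool (C (\<omega> 0)) * (1 - exp (\<kappa> * \<omega> 0)) :: real"
  have nn: "0 \<le> ?d \<omega>" and le: "?d \<omega> \<le> 1" for \<omega> using k[of "\<omega> 0"] by (cases "C (\<omega> 0)"; simp)+
  have int: "integrable paths ?d"
  proof (rule integrable_bounded[where B = 1])
    show "\<bar>?d \<omega>\<bar> \<le> 1" for \<omega> using nn[of \<omega>] le[of \<omega>] by linarith
  qed measurable
  have e1: "of_bool (C x) * exp (\<kappa> * x) \<le> 1" for x using k[of x] by (cases "C x") auto
  have int1: "integrable paths (\<lambda>\<omega>. of_bool (C (\<omega> 0)) * exp (\<kappa> * \<omega> 0))"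
    using e1 by (intro integrable_bounded[where B = 1]) (auto simp: abs_mult)
  have "(\<integral>\<omega>. ?d \<omega> \<partial>paths) \<noteq> 0"
  proof
    assume "(\<integral>\<omega>. ?d \<omega> \<partial>paths) = 0"
    then have "AE \<omega> in paths. ?d \<omega> = 0"
      using integral_nonneg_eq_0_iff_AE[OF int] AE_I2[of paths "\<lambda>\<omega>. 0 \<le> ?d \<omega>"] nn by blast
    then have "AE \<omega> in paths. \<omega> \<notin> {\<omega>. C (\<omega> 0) \<and> \<kappa> * \<omega> 0 < 0}"
      by eventually_elim auto
    then have "measure paths {\<omega>. C (\<omega> 0) \<and> \<kappa> * \<omega> 0 < 0} = 0"
      by (subst P.prob_eq_0) (auto intro!: sets_Collect_paths)
    with pos show False by simp
  qed
  moreover have "0 \<le> (\<integral>\<omega>. ?d \<omega> \<partial>paths)" by (intro integral_nonneg_AE AE_I2 nn)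
  ultimately have "0 < (\<integral>\<omega>. ?d \<omega> \<partial>paths)" by linarith
  also have "\<dots> = (\<integral>\<omega>. of_bool (C (\<omega> 0)) - of_bool (C (\<omega> 0)) * exp (\<kappa> * \<omega> 0) \<partial>paths)"
    by (simp add: right_diff_distrib)
  also have "\<dots> = measure paths {\<omega>. C (\<omega> 0)} - (\<integral>\<omega>. of_bool (C (\<omega> 0)) * exp (\<kappa> * \<omega> 0) \<partial>paths)"
    using int1 by (subst Bochner_Integration.integral_diff)
      (auto intro!: integrable_bounded[where B = 1] simp: integral_of_bool)
  finally show ?thesis unfolding ps1 by simp
qed

lemma up_weight:
  assumes "0 < \<theta>"
  shows "summable (up_weight \<theta>)" "0 \<le> up_weight \<theta> n" "(\<lambda>n. real n * up_weight \<theta> n) \<longlonglongrightarrow> 0"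
proof -
  interpret U: iid_walk_half_line \<nu> "\<lambda>x. 0 < x" "- \<theta>" using iid_walk_half_line_pos assms by simp
  have eq: "U.ladder_weight = up_weight \<theta>"
    by (simp add: fun_eq_iff U.ladder_weight_def up_weight_def)
  have sw: "U.sum_weight \<longlonglongrightarrow> 0" unfolding U.sum_weight_def
    using assms by (intro weights_tendsto_0[where \<theta> = \<theta> and f = "\<lambda>x. - \<theta> * x" and C = "\<lambda>x. 0 < x"]) auto
  have "{\<omega>. 0 < \<omega> 0 \<and> - \<theta> * \<omega> 0 < 0} = {\<omega>::nat \<Rightarrow> real. 0 < \<omega> 0}" using assms by auto
  then have s: "summable U.ladder_weight"
    using assms positive_step unfolding up_weight_def
    by (intro U.summable_ladder_weight[unfolded U.sum_weight_def] weight_deficit) auto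
  show "summable (up_weight \<theta>)" using s by (simp add: eq)
  show "0 \<le> up_weight \<theta> n" using U.ladder_weight_nonneg[of n] by (simp add: eq)
  show "(\<lambda>n. real n * up_weight \<theta> n) \<longlonglongrightarrow> 0"
    using U.ladder_weight_smaller[OF s sw] by (simp add: eq)
qed

lemma down_weight:
  assumes "0 < \<theta>"
  shows "summable (down_weight \<theta>)" "0 \<le> down_weight \<theta> n" "(\<lambda>n. real n * down_weight \<theta> n) \<longlonglongrightarrow> 0"
proof -
  interpret U: iid_walk_half_line \<nu> "\<lambda>x. x \<le> 0" \<theta> using iid_walk_half_line_nonpos assms by simp
  have eq: "U.ladder_weight = down_weight \<theta>"
    by (simp add: fun_eq_iff U.ladder_weight_stays down_weight_def)
  have sw: "U.sum_weight \<longlonglongrightarrow> 0" unfolding U.sum_weight_def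
    using assms by (intro weights_tendsto_0[where \<theta> = \<theta> and f = "\<lambda>x. \<theta> * x" and C = "\<lambda>x. x \<le> 0"]) auto
  have "{\<omega>. \<omega> 0 \<le> 0 \<and> \<theta> * \<omega> 0 < 0} = {\<omega>::nat \<Rightarrow> real. \<omega> 0 < 0}"
    using assms by (auto simp: mult_less_0_iff)
  then have s: "summable U.ladder_weight"
    using assms negative_step
    by (intro U.summable_ladder_weight[unfolded U.sum_weight_def] weight_deficit) (auto simp: mult_nonneg_nonpos)
  show "summable (down_weight \<theta>)" using s by (simp add: eq)
  show "0 \<le> down_weight \<theta> n" using U.ladder_weight_nonneg[of n] by (simp add: eq)
  show "(\<lambda>n. real n * down_weight \<theta> n) \<longlonglongrightarrow> 0"
    using U.ladder_weight_smaller[OF s sw] by (simp add: eq)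
qed

lemma stays_mono: "m \<le> n \<Longrightarrow> stays C \<omega> n \<Longrightarrow> stays C \<omega> m"
  by (auto simp: stays_def)

sublocale regular_tail tail "1 - \<rho>"
proof -
  interpret U: iid_walk_half_line \<nu> "\<lambda>x. x \<le> 0" 0 using iid_walk_half_line_nonpos by simp
  have eq: "U.ladder_weight n = tail n" for n
    unfolding U.ladder_weight_stays tail_def by (simp add: integral_of_bool)
  have b: "U.sum_weight n = 1 - measure paths {\<omega>. 0 < partial_sum \<omega> n}" for n
  proof -
    have "U.sum_weight n = measure paths {\<omega>. partial_sum \<omega> n \<le> 0}"
      unfolding U.sum_weight_def by (simp add: integral_of_bool)
    also have "{\<omega>. partial_sum \<omega> n \<le> 0} = space paths - {\<omega>. 0 < partial_sum \<omega> n}" by auto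
    also have "measure paths \<dots> = 1 - measure paths {\<omega>. 0 < partial_sum \<omega> n}"
      by (intro P.prob_compl sets_Collect_paths) measurable
    finally show ?thesis .
  qed
  have rec: "real n * tail n = (\<Sum>k=1..n. U.sum_weight k * tail (n - k))" for n
    using U.spitzer[of n] by (simp add: eq)
  have nn: "0 \<le> U.sum_weight n" for n unfolding b by simp
  have b1: "0 < U.sum_weight 1"
  proof -
    have "measure paths {\<omega>. \<omega> 0 < 0} \<le> measure paths {\<omega>. partial_sum \<omega> 1 \<le> 0}"
      by (intro P.finite_measure_mono sets_Collect_paths) (auto simp: partial_sum_def)
    also have "\<dots> = U.sum_weight 1" unfolding U.sum_weight_def by (simp add: integral_of_bool)
    finally show ?thesis using negative_step by simp
  qed
  show "regular_tail tail (1 - \<rho>)"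
  proof (rule regular_tailI[where b = U.sum_weight])
    show "0 < tail n" for n
    proof (induction n)
      case 0
      then show ?case using U.ladder_weight_0 eq by (metis zero_less_one)
    next
      case (Suc n)
      have "0 < U.sum_weight 1 * tail (Suc n - 1)" using Suc b1 by simp
      also have "\<dots> \<le> (\<Sum>k=1..Suc n. U.sum_weight k * tail (Suc n - k))"
        using nn by (intro member_le_sum) (auto simp: tail_def)
      also have "\<dots> = real (Suc n) * tail (Suc n)" using rec[of "Suc n"] by simp
      finally show ?case by (simp add: zero_less_mult_iff)
    qed
    show "tail n \<le> tail m" if "m \<le> n" for m n
      unfolding tail_def using that by (intro P.finite_measure_mono sets_Collect_paths) (auto intro: stays_mono)
    show "U.sum_weight \<longlonglongrightarrow> 1 - \<rho>"
      unfolding b[abs_def] by (intro tendsto_intros positive_lim)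
  qed (use \<rho> rec in auto)
qed

end

section \<open>Exponential functionals of the walk\<close>

definition expsum :: "(nat \<Rightarrow> real) \<Rightarrow> nat \<Rightarrow> real" where
  "expsum \<omega> n = (\<Sum>k\<le>n. exp (partial_sum \<omega> k))"

definition past_expsum :: "(nat \<Rightarrow> real) \<Rightarrow> nat \<Rightarrow> real" where
  "past_expsum \<omega> k = (\<Sum>j<k. exp (partial_sum \<omega> j - partial_sum \<omega> k))"

lemma exp_le_expsum: "k \<le> n \<Longrightarrow> exp (partial_sum \<omega> k) \<le> expsum \<omega> n"
  unfolding expsum_def by (intro member_le_sum) auto

lemma expsum_ge_1: "1 \<le> expsum \<omega> n"
  using exp_le_expsum[of 0 n \<omega>] by simp

lemma expsum_0 [simp]: "expsum \<omega> 0 = 1"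
  by (simp add: expsum_def)

lemma expsum_Suc: "expsum \<omega> (Suc n) = expsum \<omega> n + exp (partial_sum \<omega> (Suc n))"
  by (simp add: expsum_def)

lemma inverse_square_le_1: "0 \<le> g \<Longrightarrow> 1 / (g + expsum \<omega> n)\<^sup>2 \<le> 1"
  using expsum_ge_1[of \<omega> n] by (simp add: one_le_power)

lemma exp_over_expsum_bounds:
  "0 \<le> exp (partial_sum \<omega> n) / (expsum \<omega> n)\<^sup>2" "exp (partial_sum \<omega> n) / (expsum \<omega> n)\<^sup>2 \<le> 1"
proof -
  have "exp (partial_sum \<omega> n) \<le> expsum \<omega> n * 1" using exp_le_expsum[of n n \<omega>] by simp
  also have "\<dots> \<le> expsum \<omega> n * expsum \<omega> n" using expsum_ge_1[of \<omega> n] by (intro mult_left_mono) auto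
  finally show "exp (partial_sum \<omega> n) / (expsum \<omega> n)\<^sup>2 \<le> 1"
    using expsum_ge_1[of \<omega> n] by (simp add: power2_eq_square divide_le_eq)
qed simp

lemma past_expsum_nonneg: "0 \<le> past_expsum \<omega> k"
  unfolding past_expsum_def by (intro sum_nonneg) auto

lemma expsum_comb_seq:
  assumes "k \<le> n"
  shows "expsum (comb_seq k \<omega> \<omega>') n = exp (partial_sum \<omega> k) * (past_expsum \<omega> k + expsum \<omega>' (n - k))"
proof -
  let ?S = "partial_sum (comb_seq k \<omega> \<omega>')"
  have "expsum (comb_seq k \<omega> \<omega>') n = (\<Sum>j\<in>{..<k} \<union> {k..n}. exp (?S j))"
    unfolding expsum_def using assms by (intro sum.cong) auto
  also have "\<dots> = (\<Sum>j<k. exp (?S j)) + (\<Sum>j\<in>{k..n}. exp (?S j))"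
    by (rule sum.union_disjoint) auto
  also have "(\<Sum>j<k. exp (?S j)) = exp (partial_sum \<omega> k) * past_expsum \<omega> k"
    unfolding past_expsum_def sum_distrib_left
    by (intro sum.cong) (auto simp: partial_sum_comb_seq_le exp_diff)
  also have "(\<Sum>j\<in>{k..n}. exp (?S j)) = (\<Sum>j\<le>n - k. exp (?S (k + j)))"
    using assms by (intro sum.reindex_bij_witness[of _ "\<lambda>j. k + j" "\<lambda>j. j - k"]) auto
  also have "\<dots> = exp (partial_sum \<omega> k) * expsum \<omega>' (n - k)"
    by (simp add: partial_sum_comb_seq_add exp_add expsum_def sum_distrib_left)
  finally show ?thesis by (simp add: distrib_left)
qed

lemma stays_comb_seq:
  assumes "j \<le> n"
  shows "stays C (comb_seq j \<omega> \<omega>') n \<longleftrightarrow> stays C \<omega> j \<and> stays (\<lambda>y. C (partial_sum \<omega> j + y)) \<omega>' (n - j)"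
proof -
  have "stays C (comb_seq j \<omega> \<omega>') n \<longleftrightarrow>
     (\<forall>i\<in>{1..j}. C (partial_sum (comb_seq j \<omega> \<omega>') i)) \<and> (\<forall>i\<in>{1..n - j}. C (partial_sum (comb_seq j \<omega> \<omega>') (j + i)))"
    unfolding stays_def
  proof (intro iffI conjI ballI)
    fix i assume *: "(\<forall>i\<in>{1..j}. C (partial_sum (comb_seq j \<omega> \<omega>') i)) \<and> (\<forall>i\<in>{1..n - j}. C (partial_sum (comb_seq j \<omega> \<omega>') (j + i)))"
      and i: "i \<in> {1..n}"
    show "C (partial_sum (comb_seq j \<omega> \<omega>') i)"
    proof (cases "i \<le> j")
      case False
      then have "i - j \<in> {1..n - j}" using i by auto
      then have "C (partial_sum (comb_seq j \<omega> \<omega>') (j + (i - j)))" using * by blast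
      then show ?thesis using False by simp
    qed (use * i in auto)
  qed (use assms in auto)
  then show ?thesis by (simp add: stays_def partial_sum_comb_seq_le partial_sum_comb_seq_add)
qed

lemma ladder_comb_seq: "ladder C (comb_seq k \<omega> \<omega>') k = ladder C \<omega> k"
  by (simp add: ladder_def partial_sum_comb_seq_le)

lemma (in iid_walk) measurable_expsum [measurable]: "(\<lambda>\<omega>. expsum \<omega> n) \<in> borel_measurable paths"
  unfolding expsum_def by measurable

lemma (in iid_walk) measurable_past_expsum [measurable]: "(\<lambda>\<omega>. past_expsum \<omega> n) \<in> borel_measurable paths"
  unfolding past_expsum_def by measurable

context spitzer_walk
begin

lemma measurable_shift:
  assumes "f \<in> borel_measurable paths"
  shows "(\<lambda>\<omega>. f (\<lambda>i. \<omega> (k + i))) \<in> borel_measurable paths"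
  by (rule measurable_compose[OF measurable_reindex assms])

lemma split_at_maximum:
  "(\<Sum>k\<le>n. of_bool (ladder (\<lambda>x. 0 < x) \<omega> k) * of_bool (stays (\<lambda>x. x \<le> 0) (\<lambda>i. \<omega> (k + i)) (n - k))) = (1 :: real)"
  using half_line.sum_ladder_stays[OF half_line_pos, of \<omega> n] by (simp add: not_less)

lemma integral_split_max:
  fixes f :: "(nat \<Rightarrow> real) \<Rightarrow> real"
  assumes [measurable]: "f \<in> borel_measurable paths" and B: "\<And>\<omega>. \<bar>f \<omega>\<bar> \<le> B"
  shows "(\<integral>\<omega>. f \<omega> \<partial>paths) = (\<Sum>k\<le>n. \<integral>\<omega>. of_bool (ladder (\<lambda>x. 0 < x) \<omega> k) *
     (\<integral>\<omega>'. of_bool (stays (\<lambda>x. x \<le> 0) \<omega>' (n - k)) * f (comb_seq k \<omega> \<omega>') \<partial>paths) \<partial>paths)"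
proof -
  let ?l = "\<lambda>k \<omega>. of_bool (ladder (\<lambda>x. 0 < x) \<omega> k) :: real"
  let ?s = "\<lambda>k \<omega>. of_bool (stays (\<lambda>x. x \<le> 0) \<omega> (n - k)) :: real"
  have m [measurable]: "(\<lambda>\<omega>. ?s k (\<lambda>i. \<omega> (k + i))) \<in> borel_measurable paths" for k
    by (rule measurable_shift) measurable
  have b: "\<bar>?l k \<omega> * ?s k (\<lambda>i. \<omega> (k + i)) * f \<omega>\<bar> \<le> B" for k \<omega>
    using B[of \<omega>] order_trans[OF abs_ge_zero B[of \<omega>]] by (auto simp: abs_mult)
  have "(\<integral>\<omega>. f \<omega> \<partial>paths) = (\<integral>\<omega>. (\<Sum>k\<le>n. ?l k \<omega> * ?s k (\<lambda>i. \<omega> (k + i)) * f \<omega>) \<partial>paths)"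
    unfolding sum_distrib_right[symmetric] split_at_maximum by simp
  also have "\<dots> = (\<Sum>k\<le>n. \<integral>\<omega>. ?l k \<omega> * ?s k (\<lambda>i. \<omega> (k + i)) * f \<omega> \<partial>paths)"
    using b by (intro Bochner_Integration.integral_sum integrable_bounded[where B = B]) measurable
  also have "\<dots> = (\<Sum>k\<le>n. \<integral>\<omega>. ?l k \<omega> * (\<integral>\<omega>'. ?s k \<omega>' * f (comb_seq k \<omega> \<omega>') \<partial>paths) \<partial>paths)"
  proof (intro sum.cong refl)
    fix k
    have "(\<integral>\<omega>. ?l k \<omega> * ?s k (\<lambda>i. \<omega> (k + i)) * f \<omega> \<partial>paths) =
      (\<integral>\<omega>. (\<integral>\<omega>'. ?l k (comb_seq k \<omega> \<omega>') * ?s k (\<lambda>i. comb_seq k \<omega> \<omega>' (k + i)) * f (comb_seq k \<omega> \<omega>') \<partial>paths) \<partial>paths)"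
      using b by (intro integral_comb_seq[where B = B]) measurable
    then show "(\<integral>\<omega>. ?l k \<omega> * ?s k (\<lambda>i. \<omega> (k + i)) * f \<omega> \<partial>paths) =
        (\<integral>\<omega>. ?l k \<omega> * (\<integral>\<omega>'. ?s k \<omega>' * f (comb_seq k \<omega> \<omega>') \<partial>paths) \<partial>paths)"
      by (simp add: comb_seq_shift ladder_comb_seq mult.assoc)
  qed
  finally show ?thesis .
qed

definition max_tail :: "real \<Rightarrow> nat \<Rightarrow> real" where
  "max_tail x n = measure paths {\<omega>. stays (\<lambda>y. y \<le> x) \<omega> n}"

lemma max_tail_nonneg: "0 \<le> max_tail x n"
  by (simp add: max_tail_def)

lemma max_tail_mono: "x \<le> y \<Longrightarrow> max_tail x n \<le> max_tail y n"
  unfolding max_tail_def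
  by (intro P.finite_measure_mono sets_Collect_paths) (auto simp: stays_def)

lemma measurable_max_tail [measurable]: "(\<lambda>x. max_tail x n) \<in> borel_measurable borel"
  by (intro borel_measurable_mono monoI max_tail_mono)

definition low_ladder :: "real \<Rightarrow> nat \<Rightarrow> real" where
  "low_ladder x k = measure paths {\<omega>. ladder (\<lambda>x. 0 < x) \<omega> k \<and> partial_sum \<omega> k \<le> x}"

lemma max_tail_eq:
  assumes x: "0 \<le> x"
  shows "max_tail x n = (\<Sum>k\<le>n. low_ladder x k * tail (n - k))"
proof -
  have "max_tail x n = (\<integral>\<omega>. of_bool (stays (\<lambda>y. y \<le> x) \<omega> n) \<partial>paths)"
    by (simp add: max_tail_def integral_of_bool)
  also have "\<dots> = (\<Sum>k\<le>n. \<integral>\<omega>. of_bool (ladder (\<lambda>x. 0 < x) \<omega> k) *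
     (\<integral>\<omega>'. of_bool (stays (\<lambda>x. x \<le> 0) \<omega>' (n - k)) * of_bool (stays (\<lambda>y. y \<le> x) (comb_seq k \<omega> \<omega>') n) \<partial>paths) \<partial>paths)"
    by (rule integral_split_max[where B = 1]) auto
  also have "\<dots> = (\<Sum>k\<le>n. \<integral>\<omega>. of_bool (ladder (\<lambda>x. 0 < x) \<omega> k \<and> partial_sum \<omega> k \<le> x) * tail (n - k) \<partial>paths)"
  proof (intro sum.cong refl Bochner_Integration.integral_cong)
    fix k \<omega> assume k: "k \<in> {..n}"
    show "of_bool (ladder (\<lambda>x. 0 < x) \<omega> k) *
     (\<integral>\<omega>'. of_bool (stays (\<lambda>x. x \<le> 0) \<omega>' (n - k)) * of_bool (stays (\<lambda>y. y \<le> x) (comb_seq k \<omega> \<omega>') n) \<partial>paths)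
     = of_bool (ladder (\<lambda>x. 0 < x) \<omega> k \<and> partial_sum \<omega> k \<le> x) * tail (n - k)"
    proof (cases "ladder (\<lambda>x. 0 < x) \<omega> k")
      case True
      have "of_bool (stays (\<lambda>x. x \<le> 0) \<omega>' (n - k)) * of_bool (stays (\<lambda>y. y \<le> x) (comb_seq k \<omega> \<omega>') n)
         = of_bool (partial_sum \<omega> k \<le> x) * (of_bool (stays (\<lambda>x. x \<le> 0) \<omega>' (n - k)) :: real)" for \<omega>'
      proof (cases "stays (\<lambda>x. x \<le> 0) \<omega>' (n - k)")
        case st: True
        have "stays (\<lambda>y. y \<le> x) (comb_seq k \<omega> \<omega>') n \<longleftrightarrow> partial_sum \<omega> k \<le> x"
        proof
          assume Sx: "partial_sum \<omega> k \<le> x"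
          have "partial_sum \<omega> i \<le> partial_sum \<omega> k" if "i \<le> k" for i
            using True that by (cases "i = k") (auto simp: ladder_def dest!: bspec[of _ _ i])
          then have "stays (\<lambda>y. y \<le> x) \<omega> k"
            using Sx unfolding stays_def by (meson atLeastAtMost_iff order_trans)
          moreover have "stays (\<lambda>y. partial_sum \<omega> k + y \<le> x) \<omega>' (n - k)"
            using st Sx by (fastforce simp: stays_def)
          ultimately show "stays (\<lambda>y. y \<le> x) (comb_seq k \<omega> \<omega>') n"
            using k by (simp add: stays_comb_seq)
        next
          assume "stays (\<lambda>y. y \<le> x) (comb_seq k \<omega> \<omega>') n"
          then have "stays (\<lambda>y. y \<le> x) \<omega> k" using k by (simp add: stays_comb_seq)
          then show "partial_sum \<omega> k \<le> x" using x by (cases "k = 0") (auto simp: stays_def)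
        qed
        then show ?thesis by simp
      qed simp
      then have "(\<integral>\<omega>'. of_bool (stays (\<lambda>x. x \<le> 0) \<omega>' (n - k)) * of_bool (stays (\<lambda>y. y \<le> x) (comb_seq k \<omega> \<omega>') n) \<partial>paths)
         = of_bool (partial_sum \<omega> k \<le> x) * (\<integral>\<omega>'. of_bool (stays (\<lambda>x. x \<le> 0) \<omega>' (n - k)) \<partial>paths :: real)"
        by (simp only: integral_mult_right_zero)
      then show ?thesis using True by (simp add: tail_def integral_of_bool)
    qed simp
  qed
  also have "\<dots> = (\<Sum>k\<le>n. low_ladder x k * tail (n - k))"
    by (simp add: low_ladder_def integral_of_bool)
  finally show ?thesis .
qed

lemma low_ladder_le: "low_ladder x k \<le> exp (x / 2) * up_weight (1 / 2) k"
proof -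
  have "low_ladder x k = (\<integral>\<omega>. of_bool (ladder (\<lambda>x. 0 < x) \<omega> k \<and> partial_sum \<omega> k \<le> x) \<partial>paths)"
    by (simp add: low_ladder_def integral_of_bool)
  also have "\<dots> \<le> (\<integral>\<omega>. exp (x / 2) * (of_bool (ladder (\<lambda>x. 0 < x) \<omega> k) * exp (- (1 / 2) * partial_sum \<omega> k)) \<partial>paths)"
  proof (rule integral_mono)
    interpret U: iid_walk_half_line \<nu> "\<lambda>x. 0 < x" "- (1 / 2)" using iid_walk_half_line_pos[of "1 / 2"] by simp
    show "integrable paths (\<lambda>\<omega>. exp (x / 2) * (of_bool (ladder (\<lambda>x. 0 < x) \<omega> k) * exp (- (1 / 2) * partial_sum \<omega> k)))"
      using U.ladder_exp_le_1
      by (intro integrable_mult_right integrable_bounded[where B = 1]) (auto simp: abs_mult)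
    show "of_bool (ladder (\<lambda>x. 0 < x) \<omega> k \<and> partial_sum \<omega> k \<le> x) \<le>
        exp (x / 2) * (of_bool (ladder (\<lambda>x. 0 < x) \<omega> k) * exp (- (1 / 2) * partial_sum \<omega> k))" for \<omega>
      by (auto simp: simp flip: exp_add)
  qed (auto intro!: integrable_bounded[where B = 1])
  also have "\<dots> = exp (x / 2) * up_weight (1 / 2) k" by (simp add: up_weight_def)
  finally show ?thesis .
qed

lemma low_ladder_nonneg: "0 \<le> low_ladder x k"
  by (simp add: low_ladder_def)

lemma max_tail_le: "\<exists>c>0. \<forall>x\<ge>0. \<forall>n. max_tail x n \<le> c * exp (x / 2) * tail n"
proof -
  obtain c where c: "c > 0" "\<And>n. (\<Sum>j\<le>n. up_weight (1 / 2) j * tail (n - j)) \<le> c * tail n"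
    using convolution_tail_le[OF up_weight[of "1 / 2"]] by auto
  have "max_tail x n \<le> c * exp (x / 2) * tail n" if "0 \<le> x" for x n
  proof -
    have "max_tail x n \<le> (\<Sum>k\<le>n. exp (x / 2) * up_weight (1 / 2) k * tail (n - k))"
      unfolding max_tail_eq[OF that] using p_pos
      by (intro sum_mono mult_right_mono low_ladder_le) (auto intro: less_imp_le)
    also have "\<dots> = exp (x / 2) * (\<Sum>k\<le>n. up_weight (1 / 2) k * tail (n - k))"
      by (simp add: sum_distrib_left mult.assoc)
    also have "\<dots> \<le> exp (x / 2) * (c * tail n)" using c(2)[of n] by (intro mult_left_mono) auto
    finally show ?thesis by (simp add: mult_ac)
  qed
  with c(1) show ?thesis by blast
qed

lemma max_tail_ratio_convergent:
  assumes "0 \<le> x"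
  shows "convergent (\<lambda>n. max_tail x n / tail n)"
proof -
  have "(\<lambda>n. (\<Sum>k\<le>n. low_ladder x k * tail (n - k)) / tail n) \<longlonglongrightarrow> (\<Sum>k. low_ladder x k * 1)"
  proof (rule convolution_tail_tendsto[where e = "\<lambda>k. exp (x / 2) * up_weight (1 / 2) k"])
    show "summable (\<lambda>k. exp (x / 2) * up_weight (1 / 2) k)"
      using up_weight(1)[of "1 / 2"] by (intro summable_mult) simp
    show "0 \<le> exp (x / 2) * up_weight (1 / 2) k" for k using up_weight(2)[of "1 / 2" k] by simp
    show "(\<lambda>n. real n * (exp (x / 2) * up_weight (1 / 2) n)) \<longlonglongrightarrow> 0"
      using tendsto_mult[OF tendsto_const up_weight(3)[of "1 / 2"], of "exp (x / 2)"] by (simp add: mult_ac)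
    show "\<bar>low_ladder x j * tail (n - j)\<bar> \<le> exp (x / 2) * up_weight (1 / 2) j * tail (n - j)" for j n
      using low_ladder_le[of x j] low_ladder_nonneg[of x j] p_pos[of "n - j"]
      by (simp add: abs_mult mult_right_mono)
    show "(\<lambda>n. low_ladder x j * tail (n - j) / tail n) \<longlonglongrightarrow> low_ladder x j * 1" for j
      using tendsto_mult[OF tendsto_const p_ratio_shift, of "low_ladder x j" j] by simp
  qed
  then show ?thesis unfolding max_tail_eq[OF assms] by (rule convergentI)
qed

lemma stays_split:
  fixes b :: "(nat \<Rightarrow> real) \<Rightarrow> real"
  assumes [measurable]: "b \<in> borel_measurable paths" and B: "\<And>\<omega>. \<bar>b \<omega>\<bar> \<le> B"
    and b: "\<And>\<omega> \<omega>'. b (comb_seq j \<omega> \<omega>') = b \<omega>" and "j \<le> n"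
  shows "(\<integral>\<omega>. of_bool (stays (\<lambda>x. x \<le> 0) \<omega> n) * b \<omega> \<partial>paths)
    = (\<integral>\<omega>. of_bool (stays (\<lambda>x. x \<le> 0) \<omega> j) * b \<omega> * max_tail (- partial_sum \<omega> j) (n - j) \<partial>paths)"
proof -
  have "(\<integral>\<omega>. of_bool (stays (\<lambda>x. x \<le> 0) \<omega> n) * b \<omega> \<partial>paths)
      = (\<integral>\<omega>. (\<integral>\<omega>'. of_bool (stays (\<lambda>x. x \<le> 0) (comb_seq j \<omega> \<omega>') n) * b (comb_seq j \<omega> \<omega>') \<partial>paths) \<partial>paths)"
    using B order_trans[OF abs_ge_zero B]
    by (intro integral_comb_seq[where B = B]) (auto simp: abs_mult)
  also have "\<dots> = (\<integral>\<omega>. (\<integral>\<omega>'. of_bool (stays (\<lambda>x. x \<le> 0) \<omega> j) * b \<omega> * of_bool (stays (\<lambda>y. y \<le> - partial_sum \<omega> j) \<omega>' (n - j)) \<partial>paths) \<partial>paths)"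
  proof (intro Bochner_Integration.integral_cong refl)
    fix \<omega> \<omega>'
    have "(\<lambda>y. partial_sum \<omega> j + y \<le> 0) = (\<lambda>y. y \<le> - partial_sum \<omega> j)" by (auto simp: fun_eq_iff)
    then show "of_bool (stays (\<lambda>x. x \<le> 0) (comb_seq j \<omega> \<omega>') n) * b (comb_seq j \<omega> \<omega>')
        = of_bool (stays (\<lambda>x. x \<le> 0) \<omega> j) * b \<omega> * of_bool (stays (\<lambda>y. y \<le> - partial_sum \<omega> j) \<omega>' (n - j))"
      by (simp add: b stays_comb_seq[OF \<open>j \<le> n\<close>] of_bool_conj)
  qed
  also have "\<dots> = (\<integral>\<omega>. of_bool (stays (\<lambda>x. x \<le> 0) \<omega> j) * b \<omega> * max_tail (- partial_sum \<omega> j) (n - j) \<partial>paths)"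
    by (simp add: max_tail_def integral_of_bool)
  finally show ?thesis .
qed

lemma stays_nonpos: "stays (\<lambda>x. x \<le> 0) \<omega> j \<Longrightarrow> partial_sum \<omega> j \<le> 0"
  by (cases "j = 0") (auto simp: stays_def)

lemma stays_split_pointwise:
  assumes c: "\<And>x n. 0 \<le> x \<Longrightarrow> max_tail x n \<le> c * exp (x / 2) * tail n" "0 < c"
    and b: "0 \<le> b" "b \<le> B * exp (partial_sum \<omega> j)" "0 \<le> B"
  shows "of_bool (stays (\<lambda>x. x \<le> 0) \<omega> j) * b * max_tail (- partial_sum \<omega> j) m
    \<le> B * c * tail m * (of_bool (stays (\<lambda>x. x \<le> 0) \<omega> j) * exp ((1 / 2) * partial_sum \<omega> j))"
proof (cases "stays (\<lambda>x. x \<le> 0) \<omega> j")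
  case True
  have "b * max_tail (- partial_sum \<omega> j) m \<le> B * exp (partial_sum \<omega> j) * (c * exp (- partial_sum \<omega> j / 2) * tail m)"
    using stays_nonpos[OF True] b max_tail_nonneg by (intro mult_mono c) auto
  also have "\<dots> = B * c * tail m * (exp (partial_sum \<omega> j) * exp (- partial_sum \<omega> j / 2))" by simp
  also have "exp (partial_sum \<omega> j) * exp (- partial_sum \<omega> j / 2) = exp ((1 / 2) * partial_sum \<omega> j)"
    by (simp flip: exp_add)
  finally show ?thesis using True by simp
qed simp

lemma stays_exp_integrable:
  assumes "0 \<le> \<theta>"
  shows "integrable paths (\<lambda>\<omega>. of_bool (stays (\<lambda>x. x \<le> 0) \<omega> j) * exp (\<theta> * partial_sum \<omega> j))"
proof (rule integrable_bounded[where B = 1])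
  show "\<bar>of_bool (stays (\<lambda>x. x \<le> 0) \<omega> j) * exp (\<theta> * partial_sum \<omega> j)\<bar> \<le> 1" for \<omega>
    using stays_nonpos[of \<omega> j] assms by (auto simp: abs_mult mult_nonneg_nonpos)
qed measurable

lemma stays_split_le:
  fixes b :: "(nat \<Rightarrow> real) \<Rightarrow> real"
  assumes c: "\<And>x n. 0 \<le> x \<Longrightarrow> max_tail x n \<le> c * exp (x / 2) * tail n" "0 < c"
    and [measurable]: "b \<in> borel_measurable paths"
    and b: "\<And>\<omega>. 0 \<le> b \<omega>" "\<And>\<omega>. b \<omega> \<le> B * exp (partial_sum \<omega> j)" "0 \<le> B"
  shows "(\<integral>\<omega>. of_bool (stays (\<lambda>x. x \<le> 0) \<omega> j) * b \<omega> * max_tail (- partial_sum \<omega> j) m \<partial>paths)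
    \<le> B * c * down_weight (1 / 2) j * tail m"
proof -
  have "(\<integral>\<omega>. of_bool (stays (\<lambda>x. x \<le> 0) \<omega> j) * b \<omega> * max_tail (- partial_sum \<omega> j) m \<partial>paths)
     \<le> (\<integral>\<omega>. B * c * tail m * (of_bool (stays (\<lambda>x. x \<le> 0) \<omega> j) * exp ((1 / 2) * partial_sum \<omega> j)) \<partial>paths)"
  proof (rule integral_mono')
    show "integrable paths (\<lambda>\<omega>. B * c * tail m * (of_bool (stays (\<lambda>x. x \<le> 0) \<omega> j) * exp ((1 / 2) * partial_sum \<omega> j)))"
      by (intro integrable_mult_right stays_exp_integrable) simp
    show "of_bool (stays (\<lambda>x. x \<le> 0) \<omega> j) * b \<omega> * max_tail (- partial_sum \<omega> j) m
        \<le> B * c * tail m * (of_bool (stays (\<lambda>x. x \<le> 0) \<omega> j) * exp ((1 / 2) * partial_sum \<omega> j))" for \<omega>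
      using stays_split_pointwise[OF c b(1,2,3), of \<omega> m] by simp
    show "0 \<le> B * c * tail m * (of_bool (stays (\<lambda>x. x \<le> 0) \<omega> j) * exp ((1 / 2) * partial_sum \<omega> j))" for \<omega>
      using b c p_pos[of m] by (intro mult_nonneg_nonneg) auto
  qed
  also have "\<dots> = B * c * down_weight (1 / 2) j * tail m" by (simp add: down_weight_def mult_ac)
  finally show ?thesis .
qed

definition stays_functional :: "real \<Rightarrow> nat \<Rightarrow> real" where
  "stays_functional g n = (\<integral>\<omega>. of_bool (stays (\<lambda>x. x \<le> 0) \<omega> n) * (1 / (g + expsum \<omega> n)\<^sup>2) \<partial>paths)"

lemma stays_functional_bounds:
  assumes "0 \<le> g"
  shows "0 \<le> stays_functional g n" "stays_functional g n \<le> tail n"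
proof -
  show "0 \<le> stays_functional g n"
    unfolding stays_functional_def by (intro integral_nonneg_AE) auto
  have "stays_functional g n \<le> (\<integral>\<omega>. of_bool (stays (\<lambda>x. x \<le> 0) \<omega> n) \<partial>paths)"
    unfolding stays_functional_def
  proof (rule integral_mono')
    show "of_bool (stays (\<lambda>x. x \<le> 0) \<omega> n) * (1 / (g + expsum \<omega> n)\<^sup>2) \<le> of_bool (stays (\<lambda>x. x \<le> 0) \<omega> n)" for \<omega>
      using inverse_square_le_1[OF assms, of \<omega> n] by (cases "stays (\<lambda>x. x \<le> 0) \<omega> n") auto
  qed (auto intro!: integrable_bounded[where B = 1])
  then show "stays_functional g n \<le> tail n" by (simp add: tail_def integral_of_bool)
qed

lemma inverse_square_diff:
  fixes a e :: real
  assumes "1 \<le> a" "0 \<le> e"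
  shows "0 \<le> 1 / a\<^sup>2 - 1 / (a + e)\<^sup>2" "1 / a\<^sup>2 - 1 / (a + e)\<^sup>2 \<le> 2 * e"
proof -
  have "1 / (a + e)\<^sup>2 \<le> 1 / a\<^sup>2" using assms by (intro divide_left_mono power_mono) auto
  then show "0 \<le> 1 / a\<^sup>2 - 1 / (a + e)\<^sup>2" by simp
  have eq: "1 / a\<^sup>2 - 1 / (a + e)\<^sup>2 = e * (1 / (a * (a + e)\<^sup>2) + 1 / (a\<^sup>2 * (a + e)))"
    using assms by (simp add: divide_simps power2_eq_square) (simp add: algebra_simps)
  have "1 / (a * (a + e)\<^sup>2) \<le> 1" "1 / (a\<^sup>2 * (a + e)) \<le> 1"
    using assms mult_mono[of 1 a 1 "(a + e)\<^sup>2"] mult_mono[of 1 "a\<^sup>2" 1 "a + e"]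
    by (auto simp: one_le_power)
  then have "e * (1 / (a * (a + e)\<^sup>2) + 1 / (a\<^sup>2 * (a + e))) \<le> e * 2"
    using assms(2) by (intro mult_left_mono) linarith+
  then show "1 / a\<^sup>2 - 1 / (a + e)\<^sup>2 \<le> 2 * e" using eq by simp
qed

lemma stays_functional_ratio_convergent:
  assumes g: "0 \<le> g"
  shows "convergent (\<lambda>n. stays_functional g n / tail n)"
proof -
  obtain c where c: "c > 0" "\<And>x n. 0 \<le> x \<Longrightarrow> max_tail x n \<le> c * exp (x / 2) * tail n"
    using max_tail_le by blast
  define b where "b j \<omega> = 1 / (g + expsum \<omega> (j - 1))\<^sup>2 - 1 / (g + expsum \<omega> j)\<^sup>2" for j \<omega>
  have b_meas [measurable]: "b j \<in> borel_measurable paths" for j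
    unfolding b_def by measurable
  have b: "0 \<le> b j \<omega>" "b j \<omega> \<le> 2 * exp (partial_sum \<omega> j)" "b j \<omega> \<le> 1" for j \<omega>
  proof -
    have ge: "1 \<le> g + expsum \<omega> n" for n using g expsum_ge_1[of \<omega> n] by linarith
    have "0 \<le> b j \<omega> \<and> b j \<omega> \<le> 2 * exp (partial_sum \<omega> j)"
    proof (cases j)
      case (Suc i)
      show ?thesis using inverse_square_diff[OF ge[of i], of "exp (partial_sum \<omega> j)"]
        by (simp add: b_def Suc expsum_Suc add.assoc)
    qed (simp add: b_def)
    then show "0 \<le> b j \<omega>" "b j \<omega> \<le> 2 * exp (partial_sum \<omega> j)" by auto
    have "0 \<le> 1 / (g + expsum \<omega> j)\<^sup>2" by simp
    then show "b j \<omega> \<le> 1" unfolding b_def using inverse_square_le_1[OF g, of \<omega> "j - 1"] by linarith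
  qed
  have telescope: "1 / (g + expsum \<omega> n)\<^sup>2 = 1 / (g + 1)\<^sup>2 - (\<Sum>j\<le>n. b j \<omega>)" for n \<omega>
    by (induction n) (simp_all add: b_def)
  have dep: "b j (comb_seq j \<omega> \<omega>') = b j \<omega>" for j \<omega> \<omega>'
  proof -
    have "expsum (comb_seq j \<omega> \<omega>') i = expsum \<omega> i" if "i \<le> j" for i
      using that unfolding expsum_def by (intro sum.cong) (auto simp: partial_sum_comb_seq_le)
    then show ?thesis by (simp add: b_def)
  qed
  define cc where "cc j n = (\<integral>\<omega>. of_bool (stays (\<lambda>x. x \<le> 0) \<omega> j) * b j \<omega> * max_tail (- partial_sum \<omega> j) (n - j) \<partial>paths)" for j n
  have bint: "integrable paths (\<lambda>\<omega>. of_bool (stays (\<lambda>x. x \<le> 0) \<omega> n) * b j \<omega>)" for j n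
    using b by (intro integrable_bounded[where B = 1]) (auto simp: abs_mult)
  have phi: "stays_functional g n = 1 / (g + 1)\<^sup>2 * tail n - (\<Sum>j\<le>n. cc j n)" for n
  proof -
    have "stays_functional g n = (\<integral>\<omega>. 1 / (g + 1)\<^sup>2 * of_bool (stays (\<lambda>x. x \<le> 0) \<omega> n) - (\<Sum>j\<le>n. of_bool (stays (\<lambda>x. x \<le> 0) \<omega> n) * b j \<omega>) \<partial>paths)"
      unfolding stays_functional_def telescope right_diff_distrib sum_distrib_left by (simp only: mult.commute)
    also have "\<dots> = 1 / (g + 1)\<^sup>2 * (\<integral>\<omega>. of_bool (stays (\<lambda>x. x \<le> 0) \<omega> n) \<partial>paths) - (\<integral>\<omega>. (\<Sum>j\<le>n. of_bool (stays (\<lambda>x. x \<le> 0) \<omega> n) * b j \<omega>) \<partial>paths)"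
    proof -
      have "integrable paths (\<lambda>\<omega>. of_bool (stays (\<lambda>x. x \<le> 0) \<omega> n) :: real)"
        by (intro integrable_bounded[where B = 1]) auto
      then have "integrable paths (\<lambda>\<omega>. 1 / (g + 1)\<^sup>2 * of_bool (stays (\<lambda>x. x \<le> 0) \<omega> n))"
        by (rule integrable_mult_right)
      moreover have "integrable paths (\<lambda>\<omega>. \<Sum>j\<le>n. of_bool (stays (\<lambda>x. x \<le> 0) \<omega> n) * b j \<omega>)"
        by (intro Bochner_Integration.integrable_sum bint)
      ultimately show ?thesis by (simp only: Bochner_Integration.integral_diff integral_mult_right_zero)
    qed
    also have "(\<integral>\<omega>. (\<Sum>j\<le>n. of_bool (stays (\<lambda>x. x \<le> 0) \<omega> n) * b j \<omega>) \<partial>paths) = (\<Sum>j\<le>n. cc j n)"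
    proof -
      have "(\<integral>\<omega>. (\<Sum>j\<le>n. of_bool (stays (\<lambda>x. x \<le> 0) \<omega> n) * b j \<omega>) \<partial>paths)
          = (\<Sum>j\<le>n. \<integral>\<omega>. of_bool (stays (\<lambda>x. x \<le> 0) \<omega> n) * b j \<omega> \<partial>paths)"
        by (rule Bochner_Integration.integral_sum) (rule bint)
      also have "\<dots> = (\<Sum>j\<le>n. cc j n)" unfolding cc_def
        using b dep by (intro sum.cong refl stays_split[where B = 1]) (auto simp: abs_of_nonneg)
      finally show ?thesis .
    qed
    finally show ?thesis by (simp add: integral_of_bool tail_def)
  qed
  have cc_nonneg: "0 \<le> cc j n" for j n
    unfolding cc_def using b max_tail_nonneg by (intro integral_nonneg_AE) auto
  have cc_le: "cc j n \<le> 2 * c * down_weight (1 / 2) j * tail (n - j)" for j n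
    unfolding cc_def using b by (intro stays_split_le c) auto
  have cc_conv: "convergent (\<lambda>n. cc j n / tail n)" for j
  proof -
    obtain K where K: "\<And>n. \<bar>tail (n - j) / tail n\<bar> \<le> K"
      using tendsto_imp_abs_bounded[OF p_ratio_shift] by blast
    define s where "s n \<omega> = of_bool (stays (\<lambda>x. x \<le> 0) \<omega> j) * b j \<omega> * max_tail (- partial_sum \<omega> j) (n - j) / tail n" for n \<omega>
    have [measurable]: "s n \<in> borel_measurable paths" for n unfolding s_def by measurable
    have conv: "convergent (\<lambda>n. s n \<omega>)" for \<omega>
    proof (cases "stays (\<lambda>x. x \<le> 0) \<omega> j")
      case True
      then have "convergent (\<lambda>n. max_tail (- partial_sum \<omega> j) n / tail n)"
        by (intro max_tail_ratio_convergent) (use stays_nonpos in auto)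
      then obtain V where V: "(\<lambda>n. max_tail (- partial_sum \<omega> j) n / tail n) \<longlonglongrightarrow> V"
        by (auto simp: convergent_def)
      have "(\<lambda>n. b j \<omega> * ((max_tail (- partial_sum \<omega> j) (n - j) / tail (n - j)) * (tail (n - j) / tail n))) \<longlonglongrightarrow> b j \<omega> * (V * 1)"
        by (intro tendsto_intros p_ratio_shift filterlim_compose[OF V filterlim_minus_const_nat_at_top])
      then show ?thesis using True by (auto simp: s_def convergent_def)
    qed (simp add: s_def convergent_const)
    have "(\<lambda>n. \<integral>\<omega>. s n \<omega> \<partial>paths) \<longlonglongrightarrow> (\<integral>\<omega>. Topological_Spaces.lim (\<lambda>n. s n \<omega>) \<partial>paths)"
    proof (rule integral_dominated_convergence[where w = "\<lambda>_. 2 * c * K"])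
      show "AE \<omega> in paths. (\<lambda>n. s n \<omega>) \<longlonglongrightarrow> Topological_Spaces.lim (\<lambda>n. s n \<omega>)"
        using conv by (simp add: convergent_LIMSEQ_iff)
      show "AE \<omega> in paths. norm (s n \<omega>) \<le> 2 * c * K" for n
      proof (intro AE_I2)
        fix \<omega>
        have pos: "0 < tail n" "0 < tail (n - j)" using p_pos by auto
        have e1: "of_bool (stays (\<lambda>x. x \<le> 0) \<omega> j) * exp ((1 / 2) * partial_sum \<omega> j) \<le> 1"
          using stays_nonpos[of \<omega> j] by (cases "stays (\<lambda>x. x \<le> 0) \<omega> j") auto
        have "of_bool (stays (\<lambda>x. x \<le> 0) \<omega> j) * b j \<omega> * max_tail (- partial_sum \<omega> j) (n - j)
          \<le> 2 * c * tail (n - j) * (of_bool (stays (\<lambda>x. x \<le> 0) \<omega> j) * exp ((1 / 2) * partial_sum \<omega> j))"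
          using b by (intro stays_split_pointwise c) auto
        also have "\<dots> \<le> 2 * c * tail (n - j) * 1"
          using c(1) pos e1 by (intro mult_left_mono) auto
        finally have "s n \<omega> \<le> 2 * c * (tail (n - j) / tail n)"
          using pos unfolding s_def by (simp add: field_simps)
        also have "\<dots> \<le> 2 * c * K" using c(1) abs_le_D1[OF K[of n]] by (intro mult_left_mono) auto
        finally have "s n \<omega> \<le> 2 * c * K" .
        moreover have "0 \<le> s n \<omega>" unfolding s_def using b max_tail_nonneg pos by (intro divide_nonneg_pos mult_nonneg_nonneg) auto
        ultimately show "norm (s n \<omega>) \<le> 2 * c * K" by simp
      qed
    qed auto
    moreover have "(\<integral>\<omega>. s n \<omega> \<partial>paths) = cc j n / tail n" for n
      unfolding s_def cc_def by (rule integral_divide_zero)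
    ultimately show ?thesis by (auto simp: convergent_def)
  qed
  have "(\<lambda>n. (\<Sum>j\<le>n. cc j n) / tail n) \<longlonglongrightarrow> suminf (\<lambda>j. Topological_Spaces.lim (\<lambda>n. cc j n / tail n))"
  proof (rule convolution_tail_tendsto[where e = "\<lambda>j. 2 * c * down_weight (1 / 2) j"])
    show "summable (\<lambda>j. 2 * c * down_weight (1 / 2) j)" by (intro summable_mult down_weight) simp
    show "0 \<le> 2 * c * down_weight (1 / 2) j" for j using c(1) down_weight(2)[of "1 / 2" j] by simp
    show "(\<lambda>n. real n * (2 * c * down_weight (1 / 2) n)) \<longlonglongrightarrow> 0"
      using tendsto_mult[OF tendsto_const down_weight(3)[of "1 / 2"], of "2 * c"] by (simp add: mult_ac)
    show "\<bar>cc j n\<bar> \<le> 2 * c * down_weight (1 / 2) j * tail (n - j)" for j n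
      using cc_nonneg cc_le by simp
    show "(\<lambda>n. cc j n / tail n) \<longlonglongrightarrow> Topological_Spaces.lim (\<lambda>n. cc j n / tail n)" for j
      using cc_conv by (simp add: convergent_LIMSEQ_iff)
  qed
  from tendsto_diff[OF tendsto_const this, of "1 / (g + 1)\<^sup>2"]
  show ?thesis unfolding phi by (auto simp: diff_divide_distrib convergent_def)
qed

definition total_functional :: "nat \<Rightarrow> real" where
  "total_functional n = (\<integral>\<omega>. 1 / (expsum \<omega> n)\<^sup>2 \<partial>paths)"

lemma total_functional_integrable: "integrable paths (\<lambda>\<omega>. 1 / (expsum \<omega> n)\<^sup>2)"
  using inverse_square_le_1[of 0] by (intro integrable_bounded[where B = 1]) auto

lemma measurable_stays_functional [measurable]:
  "(\<lambda>\<omega>. stays_functional (past_expsum \<omega> k) n) \<in> borel_measurable paths"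
  unfolding stays_functional_def by measurable

lemma total_functional_eq:
  "total_functional n = (\<Sum>k\<le>n. \<integral>\<omega>. of_bool (ladder (\<lambda>x. 0 < x) \<omega> k) *
     (exp (- 2 * partial_sum \<omega> k) * stays_functional (past_expsum \<omega> k) (n - k)) \<partial>paths)"
proof -
  have "total_functional n = (\<Sum>k\<le>n. \<integral>\<omega>. of_bool (ladder (\<lambda>x. 0 < x) \<omega> k) *
     (\<integral>\<omega>'. of_bool (stays (\<lambda>x. x \<le> 0) \<omega>' (n - k)) * (1 / (expsum (comb_seq k \<omega> \<omega>') n)\<^sup>2) \<partial>paths) \<partial>paths)"
    unfolding total_functional_def using inverse_square_le_1[of 0]
    by (intro integral_split_max[where B = 1]) auto
  also have "\<dots> = (\<Sum>k\<le>n. \<integral>\<omega>. of_bool (ladder (\<lambda>x. 0 < x) \<omega> k) *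
     (exp (- 2 * partial_sum \<omega> k) * stays_functional (past_expsum \<omega> k) (n - k)) \<partial>paths)"
  proof (intro sum.cong refl Bochner_Integration.integral_cong arg_cong2[where f = "(*)"])
    fix k \<omega> assume k: "k \<in> {..n}"
    have "1 / (expsum (comb_seq k \<omega> \<omega>') n)\<^sup>2 = exp (- 2 * partial_sum \<omega> k) * (1 / (past_expsum \<omega> k + expsum \<omega>' (n - k))\<^sup>2)" for \<omega>'
      using k by (simp add: expsum_comb_seq power_mult_distrib exp_minus divide_inverse exp_double)
    then have "of_bool (stays (\<lambda>x. x \<le> 0) \<omega>' (n - k)) * (1 / (expsum (comb_seq k \<omega> \<omega>') n)\<^sup>2)
        = exp (- 2 * partial_sum \<omega> k) * (of_bool (stays (\<lambda>x. x \<le> 0) \<omega>' (n - k)) * (1 / (past_expsum \<omega> k + expsum \<omega>' (n - k))\<^sup>2))" for \<omega>'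
      by simp
    then show "(\<integral>\<omega>'. of_bool (stays (\<lambda>x. x \<le> 0) \<omega>' (n - k)) * (1 / (expsum (comb_seq k \<omega> \<omega>') n)\<^sup>2) \<partial>paths)
       = exp (- 2 * partial_sum \<omega> k) * stays_functional (past_expsum \<omega> k) (n - k)"
      unfolding stays_functional_def by (simp only: integral_mult_right_zero)
  qed
  finally show ?thesis .
qed

lemma ladder_nonneg: "ladder (\<lambda>x. 0 < x) \<omega> k \<Longrightarrow> 0 \<le> partial_sum \<omega> k"
  by (cases "k = 0") (auto simp: ladder_def dest!: bspec[of _ _ 0])

lemma ladder_exp_integrable:
  assumes "0 \<le> \<theta>"
  shows "integrable paths (\<lambda>\<omega>. of_bool (ladder (\<lambda>x. 0 < x) \<omega> j) * exp (- \<theta> * partial_sum \<omega> j))"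
proof (rule integrable_bounded[where B = 1])
  show "\<bar>of_bool (ladder (\<lambda>x. 0 < x) \<omega> j) * exp (- \<theta> * partial_sum \<omega> j)\<bar> \<le> 1" for \<omega>
    using ladder_nonneg[of \<omega> j] assms by (auto simp: abs_mult)
qed measurable

lemma total_functional_ratio_convergent: "convergent (\<lambda>n. total_functional n / tail n)"
proof -
  define cc where "cc k n = (\<integral>\<omega>. of_bool (ladder (\<lambda>x. 0 < x) \<omega> k) *
     (exp (- 2 * partial_sum \<omega> k) * stays_functional (past_expsum \<omega> k) (n - k)) \<partial>paths)" for k n
  have pw: "of_bool (ladder (\<lambda>x. 0 < x) \<omega> k) * (exp (- 2 * partial_sum \<omega> k) * stays_functional (past_expsum \<omega> k) m)
     \<le> tail m * (of_bool (ladder (\<lambda>x. 0 < x) \<omega> k) * exp (- 1 * partial_sum \<omega> k))" for \<omega> k m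
  proof (cases "ladder (\<lambda>x. 0 < x) \<omega> k")
    case True
    have "exp (- 2 * partial_sum \<omega> k) * stays_functional (past_expsum \<omega> k) m \<le> exp (- 1 * partial_sum \<omega> k) * tail m"
      using ladder_nonneg[OF True] stays_functional_bounds[OF past_expsum_nonneg, of \<omega> k m]
      by (intro mult_mono) auto
    then show ?thesis using True by (simp add: mult_ac)
  qed simp
  have nn: "0 \<le> of_bool (ladder (\<lambda>x. 0 < x) \<omega> k) * (exp (- 2 * partial_sum \<omega> k) * stays_functional (past_expsum \<omega> k) m)" for \<omega> k m
    using stays_functional_bounds(1)[OF past_expsum_nonneg, of \<omega> k m] by simp
  have cc_nonneg: "0 \<le> cc k n" for k n unfolding cc_def by (intro integral_nonneg_AE AE_I2 nn)
  have cc_le: "cc k n \<le> up_weight 1 k * tail (n - k)" for k n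
  proof -
    have "cc k n \<le> (\<integral>\<omega>. tail (n - k) * (of_bool (ladder (\<lambda>x. 0 < x) \<omega> k) * exp (- 1 * partial_sum \<omega> k)) \<partial>paths)"
      unfolding cc_def
    proof (rule integral_mono')
      show "integrable paths (\<lambda>\<omega>. tail (n - k) * (of_bool (ladder (\<lambda>x. 0 < x) \<omega> k) * exp (- 1 * partial_sum \<omega> k)))"
        by (intro integrable_mult_right ladder_exp_integrable) simp
      show "0 \<le> tail (n - k) * (of_bool (ladder (\<lambda>x. 0 < x) \<omega> k) * exp (- 1 * partial_sum \<omega> k))" for \<omega>
        using p_pos[of "n - k"] by simp
    qed (rule pw)
    then show ?thesis by (simp add: up_weight_def mult.commute)
  qed
  have cc_conv: "convergent (\<lambda>n. cc k n / tail n)" for k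
  proof -
    obtain K where K: "\<And>n. \<bar>tail (n - k) / tail n\<bar> \<le> K"
      using tendsto_imp_abs_bounded[OF p_ratio_shift] by blast
    define s where "s n \<omega> = of_bool (ladder (\<lambda>x. 0 < x) \<omega> k) *
     (exp (- 2 * partial_sum \<omega> k) * stays_functional (past_expsum \<omega> k) (n - k)) / tail n" for n \<omega>
    have [measurable]: "s n \<in> borel_measurable paths" for n unfolding s_def by measurable
    have conv: "convergent (\<lambda>n. s n \<omega>)" for \<omega>
    proof -
      obtain V where V: "(\<lambda>n. stays_functional (past_expsum \<omega> k) n / tail n) \<longlonglongrightarrow> V"
        using stays_functional_ratio_convergent[OF past_expsum_nonneg] by (auto simp: convergent_def)
      have "(\<lambda>n. of_bool (ladder (\<lambda>x. 0 < x) \<omega> k) * exp (- 2 * partial_sum \<omega> k) *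
          ((stays_functional (past_expsum \<omega> k) (n - k) / tail (n - k)) * (tail (n - k) / tail n)))
          \<longlonglongrightarrow> of_bool (ladder (\<lambda>x. 0 < x) \<omega> k) * exp (- 2 * partial_sum \<omega> k) * (V * 1)"
        by (intro tendsto_intros p_ratio_shift filterlim_compose[OF V filterlim_minus_const_nat_at_top])
      moreover have "of_bool (ladder (\<lambda>x. 0 < x) \<omega> k) * exp (- 2 * partial_sum \<omega> k) *
          ((stays_functional (past_expsum \<omega> k) (n - k) / tail (n - k)) * (tail (n - k) / tail n)) = s n \<omega>" for n
        unfolding s_def by simp
      ultimately show ?thesis by (auto simp: convergent_def)
    qed
    have "(\<lambda>n. \<integral>\<omega>. s n \<omega> \<partial>paths) \<longlonglongrightarrow> (\<integral>\<omega>. Topological_Spaces.lim (\<lambda>n. s n \<omega>) \<partial>paths)"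
    proof (rule integral_dominated_convergence[where w = "\<lambda>_. K"])
      show "AE \<omega> in paths. (\<lambda>n. s n \<omega>) \<longlonglongrightarrow> Topological_Spaces.lim (\<lambda>n. s n \<omega>)"
        using conv by (simp add: convergent_LIMSEQ_iff)
      show "AE \<omega> in paths. norm (s n \<omega>) \<le> K" for n
      proof (intro AE_I2)
        fix \<omega>
        have pos: "0 < tail n" "0 < tail (n - k)" using p_pos by auto
        have e1: "of_bool (ladder (\<lambda>x. 0 < x) \<omega> k) * exp (- 1 * partial_sum \<omega> k) \<le> 1"
          using ladder_nonneg[of \<omega> k] by (cases "ladder (\<lambda>x. 0 < x) \<omega> k") auto
        have "s n \<omega> \<le> tail (n - k) * (of_bool (ladder (\<lambda>x. 0 < x) \<omega> k) * exp (- 1 * partial_sum \<omega> k)) / tail n"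
          unfolding s_def using pos by (intro divide_right_mono pw) auto
        also have "\<dots> \<le> tail (n - k) * 1 / tail n"
          using pos e1 by (intro divide_right_mono mult_left_mono) auto
        also have "\<dots> \<le> K" using abs_le_D1[OF K[of n]] by simp
        finally have "s n \<omega> \<le> K" .
        moreover have "0 \<le> s n \<omega>" unfolding s_def using pos by (intro divide_nonneg_pos nn) auto
        ultimately show "norm (s n \<omega>) \<le> K" by simp
      qed
    qed auto
    moreover have "(\<integral>\<omega>. s n \<omega> \<partial>paths) = cc k n / tail n" for n
      unfolding s_def cc_def by (rule integral_divide_zero)
    ultimately show ?thesis by (auto simp: convergent_def)
  qed
  have "(\<lambda>n. (\<Sum>k\<le>n. cc k n) / tail n) \<longlonglongrightarrow> suminf (\<lambda>k. Topological_Spaces.lim (\<lambda>n. cc k n / tail n))"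
  proof (rule convolution_tail_tendsto[where e = "up_weight 1"])
    show "\<bar>cc k n\<bar> \<le> up_weight 1 k * tail (n - k)" for k n using cc_nonneg cc_le by simp
    show "(\<lambda>n. cc k n / tail n) \<longlonglongrightarrow> Topological_Spaces.lim (\<lambda>n. cc k n / tail n)" for k
      using cc_conv by (simp add: convergent_LIMSEQ_iff)
  qed (intro up_weight; simp)+
  then show ?thesis unfolding total_functional_eq cc_def by (rule convergentI)
qed

lemma total_functional_ge: "\<exists>c>0. \<forall>n. c * tail n \<le> total_functional n"
proof -
  obtain c where c: "c > 0" "\<And>x n. 0 \<le> x \<Longrightarrow> max_tail x n \<le> c * exp (x / 2) * tail n"
    using max_tail_le by blast
  obtain D where D: "D > 0" "\<And>n. (\<Sum>j\<le>n. down_weight (1 / 2) j * tail (n - j)) \<le> D * tail n"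
    using convolution_tail_le[OF down_weight[of "1 / 2"]] by auto
  define t where "t = 1 / (c * D)"
  have t: "t > 0" using c D by (simp add: t_def)
  have "t\<^sup>2 * tail n \<le> total_functional n" for n
  proof -
    let ?st = "\<lambda>\<omega>. of_bool (stays (\<lambda>x. x \<le> 0) \<omega> n) :: real"
    let ?m = "\<lambda>j \<omega>. min 1 (exp (partial_sum \<omega> j)) :: real"
    have int1: "integrable paths ?st" by (intro integrable_bounded[where B = 1]) auto
    have int2: "integrable paths (\<lambda>\<omega>. ?st \<omega> * ?m j \<omega>)" for j
      by (intro integrable_bounded[where B = 1]) (auto simp: abs_mult)
    have each: "(\<integral>\<omega>. ?st \<omega> * ?m j \<omega> \<partial>paths) \<le> c * (down_weight (1 / 2) j * tail (n - j))" if "j \<le> n" for j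
    proof -
      have "(\<integral>\<omega>. ?st \<omega> * ?m j \<omega> \<partial>paths) = (\<integral>\<omega>. of_bool (stays (\<lambda>x. x \<le> 0) \<omega> j) * ?m j \<omega> * max_tail (- partial_sum \<omega> j) (n - j) \<partial>paths)"
        using that by (intro stays_split[where B = 1]) (auto simp: partial_sum_comb_seq_le)
      also have "\<dots> \<le> 1 * c * down_weight (1 / 2) j * tail (n - j)"
        by (intro stays_split_le c) auto
      finally show ?thesis by (simp add: mult.assoc)
    qed
    have pw: "3 * t\<^sup>2 * ?st \<omega> - 2 * t ^ 3 * (\<Sum>j\<le>n. ?st \<omega> * ?m j \<omega>) \<le> 1 / (expsum \<omega> n)\<^sup>2" for \<omega>
    proof (cases "stays (\<lambda>x. x \<le> 0) \<omega> n")
      case True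
      have "partial_sum \<omega> j \<le> 0" if "j \<le> n" for j
        using stays_mono[OF that True] stays_nonpos by blast
      then have "(\<Sum>j\<le>n. ?st \<omega> * ?m j \<omega>) = expsum \<omega> n"
        unfolding expsum_def using True by (intro sum.cong refl) (simp add: min_absorb2)
      moreover have "3 * t\<^sup>2 - 2 * t ^ 3 * h \<le> 1 / h\<^sup>2" if h: "h > 0" for h
      proof -
        have "0 \<le> (t * h - 1)\<^sup>2 * (2 * (t * h) + 1)" using t h by simp
        then have "(3 * t\<^sup>2 - 2 * t ^ 3 * h) * h\<^sup>2 \<le> 1"
          by (simp add: algebra_simps power2_eq_square power3_eq_cube)
        then show ?thesis using h by (simp add: pos_le_divide_eq)
      qed
      ultimately show ?thesis using True expsum_ge_1[of \<omega> n] by simp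
    qed simp
    have "3 * t\<^sup>2 * tail n - 2 * t ^ 3 * (c * D * tail n) \<le> 3 * t\<^sup>2 * tail n - 2 * t ^ 3 * (\<Sum>j\<le>n. \<integral>\<omega>. ?st \<omega> * ?m j \<omega> \<partial>paths)"
    proof -
      have "(\<Sum>j\<le>n. \<integral>\<omega>. ?st \<omega> * ?m j \<omega> \<partial>paths) \<le> (\<Sum>j\<le>n. c * (down_weight (1 / 2) j * tail (n - j)))"
        by (intro sum_mono each) auto
      also have "\<dots> \<le> c * (D * tail n)" unfolding sum_distrib_left[symmetric] using D(2) c(1) by (intro mult_left_mono) auto
      finally have "2 * t ^ 3 * (\<Sum>j\<le>n. \<integral>\<omega>. ?st \<omega> * ?m j \<omega> \<partial>paths) \<le> 2 * t ^ 3 * (c * (D * tail n))"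
        using t by (intro mult_left_mono) auto
      then show ?thesis by (simp add: mult.assoc)
    qed
    also have "\<dots> = (\<integral>\<omega>. 3 * t\<^sup>2 * ?st \<omega> - 2 * t ^ 3 * (\<Sum>j\<le>n. ?st \<omega> * ?m j \<omega>) \<partial>paths)"
    proof -
      have "(\<integral>\<omega>. 3 * t\<^sup>2 * ?st \<omega> - 2 * t ^ 3 * (\<Sum>j\<le>n. ?st \<omega> * ?m j \<omega>) \<partial>paths)
        = (\<integral>\<omega>. 3 * t\<^sup>2 * ?st \<omega> \<partial>paths) - (\<integral>\<omega>. 2 * t ^ 3 * (\<Sum>j\<le>n. ?st \<omega> * ?m j \<omega>) \<partial>paths)"
        by (intro Bochner_Integration.integral_diff integrable_mult_right Bochner_Integration.integrable_sum int1 int2)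
      also have "(\<integral>\<omega>. 3 * t\<^sup>2 * ?st \<omega> \<partial>paths) = 3 * t\<^sup>2 * tail n"
        by (subst integral_mult_right_zero) (simp add: integral_of_bool tail_def)
      also have "(\<integral>\<omega>. 2 * t ^ 3 * (\<Sum>j\<le>n. ?st \<omega> * ?m j \<omega>) \<partial>paths) = 2 * t ^ 3 * (\<Sum>j\<le>n. \<integral>\<omega>. ?st \<omega> * ?m j \<omega> \<partial>paths)"
        by (subst integral_mult_right_zero, subst Bochner_Integration.integral_sum[OF int2]) simp
      finally show ?thesis by simp
    qed
    also have "\<dots> \<le> total_functional n"
      unfolding total_functional_def
      by (intro integral_mono pw total_functional_integrable Bochner_Integration.integrable_diff integrable_mult_right
          Bochner_Integration.integrable_sum int1 int2)
    finally have "3 * t\<^sup>2 * tail n - 2 * t ^ 3 * (c * D * tail n) \<le> total_functional n" .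
    moreover have "t ^ 3 * (c * D) = t\<^sup>2"
      using c D by (simp add: t_def power2_eq_square power3_eq_cube)
    then have "t ^ 3 * (c * D * tail n) = t\<^sup>2 * tail n" by (metis mult.assoc)
    ultimately show ?thesis by linarith
  qed
  then show ?thesis using t by (intro exI[of _ "t\<^sup>2"]) auto
qed

definition end_functional :: "nat \<Rightarrow> real" where
  "end_functional n = (\<integral>\<omega>. exp (partial_sum \<omega> n) / (expsum \<omega> n)\<^sup>2 \<partial>paths)"

lemma end_functional_integrable: "integrable paths (\<lambda>\<omega>. exp (partial_sum \<omega> n) / (expsum \<omega> n)\<^sup>2)"
  using exp_over_expsum_bounds by (intro integrable_bounded[where B = 1]) auto

lemma end_functional_le: "end_functional n \<le> (\<Sum>k\<le>n. up_weight 1 k * down_weight 1 (n - k))"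
proof -
  let ?l = "\<lambda>k \<omega>. of_bool (ladder (\<lambda>x. 0 < x) \<omega> k) * exp (- 1 * partial_sum \<omega> k) :: real"
  let ?s = "\<lambda>k \<omega>. of_bool (stays (\<lambda>x. x \<le> 0) \<omega> (n - k)) * exp (1 * partial_sum \<omega> (n - k)) :: real"
  have m [measurable]: "(\<lambda>\<omega>. ?s k (\<lambda>i. \<omega> (k + i))) \<in> borel_measurable paths" for k
    by (rule measurable_shift) measurable
  have b: "\<bar>?l k \<omega>\<bar> \<le> 1" "\<bar>?s k \<omega>\<bar> \<le> 1" for k \<omega>
    using ladder_nonneg[of \<omega> k] stays_nonpos[of \<omega> "n - k"] by (auto simp: abs_mult)
  have int: "integrable paths (\<lambda>\<omega>. ?l k \<omega> * ?s k (\<lambda>i. \<omega> (k + i)))" for k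
  proof (rule integrable_bounded[where B = "1 * 1"])
    show "\<bar>?l k \<omega> * ?s k (\<lambda>i. \<omega> (k + i))\<bar> \<le> 1 * 1" for \<omega>
      unfolding abs_mult[of "?l k \<omega>"] by (intro mult_mono b) auto
  qed measurable
  have "end_functional n \<le> (\<integral>\<omega>. (\<Sum>k\<le>n. ?l k \<omega> * ?s k (\<lambda>i. \<omega> (k + i))) \<partial>paths)"
    unfolding end_functional_def
  proof (rule integral_mono[OF end_functional_integrable])
    show "integrable paths (\<lambda>\<omega>. \<Sum>k\<le>n. ?l k \<omega> * ?s k (\<lambda>i. \<omega> (k + i)))"
      by (intro Bochner_Integration.integrable_sum int)
    fix \<omega>
    let ?f = "exp (partial_sum \<omega> n) / (expsum \<omega> n)\<^sup>2"
    have "?f = (\<Sum>k\<le>n. of_bool (ladder (\<lambda>x. 0 < x) \<omega> k) * of_bool (stays (\<lambda>x. x \<le> 0) (\<lambda>i. \<omega> (k + i)) (n - k)) * ?f)"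
      unfolding sum_distrib_right[symmetric] split_at_maximum by simp
    also have "\<dots> \<le> (\<Sum>k\<le>n. ?l k \<omega> * ?s k (\<lambda>i. \<omega> (k + i)))"
    proof (rule sum_mono)
      fix k assume k: "k \<in> {..n}"
      have "?f \<le> exp (partial_sum \<omega> n) / (exp (partial_sum \<omega> k))\<^sup>2"
        using k expsum_ge_1[of \<omega> n] by (intro divide_left_mono power_mono exp_le_expsum) auto
      also have "\<dots> = exp (partial_sum \<omega> n - 2 * partial_sum \<omega> k)"
        by (simp add: exp_diff exp_double)
      also have "\<dots> = exp (- 1 * partial_sum \<omega> k) * exp (1 * partial_sum (\<lambda>i. \<omega> (k + i)) (n - k))"
        using k by (simp add: partial_sum_shift flip: exp_add)
      finally show "of_bool (ladder (\<lambda>x. 0 < x) \<omega> k) * of_bool (stays (\<lambda>x. x \<le> 0) (\<lambda>i. \<omega> (k + i)) (n - k)) * ?f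
          \<le> ?l k \<omega> * ?s k (\<lambda>i. \<omega> (k + i))"
        by (auto simp: of_bool_def)
    qed
    finally show "?f \<le> (\<Sum>k\<le>n. ?l k \<omega> * ?s k (\<lambda>i. \<omega> (k + i)))" .
  qed
  also have "\<dots> = (\<Sum>k\<le>n. \<integral>\<omega>. ?l k \<omega> * ?s k (\<lambda>i. \<omega> (k + i)) \<partial>paths)"
    by (intro Bochner_Integration.integral_sum int)
  also have "\<dots> = (\<Sum>k\<le>n. up_weight 1 k * down_weight 1 (n - k))"
    unfolding up_weight_def down_weight_def
  proof (intro sum.cong refl integral_split_product[where B = 1 and B' = 1] b)
    show "?l k (comb_seq k \<omega> \<omega>') = ?l k \<omega>" for k \<omega> \<omega>'
      by (simp add: ladder_comb_seq partial_sum_comb_seq_le)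
  qed measurable
  finally show ?thesis .
qed

lemma end_functional_ratio: "(\<lambda>n. end_functional n / tail n) \<longlonglongrightarrow> 0"
proof (rule tendsto_smaller_than_tail, rule tendsto_sandwich[where f = "\<lambda>_. 0"])
  show "(\<lambda>n. real n * (\<Sum>k\<le>n. up_weight 1 k * down_weight 1 (n - k))) \<longlonglongrightarrow> 0"
    using up_weight[of 1] down_weight[of 1] by (intro weighted_convolution_tendsto_0) auto
  show "\<forall>\<^sub>F n in sequentially. real n * end_functional n \<le> real n * (\<Sum>k\<le>n. up_weight 1 k * down_weight 1 (n - k))"
    by (intro always_eventually allI mult_left_mono end_functional_le) auto
  show "\<forall>\<^sub>F n in sequentially. 0 \<le> real n * end_functional n"
    unfolding end_functional_def
    by (intro always_eventually allI mult_nonneg_nonneg integral_nonneg_AE AE_I2 exp_over_expsum_bounds) auto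
qed simp

theorem functional_asymptotics:
  "\<exists>l R. slowly_varying l \<and> 0 < R \<and>
     (\<lambda>n. real n powr \<rho> * l (real n) * total_functional n) \<longlonglongrightarrow> R \<and>
     (\<lambda>n. real n powr \<rho> * l (real n) * end_functional n) \<longlonglongrightarrow> 0"
proof -
  obtain c0 where c0: "c0 > 0" "(\<lambda>n. real n powr \<rho> * slow_factor (real n) * tail n) \<longlonglongrightarrow> c0"
    using slow_factor_tail_tendsto by auto
  obtain R where R: "(\<lambda>n. total_functional n / tail n) \<longlonglongrightarrow> R"
    using total_functional_ratio_convergent by (auto simp: convergent_def)
  obtain c where c: "c > 0" "\<And>n. c * tail n \<le> total_functional n" using total_functional_ge by blast
  have "c \<le> total_functional n / tail n" for n
    using c(2)[of n] p_pos[of n] by (simp add: field_simps)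
  then have "c \<le> R" by (intro LIMSEQ_le_const[OF R]) auto
  have "(\<lambda>n. real n powr \<rho> * slow_factor (real n) * tail n * (total_functional n / tail n)) \<longlonglongrightarrow> c0 * R"
    by (intro tendsto_mult c0 R)
  moreover have "(\<lambda>n. real n powr \<rho> * slow_factor (real n) * tail n * (end_functional n / tail n)) \<longlonglongrightarrow> c0 * 0"
    by (intro tendsto_mult c0 end_functional_ratio)
  ultimately show ?thesis
    using slowly_varying_slow_factor c0(1) c(1) \<open>c \<le> R\<close>
    by (intro exI[of _ slow_factor] exI[of _ "c0 * R"]) (simp add: mult.assoc)
qed

end

section \<open>Stable limits\<close>

lemma (in prob_space) distr_iid_sequence:
  fixes X :: "nat \<Rightarrow> 'a \<Rightarrow> 'b" and g :: "'b \<Rightarrow> real"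
  assumes indep: "indep_vars (\<lambda>_. N) X {1..}" and law: "\<And>n. 1 \<le> n \<Longrightarrow> distr M N (X n) = L"
    and g [measurable]: "g \<in> borel_measurable N"
  shows "distr M (\<Pi>\<^sub>M i\<in>(UNIV::nat set). distr L borel g) (\<lambda>\<omega> i. g (X (Suc i) \<omega>))
    = (\<Pi>\<^sub>M i\<in>(UNIV::nat set). distr L borel g)"
proof -
  define \<nu> where "\<nu> = distr L borel g"
  have X: "X n \<in> measurable M N" if "1 \<le> n" for n
    using indep that by (auto simp: indep_vars_def)
  have gX: "(\<lambda>\<omega>. g (X n \<omega>)) \<in> borel_measurable M" if "1 \<le> n" for n
    using X[OF that] g by (rule measurable_compose)
  have nu: "distr M borel (\<lambda>\<omega>. g (X n \<omega>)) = \<nu>" if "1 \<le> n" for n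
  proof -
    have "distr (distr M N (X n)) borel g = distr M borel (g \<circ> X n)"
      by (rule distr_distr[OF g X[OF that]])
    then show ?thesis using law[OF that] by (simp add: \<nu>_def comp_def)
  qed
  have prob: "prob_space \<nu>" using nu[of 1] prob_space_distr[OF gX[of 1]] by simp
  have [measurable_cong]: "sets \<nu> = sets borel" by (simp add: \<nu>_def)
  have "indep_vars (\<lambda>_. borel) (\<lambda>i \<omega>. g (X i \<omega>)) {1..}"
    by (rule indep_vars_compose2[OF indep]) measurable
  then have "distr M (\<Pi>\<^sub>M i\<in>{1..}. borel) (\<lambda>\<omega>. \<lambda>i\<in>{1..}. g (X i \<omega>)) = (\<Pi>\<^sub>M i\<in>{1..}. distr M borel (\<lambda>\<omega>. g (X i \<omega>)))"
    by (subst (asm) indep_vars_iff_distr_eq_PiM') (auto intro: gX)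
  also have "\<dots> = (\<Pi>\<^sub>M i\<in>{1..}. \<nu>)" by (intro PiM_cong) (auto simp: nu)
  finally have 1: "distr M (\<Pi>\<^sub>M i\<in>{1..}. borel) (\<lambda>\<omega>. \<lambda>i\<in>{1..}. g (X i \<omega>)) = (\<Pi>\<^sub>M i\<in>{1..}. \<nu>)" .
  have "(\<Pi>\<^sub>M i\<in>(UNIV::nat set). \<nu>) = distr (\<Pi>\<^sub>M i\<in>{1..}. \<nu>) (\<Pi>\<^sub>M i\<in>(UNIV::nat set). \<nu>) (\<lambda>\<omega> i. \<omega> (Suc i))"
    using distr_PiM_reindex[of "{1..}" "\<lambda>_. \<nu>" Suc UNIV] prob by (simp add: restrict_def)
  also have "\<dots> = distr (distr M (\<Pi>\<^sub>M i\<in>{1..}. borel) (\<lambda>\<omega>. \<lambda>i\<in>{1..}. g (X i \<omega>))) (\<Pi>\<^sub>M i\<in>(UNIV::nat set). \<nu>) (\<lambda>\<omega> i. \<omega> (Suc i))"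
    by (simp only: 1)
  also have "\<dots> = distr M (\<Pi>\<^sub>M i\<in>(UNIV::nat set). \<nu>) ((\<lambda>\<omega> i. \<omega> (Suc i)) \<circ> (\<lambda>\<omega>. \<lambda>i\<in>{1..}. g (X i \<omega>)))"
  proof (rule distr_distr)
    show "(\<lambda>\<omega>. \<lambda>i\<in>{1..}. g (X i \<omega>)) \<in> measurable M (\<Pi>\<^sub>M i\<in>{1..}. borel)"
      by (intro measurable_restrict gX) auto
    have "(\<lambda>\<omega> i. \<omega> (Suc i)) \<in> measurable (\<Pi>\<^sub>M i\<in>{1..}. borel) (\<Pi>\<^sub>M i\<in>(UNIV::nat set). borel)"
      by (intro measurable_PiM_single' measurable_component_singleton) (auto simp: space_PiM)
    moreover have "sets (\<Pi>\<^sub>M i\<in>(UNIV::nat set). \<nu>) = sets (\<Pi>\<^sub>M i\<in>(UNIV::nat set). (borel :: real measure))"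
      by (intro sets_PiM_cong) (auto simp: \<nu>_def)
    ultimately show "(\<lambda>\<omega> i. \<omega> (Suc i)) \<in> measurable (\<Pi>\<^sub>M i\<in>{1..}. borel) (\<Pi>\<^sub>M i\<in>(UNIV::nat set). \<nu>)"
      using measurable_cong_sets[OF refl] by blast
  qed
  finally show ?thesis by (simp add: comp_def \<nu>_def)
qed

lemma indep_vars_PiM_coordinates:
  assumes N: "prob_space N" and I: "I \<noteq> {}"
  shows "prob_space.indep_vars (\<Pi>\<^sub>M i\<in>I. N) (\<lambda>_. N) (\<lambda>i e. e i) I"
proof -
  interpret PM: prob_space "\<Pi>\<^sub>M i\<in>I. N" by (intro prob_space_PiM N)
  have "distr (\<Pi>\<^sub>M i\<in>I. N) (\<Pi>\<^sub>M i\<in>I. N) (\<lambda>x. \<lambda>i\<in>I. x i) = distr (\<Pi>\<^sub>M i\<in>I. N) (\<Pi>\<^sub>M i\<in>I. N) (\<lambda>x. x)"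
    by (intro distr_cong refl) (auto simp: space_PiM PiE_iff extensional_restrict)
  also have "\<dots> = (\<Pi>\<^sub>M i\<in>I. distr (\<Pi>\<^sub>M i\<in>I. N) N (\<lambda>x. x i))"
    by (subst distr_id) (auto intro!: PiM_cong simp: distr_PiM_component[of I "\<lambda>_. N"] N)
  finally show ?thesis
    using I by (subst PM.indep_vars_iff_distr_eq_PiM') auto
qed

lemma (in prob_space) finite_large_atoms:
  assumes sing: "\<And>x. {x} \<in> events" and "0 < \<delta>"
  shows "finite {x. \<delta> \<le> prob {x}}"
proof (rule ccontr)
  assume inf: "infinite {x. \<delta> \<le> prob {x}}"
  obtain n :: nat where n: "1 / \<delta> < real n" using reals_Archimedean2 by blast
  obtain A where A: "A \<subseteq> {x. \<delta> \<le> prob {x}}" "finite A" "card A = n"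
    using infinite_arbitrarily_large[OF inf] by blast
  have "real n * \<delta> = (\<Sum>x\<in>A. \<delta>)" using A by simp
  also have "\<dots> \<le> (\<Sum>x\<in>A. prob {x})" using A by (intro sum_mono) auto
  also have "\<dots> = prob A" using A sing by (intro finite_measure_eq_sum_singleton[symmetric]) auto
  also have "\<dots> \<le> 1" by simp
  finally show False using n \<open>0 < \<delta>\<close> by (simp add: field_simps)
qed

text \<open>If \<open>q\<close> is the mass of the largest atom, then the sum of two independent copies can carry an
  atom of mass \<open>q\<close> only if almost all of \<open>\<mu>\<close> sits on finitely many points.\<close>

lemma stable_law_no_atoms:
  assumes st: "stable_law \<alpha> \<mu>" and ts: "two_sided \<mu>"
  shows "measure \<mu> {z} = 0"
proof (rule ccontr)
  assume z: "measure \<mu> {z} \<noteq> 0"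
  interpret real_distribution \<mu> using st by (simp add: stable_law_def)
  interpret PP: pair_prob_space \<mu> \<mu> ..
  have sing: "{x} \<in> sets \<mu>" for x by simp
  let ?A = "{x. prob {z} \<le> prob {x}}"
  have "finite ?A" using z by (intro finite_large_atoms sing) (simp add: less_le)
  moreover have "z \<in> ?A" by simp
  ultimately have "Max ((\<lambda>x. prob {x}) ` ?A) \<in> (\<lambda>x. prob {x}) ` ?A" by (intro Max_in) blast+
  then obtain x0 where x0: "x0 \<in> ?A" "Max ((\<lambda>x. prob {x}) ` ?A) = prob {x0}" by blast
  have x0_max: "prob {x} \<le> prob {x0}" if "x \<in> ?A" for x
    unfolding x0(2)[symmetric] using that \<open>finite ?A\<close> by (intro Max_ge) auto
  define q where "q = prob {x0}"
  have "0 < prob {z}" using z by (simp add: less_le)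
  then have q: "0 < q" using x0(1) unfolding q_def by (simp del: zero_less_measure_iff)
  have le_q: "prob {x} \<le> q" for x
    using x0_max[of x] x0(1) by (cases "x \<in> ?A") (auto simp: q_def)
  obtain d where d: "distr (\<mu> \<Otimes>\<^sub>M \<mu>) borel (\<lambda>(u, v). 1 * u + 1 * v)
        = distr \<mu> borel (\<lambda>u. (1 powr \<alpha> + 1 powr \<alpha>) powr (1 / \<alpha>) * u + d)"
    using st unfolding stable_law_def by (metis zero_less_one)
  define c where "c = (1 powr \<alpha> + 1 powr \<alpha>) powr (1 / \<alpha>)"
  have c: "c > 0" by (simp add: c_def)
  define y where "y = c * x0 + d"
  have "measure (distr \<mu> borel (\<lambda>u. c * u + d)) {y} = measure \<mu> {x0}"
    by (subst measure_distr) (use c in \<open>auto simp: y_def vimage_def\<close>)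
  then have q1: "q = measure (distr (\<mu> \<Otimes>\<^sub>M \<mu>) borel (\<lambda>(u, v). u + v)) {y}"
    using d by (simp add: c_def q_def)
  have "ennreal q = emeasure (distr (\<mu> \<Otimes>\<^sub>M \<mu>) borel (\<lambda>(u, v). u + v)) {y}"
  proof -
    have "prob_space (distr (\<mu> \<Otimes>\<^sub>M \<mu>) borel (\<lambda>(u, v). u + v))"
      by (intro PP.prob_space_distr) measurable
    then show ?thesis using q1 by (simp add: finite_measure.emeasure_eq_measure prob_space.finite_measure)
  qed
  also have "\<dots> = emeasure (\<mu> \<Otimes>\<^sub>M \<mu>) ((\<lambda>(u, v). u + v) -` {y} \<inter> space (\<mu> \<Otimes>\<^sub>M \<mu>))"
    by (intro emeasure_distr) measurable
  also have "\<dots> = (\<integral>\<^sup>+u. emeasure \<mu> (Pair u -` ((\<lambda>(u, v). u + v) -` {y} \<inter> space (\<mu> \<Otimes>\<^sub>M \<mu>))) \<partial>\<mu>)"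
    by (intro emeasure_pair_measure_alt) measurable
  also have "\<dots> = (\<integral>\<^sup>+u. ennreal (prob {y - u}) \<partial>\<mu>)"
  proof (intro nn_integral_cong)
    fix u
    have "Pair u -` ((\<lambda>(u, v). u + v) -` {y} \<inter> space (\<mu> \<Otimes>\<^sub>M \<mu>)) = {y - u}"
      by (auto simp: space_pair_measure)
    then show "emeasure \<mu> (Pair u -` ((\<lambda>(u, v). u + v) -` {y} \<inter> space (\<mu> \<Otimes>\<^sub>M \<mu>))) = ennreal (prob {y - u})"
      by (simp add: emeasure_eq_measure)
  qed
  finally have int: "ennreal q = (\<integral>\<^sup>+u. ennreal (prob {y - u}) \<partial>\<mu>)" .
  define A where "A = {u. q \<le> prob {y - u}}"
  have "finite A"
  proof -
    have "A = (\<lambda>x. y - x) ` {x. q \<le> prob {x}}"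
      by (auto simp: A_def image_iff intro!: exI[of _ "y - _"])
    then show ?thesis using finite_large_atoms[OF sing q] by simp
  qed
  have A_meas: "A \<in> sets \<mu>" using \<open>finite A\<close> by (simp add: finite_imp_closed borel_closed)
  have meas: "(\<lambda>u. ennreal (prob {y - u})) \<in> borel_measurable \<mu>"
  proof -
    have "(\<lambda>u. emeasure \<mu> (Pair u -` ((\<lambda>(u, v). u + v) -` {y} \<inter> space (\<mu> \<Otimes>\<^sub>M \<mu>)))) \<in> borel_measurable \<mu>"
      by (intro measurable_emeasure_Pair) measurable
    moreover have "Pair u -` ((\<lambda>(u, v). u + v) -` {y} \<inter> space (\<mu> \<Otimes>\<^sub>M \<mu>)) = {y - u}" for u
      by (auto simp: space_pair_measure)
    ultimately show ?thesis by (simp only: emeasure_eq_measure)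
  qed
  have "AE u in \<mu>. u \<in> A"
  proof -
    have "(\<integral>\<^sup>+u. ennreal q - ennreal (prob {y - u}) \<partial>\<mu>) = (\<integral>\<^sup>+u. ennreal q \<partial>\<mu>) - (\<integral>\<^sup>+u. ennreal (prob {y - u}) \<partial>\<mu>)"
      using meas by (intro nn_integral_diff) (auto simp flip: int intro!: AE_I2 ennreal_leI le_q)
    also have "\<dots> = 0"
      using emeasure_space_1 by (simp add: int[symmetric])
    finally have "AE u in \<mu>. ennreal q - ennreal (prob {y - u}) = 0"
      using meas by (subst (asm) nn_integral_0_iff_AE) auto
    then show ?thesis
    proof eventually_elim
      case (elim u)
      then have "ennreal q \<le> ennreal (prob {y - u})" by (simp add: diff_eq_0_iff_ennreal)
      then show ?case by (simp add: A_def)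
    qed
  qed
  then have "prob A = 1" using A_meas by (simp add: prob_eq_1)
  then have "A \<noteq> {}" by auto
  have "AE u in \<mu>. u \<in> {..Max A}"
    using \<open>AE u in \<mu>. u \<in> A\<close> by eventually_elim (use \<open>finite A\<close> in auto)
  then have "prob {..Max A} = 1" by (subst prob_eq_1) auto
  then show False using ts by (simp add: two_sided_def)
qed

lemma regularly_varying_at_top:
  fixes c :: "nat \<Rightarrow> real"
  assumes pos: "\<And>n. 1 \<le> n \<Longrightarrow> 0 < c n" and mono: "mono_on {1..} c" and l: "slowly_varying l"
    and c: "\<And>n. 1 \<le> n \<Longrightarrow> c n = real n powr (1 / \<alpha>) * l (real n)" and "0 < \<alpha>"
  shows "filterlim c at_top sequentially"
  unfolding filterlim_at_top
proof (rule ccontr, clarsimp)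
  fix Z assume Z: "\<not> (\<forall>\<^sub>F n in sequentially. Z \<le> c n)"
  have less: "c n \<le> Z" if "1 \<le> n" for n
  proof (rule ccontr)
    assume "\<not> c n \<le> Z"
    then have "Z \<le> c m" if "m \<ge> n" for m
      using mono_onD[OF mono, of n m] that \<open>1 \<le> n\<close> by force
    with Z show False by (auto simp: eventually_sequentially)
  qed
  have inc: "incseq (\<lambda>n. c (Suc n))"
    using mono_onD[OF mono] by (auto simp: incseq_def)
  obtain L where L: "(\<lambda>n. c (Suc n)) \<longlonglongrightarrow> L" "\<forall>i. c (Suc i) \<le> L"
    using incseq_convergent[OF inc, of Z] less by auto
  have Lpos: "L > 0" using L(2) pos[of 1] by (metis One_nat_def le_refl order_less_le_trans)
  have cL: "c \<longlonglongrightarrow> L" using L(1) by (simp add: filterlim_sequentially_Suc)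
  have "(\<lambda>n. c (2 * n) / c n) \<longlonglongrightarrow> L / L"
    using Lpos by (intro tendsto_divide cL filterlim_compose[OF cL] mult_nat_left_at_top) auto
  moreover have "(\<lambda>n. c (2 * n) / c n) \<longlonglongrightarrow> 2 powr (1 / \<alpha>) * 1"
  proof -
    have "((\<lambda>x. l (2 * x) / l x) \<longlongrightarrow> 1) at_top" using l by (simp add: slowly_varying_def)
    then have "(\<lambda>n. l (2 * real n) / l (real n)) \<longlonglongrightarrow> 1"
      by (rule filterlim_compose) (rule filterlim_real_sequentially)
    then have "(\<lambda>n. 2 powr (1 / \<alpha>) * (l (2 * real n) / l (real n))) \<longlonglongrightarrow> 2 powr (1 / \<alpha>) * 1"
      by (intro tendsto_intros)
    moreover have "\<forall>\<^sub>F n in sequentially. 2 powr (1 / \<alpha>) * (l (2 * real n) / l (real n)) = c (2 * n) / c n"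
      using eventually_ge_at_top[of 1]
    proof eventually_elim
      case (elim n)
      have "l (real n) > 0" using l elim by (simp add: slowly_varying_def)
      then show ?case using elim c[of n] c[of "2 * n"] by (simp add: powr_mult)
    qed
    ultimately show ?thesis by (rule Lim_transform_eventually)
  qed
  ultimately have "2 powr (1 / \<alpha>) = L / L" using LIMSEQ_unique by fastforce
  then have "2 powr (1 / \<alpha>) = 1" using Lpos by simp
  moreover have "2 powr (1 / \<alpha>) > (1 :: real)" using \<open>0 < \<alpha>\<close> by simp
  ultimately show False by simp
qed

lemma (in prob_space) scaled_weak_limit:
  fixes W :: "nat \<Rightarrow> 'a \<Rightarrow> real"
  assumes W [measurable]: "\<And>n. W n \<in> borel_measurable M"
    and c: "\<And>n. 1 \<le> n \<Longrightarrow> 0 < c n" "filterlim c at_top sequentially"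
    and \<mu>: "real_distribution \<mu>" "\<And>z. measure \<mu> {z} = 0"
    and conv: "weak_conv_m (\<lambda>n. distr M borel (\<lambda>e. W n e / c n)) \<mu>"
  shows "(\<lambda>n. prob {e \<in> space M. 0 < W n e}) \<longlonglongrightarrow> 1 - measure \<mu> {..0}"
    and "(\<lambda>n. prob {e \<in> space M. \<bar>W n e\<bar> \<le> K}) \<longlonglongrightarrow> 0"
proof -
  interpret m: real_distribution \<mu> by fact
  have lim: "(\<lambda>n. prob {e \<in> space M. W n e / c n \<le> x}) \<longlonglongrightarrow> cdf \<mu> x" for x
  proof -
    have "(\<lambda>n. cdf (distr M borel (\<lambda>e. W n e / c n)) x) \<longlonglongrightarrow> cdf \<mu> x"
      using conv \<mu>(2) by (simp add: weak_conv_m_def weak_conv_def m.isCont_cdf)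
    moreover have "cdf (distr M borel (\<lambda>e. W n e / c n)) x = prob {e \<in> space M. W n e / c n \<le> x}" for n
      unfolding cdf_def by (subst measure_distr) (auto simp: vimage_def Int_def conj_commute)
    ultimately show ?thesis by simp
  qed
  have "(\<lambda>n. 1 - prob {e \<in> space M. W n e / c n \<le> 0}) \<longlonglongrightarrow> 1 - cdf \<mu> 0"
    by (intro tendsto_intros lim)
  moreover have "\<forall>\<^sub>F n in sequentially. 1 - prob {e \<in> space M. W n e / c n \<le> 0} = prob {e \<in> space M. 0 < W n e}"
    using eventually_ge_at_top[of 1]
  proof eventually_elim
    case (elim n)
    have "{e \<in> space M. 0 < W n e} = space M - {e \<in> space M. W n e / c n \<le> 0}"
      using c(1)[OF elim] by (auto simp: divide_le_0_iff)
    then show ?case by (simp add: prob_compl)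
  qed
  ultimately show "(\<lambda>n. prob {e \<in> space M. 0 < W n e}) \<longlonglongrightarrow> 1 - measure \<mu> {..0}"
    by (simp add: cdf_def Lim_transform_eventually)
  show "(\<lambda>n. prob {e \<in> space M. \<bar>W n e\<bar> \<le> K}) \<longlonglongrightarrow> 0"
  proof (rule LIMSEQ_I)
    fix \<epsilon> :: real assume \<epsilon>: "0 < \<epsilon>"
    have "isCont (cdf \<mu>) 0" using \<mu>(2) by (simp add: m.isCont_cdf)
    then obtain \<delta> where \<delta>: "\<delta> > 0" "\<And>x. \<bar>x - 0\<bar> < \<delta> \<Longrightarrow> \<bar>cdf \<mu> x - cdf \<mu> 0\<bar> < \<epsilon> / 4"
      using \<epsilon> unfolding continuous_at_eps_delta dist_real_def
      by (metis divide_pos_pos zero_less_numeral)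
    define h where "h = \<delta> / 2"
    have h: "h > 0" "\<bar>cdf \<mu> h - cdf \<mu> 0\<bar> < \<epsilon> / 4" "\<bar>cdf \<mu> (- h) - cdf \<mu> 0\<bar> < \<epsilon> / 4"
      using \<delta> by (auto simp: h_def)
    have "(\<lambda>n. prob {e \<in> space M. W n e / c n \<le> h} - prob {e \<in> space M. W n e / c n \<le> - h}) \<longlonglongrightarrow> cdf \<mu> h - cdf \<mu> (- h)"
      by (intro tendsto_intros lim)
    then have "\<forall>\<^sub>F n in sequentially. prob {e \<in> space M. W n e / c n \<le> h} - prob {e \<in> space M. W n e / c n \<le> - h} < \<epsilon>"
      by (rule order_tendstoD) (use h in linarith)
    moreover have "\<forall>\<^sub>F n in sequentially. c n > \<bar>K\<bar> / h"
      using c(2) by (simp add: filterlim_at_top_dense)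
    ultimately have "\<forall>\<^sub>F n in sequentially. norm (prob {e \<in> space M. \<bar>W n e\<bar> \<le> K} - 0) < \<epsilon>"
      using eventually_ge_at_top[of 1]
    proof eventually_elim
      case (elim n)
      have cn: "c n > 0" using c(1) elim by simp
      have Kh: "K < h * c n" using elim(2) h(1) by (simp add: field_simps)
      have "prob {e \<in> space M. \<bar>W n e\<bar> \<le> K} \<le> prob ({e \<in> space M. W n e / c n \<le> h} - {e \<in> space M. W n e / c n \<le> - h})"
      proof (rule finite_measure_mono)
        show "{e \<in> space M. \<bar>W n e\<bar> \<le> K} \<subseteq> {e \<in> space M. W n e / c n \<le> h} - {e \<in> space M. W n e / c n \<le> - h}"
        proof safe
          fix e assume e: "\<bar>W n e\<bar> \<le> K"
          show "W n e / c n \<le> h" using e Kh cn by (simp add: pos_divide_le_eq)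
          assume "W n e / c n \<le> - h"
          then show False using e Kh cn by (simp add: pos_divide_le_eq)
        qed
      qed measurable
      also have "\<dots> = prob {e \<in> space M. W n e / c n \<le> h} - prob {e \<in> space M. W n e / c n \<le> - h}"
        using h(1) by (intro finite_measure_Diff) auto
      finally show ?case using elim(1) by simp
    qed
    then show "\<exists>N. \<forall>n\<ge>N. norm (prob {e \<in> space M. \<bar>W n e\<bar> \<le> K} - 0) < \<epsilon>"
      by (simp add: eventually_sequentially)
  qed
qed

section \<open>Clans and generating functions\<close>

lemma prod_over_children:
  fixes f :: "nat \<Rightarrow> 'a::comm_monoid_mult"
  shows "(\<Prod>k<(\<Sum>l<m. y l). f (LEAST j. k < (\<Sum>l\<le>j. y l))) = (\<Prod>j<m. f j ^ y j)"
proof (induction m)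
  case (Suc m)
  define N where "N = (\<Sum>l<m. y l)"
  have "{..<N + y m} = {..<N} \<union> {N..<N + y m}" by auto
  then have "(\<Prod>k<N + y m. f (LEAST j. k < (\<Sum>l\<le>j. y l))) =
      (\<Prod>k<N. f (LEAST j. k < (\<Sum>l\<le>j. y l))) * (\<Prod>k\<in>{N..<N + y m}. f (LEAST j. k < (\<Sum>l\<le>j. y l)))"
    by (simp add: prod.union_disjoint ivl_disj_int)
  also have "(\<Prod>k\<in>{N..<N + y m}. f (LEAST j. k < (\<Sum>l\<le>j. y l))) = (\<Prod>k\<in>{N..<N + y m}. f m)"
  proof (intro prod.cong refl arg_cong[where f = f] Least_equality)
    fix k assume k: "k \<in> {N..<N + y m}"
    then show "k < (\<Sum>l\<le>m. y l)" by (simp add: N_def lessThan_Suc_atMost[symmetric])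
    fix j assume j: "k < (\<Sum>l\<le>j. y l)"
    show "m \<le> j"
    proof (rule ccontr)
      assume "\<not> m \<le> j"
      then have "(\<Sum>l\<le>j. y l) \<le> N" unfolding N_def by (intro sum_mono2) auto
      with j k show False by auto
    qed
  qed
  finally show ?case using Suc by (simp add: N_def mult.commute)
qed simp

lemma pop_Suc_pre: "pop x (Suc n) = pop_pre x (Suc n) + 1"
  by (simp add: pop_pre_def)

lemma prod_origin_Suc:
  fixes s :: "nat \<Rightarrow> 'a::comm_monoid_mult"
  shows "(\<Prod>k<pop x (Suc n). s (origin x (Suc n) k)) = s (Suc n) * (\<Prod>k<pop x n. s (origin x n k) ^ x (Suc n) k)"
proof -
  have "(\<Prod>k<pop x (Suc n). s (origin x (Suc n) k)) =
      (\<Prod>k<pop_pre x (Suc n). s (origin x (Suc n) k)) * s (Suc n)"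
    by (simp add: pop_Suc_pre del: pop.simps)
  also have "(\<Prod>k<pop_pre x (Suc n). s (origin x (Suc n) k)) = (\<Prod>k<pop_pre x (Suc n). s (origin x n (parent x (Suc n) k)))"
    by (intro prod.cong) auto
  also have "\<dots> = (\<Prod>k<pop x n. s (origin x n k) ^ x (Suc n) k)"
    unfolding parent_def pop_pre_def diff_Suc_1 by (rule prod_over_children)
  finally show ?thesis by (simp add: mult.commute)
qed

lemma origin_le: "origin x n k \<le> n"
  by (induction n arbitrary: k) (auto intro: le_SucI)

lemma clan_indicator:
  assumes "i < n"
  shows "of_bool (only_clan_survives x i n) =
     (\<Prod>k<pop x n. of_bool (origin x n k = i \<or> origin x n k = n)) - (\<Prod>k<pop x n. of_bool (origin x n k = n) :: real)"
proof -
  obtain m where n: "n = Suc m" using assms by (cases n) auto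
  have lt: "origin x n k < n" if "k < pop_pre x n" for k
    using that origin_le[of x m] by (auto simp: n le_imp_less_Suc)
  then have ne: "origin x n k \<noteq> n" if "k < pop_pre x n" for k
    using that by fastforce
  have last: "origin x n (pop_pre x n) = n" by (simp add: n)
  have p: "{..<pop x n} = insert (pop_pre x n) {..<pop_pre x n}"
    unfolding n pop_Suc_pre by auto
  have 1: "(\<Prod>k<pop x n. of_bool (origin x n k = i \<or> origin x n k = n)) = (of_bool (\<forall>k<pop_pre x n. origin x n k = i) :: real)"
  proof -
    have "(\<Prod>k<pop x n. of_bool (origin x n k = i \<or> origin x n k = n)) = (\<Prod>k<pop_pre x n. of_bool (origin x n k = i) :: real)"
      unfolding p using ne last by (subst prod.insert) (auto intro!: prod.cong)
    then show ?thesis by (cases "\<forall>k<pop_pre x n. origin x n k = i") (auto intro: prod_zero)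
  qed
  have 2: "(\<Prod>k<pop x n. of_bool (origin x n k = n)) = (of_bool (pop_pre x n = 0) :: real)"
  proof -
    have "(\<Prod>k<pop x n. of_bool (origin x n k = n)) = (\<Prod>k<pop_pre x n. 0 :: real)"
      unfolding p using ne last by (subst prod.insert) (auto intro!: prod.cong)
    then show ?thesis by auto
  qed
  have "only_clan_survives x i n \<longleftrightarrow> 0 < pop_pre x n \<and> (\<forall>k<pop_pre x n. origin x n k = i)"
    unfolding only_clan_survives_def clan_def by (auto simp: n pop_Suc_pre simp del: pop.simps origin.simps)
  then show ?thesis unfolding 1 2 by auto
qed

definition history :: "(nat \<Rightarrow> nat \<Rightarrow> nat) \<Rightarrow> nat \<Rightarrow> nat list list" where
  "history x n = map (\<lambda>m. map (x (Suc m)) [0..<pop x m]) [0..<n]"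

definition explored :: "(nat \<Rightarrow> nat \<Rightarrow> nat) \<Rightarrow> nat \<Rightarrow> (nat \<times> nat) set" where
  "explored x n = Sigma {1..n} (\<lambda>m. {..<pop x (m - 1)})"

lemma finite_explored: "finite (explored x n)"
  by (auto simp: explored_def)

lemma history_eqD:
  assumes "history x n = history x' n"
  shows "m \<le> n \<Longrightarrow> pop x m = pop x' m" "m < n \<Longrightarrow> k < pop x m \<Longrightarrow> x (Suc m) k = x' (Suc m) k"
proof -
  have eq: "map (x (Suc m)) [0..<pop x m] = map (x' (Suc m)) [0..<pop x' m]" if "m < n" for m
    using arg_cong[OF assms, of "\<lambda>h. h ! m"] that by (simp add: history_def)
  then have len: "pop x m = pop x' m" if "m < n" for m
    using that by (metis diff_zero length_map length_upt)
  show step: "x (Suc m) k = x' (Suc m) k" if "m < n" "k < pop x m" for m k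
    using arg_cong[OF eq[OF that(1)], of "\<lambda>h. h ! k"] that len[OF that(1)] by simp
  show "pop x m = pop x' m" if "m \<le> n" for m
  proof (cases m)
    case (Suc l)
    then have "l < n" using that by simp
    then show ?thesis using Suc len[of l] step[of l] by (auto intro!: sum.cong)
  qed simp
qed

lemma origin_cong:
  assumes "\<And>l. l < m \<Longrightarrow> pop x l = pop x' l" "\<And>l k. l < m \<Longrightarrow> k < pop x l \<Longrightarrow> x (Suc l) k = x' (Suc l) k"
    and "k < pop x m"
  shows "origin x m k = origin x' m k"
  using assms
proof (induction m arbitrary: k)
  case (Suc m)
  have pre: "pop_pre x (Suc m) = pop_pre x' (Suc m)"
    using Suc.prems by (auto simp: pop_pre_def intro!: sum.cong)
  show ?case
  proof (cases "k < pop_pre x (Suc m)")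
    case True
    have partial: "(\<Sum>l\<le>j. x (Suc m) l) = (\<Sum>l\<le>j. x' (Suc m) l)" if "j < pop x m" for j
      using that Suc.prems by (intro sum.cong) auto
    have pop_pos: "pop x m > 0" by (cases m) auto
    have kl: "k < (\<Sum>l\<le>pop x m - 1. x (Suc m) l)"
      using True pop_pos by (simp add: pop_pre_def lessThan_Suc_atMost[symmetric])
    have par_lt: "parent x (Suc m) k \<le> pop x m - 1"
      unfolding parent_def by (rule Least_le) (rule kl)
    have par_prop: "k < (\<Sum>l\<le>parent x (Suc m) k. x (Suc m) l)"
      unfolding parent_def by (rule LeastI) (rule kl)
    have "parent x' (Suc m) k = parent x (Suc m) k"
    proof (subst parent_def, rule Least_equality)
      show "k < (\<Sum>l\<le>parent x (Suc m) k. x' (Suc m) l)"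
        using par_prop partial[of "parent x (Suc m) k"] par_lt pop_pos by simp
      fix j assume j: "k < (\<Sum>l\<le>j. x' (Suc m) l)"
      show "parent x (Suc m) k \<le> j"
      proof (cases "j < pop x m")
        case True
        then show ?thesis unfolding parent_def using j partial by (intro Least_le) simp
      qed (use par_lt in simp)
    qed
    moreover have "origin x m (parent x (Suc m) k) = origin x' m (parent x (Suc m) k)"
      using par_lt pop_pos Suc.prems by (intro Suc.IH) auto
    ultimately show ?thesis using True pre by simp
  qed (use pre in simp)
qed simp

lemma history_eq_iff_explored: "history x' n = history x n \<longleftrightarrow> (\<forall>(m, k)\<in>explored x n. x' m k = x m k)"
proof
  assume h: "history x' n = history x n"
  show "\<forall>(m, k)\<in>explored x n. x' m k = x m k"
  proof safe
    fix m k assume "(m, k) \<in> explored x n"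
    then have "m - 1 < n" "k < pop x (m - 1)" "Suc (m - 1) = m" by (auto simp: explored_def)
    then show "x' m k = x m k" using history_eqD(2)[OF h[symmetric], of "m - 1" k] by simp
  qed
next
  assume *: "\<forall>(m, k)\<in>explored x n. x' m k = x m k"
  have step: "x' (Suc m) k = x (Suc m) k" if "m < n" "k < pop x m" for m k
  proof -
    have "(Suc m, k) \<in> explored x n" using that by (auto simp: explored_def)
    with * show ?thesis by blast
  qed
  have pop: "pop x' m = pop x m" if "m \<le> n" for m
    using that by (induction m) (auto simp: step intro!: sum.cong)
  show "history x' n = history x n"
    unfolding history_def by (intro map_cong refl) (auto simp: pop step)
qed

lemma power_series_zero_0:
  fixes a :: "nat \<Rightarrow> real"
  assumes a: "summable (\<lambda>n. \<bar>a n\<bar>)" and zero: "\<And>s. 0 < s \<Longrightarrow> s < 1 \<Longrightarrow> (\<Sum>n. a n * s ^ n) = 0"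
  shows "a 0 = 0"
proof -
  have sm: "summable (\<lambda>n. a n * s ^ n)" if "\<bar>s\<bar> < 1" for s
  proof (rule summable_comparison_test'[OF a])
    fix n
    have "\<bar>s\<bar> ^ n \<le> 1" using that by (intro power_le_one) auto
    then show "norm (a n * s ^ n) \<le> \<bar>a n\<bar>" by (simp add: abs_mult power_abs mult_left_le)
  qed
  then have "((\<lambda>s. \<Sum>n. a n * s ^ n) \<longlongrightarrow> a 0) (at 0)"
    by (intro powser_limit_0[of 1]) (auto intro: summable_sums)
  then have "((\<lambda>s. \<Sum>n. a n * s ^ n) \<longlongrightarrow> a 0) (at_right 0)"
    by (rule filterlim_at_split[THEN iffD1, THEN conjunct2])
  moreover have "\<forall>\<^sub>F s in at_right 0. (\<Sum>n. a n * s ^ n) = 0"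
    using zero by (auto simp: eventually_at_right_field intro!: exI[of _ 1])
  ultimately have "((\<lambda>_. 0) \<longlongrightarrow> a 0) (at_right (0::real))"
    by (rule Lim_transform_eventually)
  then show ?thesis
    using tendsto_unique[OF trivial_limit_at_right_real tendsto_const] by metis
qed

lemma power_series_zero:
  fixes a :: "nat \<Rightarrow> real"
  assumes "summable (\<lambda>n. \<bar>a n\<bar>)" "\<And>s. 0 < s \<Longrightarrow> s < 1 \<Longrightarrow> (\<Sum>n. a n * s ^ n) = 0"
  shows "a n = 0"
  using assms
proof (induction n arbitrary: a)
  case 0
  then show ?case by (rule power_series_zero_0)
next
  case (Suc n)
  have bnd: "norm (b * s ^ n) \<le> \<bar>b\<bar>" if "0 < s" "s < 1" for b s :: real and n
    using that by (simp add: abs_mult power_abs mult_left_le power_le_one)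
  show ?case
  proof (rule Suc.IH)
    show s: "summable (\<lambda>n. \<bar>a (Suc n)\<bar>)" using Suc.prems(1) by (subst summable_Suc_iff)
    fix s :: real assume s01: "0 < s" "s < 1"
    have sm: "summable (\<lambda>n. a n * s ^ n)"
      by (rule summable_comparison_test'[OF Suc.prems(1)]) (rule bnd[OF s01])
    have a0: "a 0 = 0" using Suc.prems by (rule power_series_zero_0)
    have "(\<Sum>n. a n * s ^ n) = (\<Sum>n. a (Suc n) * s ^ Suc n)"
      using suminf_split_head[OF sm] a0 by simp
    also have "\<dots> = s * (\<Sum>n. a (Suc n) * s ^ n)"
    proof -
      have "summable (\<lambda>n. a (Suc n) * s ^ n)"
        by (rule summable_comparison_test'[OF s]) (rule bnd[OF s01])
      from suminf_mult[OF this, of s] show ?thesis by (simp add: mult_ac)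
    qed
    finally show "(\<Sum>n. a (Suc n) * s ^ n) = 0" using Suc.prems(2)[OF s01] s01 by simp
  qed
qed

lemma prob_nat_sums:
  assumes "f \<in> space Delta"
  shows "(\<lambda>j. measure f {j}) sums 1"
proof -
  interpret f: prob_space f using assms by (simp add: space_prob_algebra)
  have sets: "sets f = UNIV" using assms by (simp add: space_prob_algebra)
  then have sp: "space f = UNIV" using sets.top[of f] sets.sets_into_space[of UNIV f] by auto
  have "(\<lambda>j. measure f {j}) sums measure f (\<Union>j. {j})"
    by (rule f.finite_measure_UNION) (auto simp: sets disjoint_family_on_def)
  then show ?thesis using f.prob_space sp by simp
qed

lemma gen_fun_bounds:
  assumes f: "f \<in> space Delta" and t: "0 \<le> t" "t \<le> 1"
  shows "summable (\<lambda>j. measure f {j} * t ^ j)" "0 \<le> gen_fun f t" "gen_fun f t \<le> 1"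
proof -
  have le: "measure f {j} * t ^ j \<le> measure f {j}" for j
    using t by (simp add: mult_left_le power_le_one)
  show s: "summable (\<lambda>j. measure f {j} * t ^ j)"
    by (rule summable_comparison_test'[OF sums_summable[OF prob_nat_sums[OF f]]]) (use t le in auto)
  show "0 \<le> gen_fun f t" unfolding gen_fun_def using t by (intro suminf_nonneg s) auto
  have "gen_fun f t \<le> (\<Sum>j. measure f {j})" unfolding gen_fun_def
    by (intro suminf_le le s sums_summable[OF prob_nat_sums[OF f]])
  then show "gen_fun f t \<le> 1" using sums_unique[OF prob_nat_sums[OF f]] by simp
qed

lemma gen_fun_geometric:
  assumes f: "f \<in> space Delta" and geo: "geometric_offspring f" and w: "0 \<le> w" "w \<le> 1"
  shows "gen_fun f (1 - w) = 1 - w / (w + exp (- log_mean f))"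
proof -
  obtain p q where pq: "0 < p" "0 < q" "p + q = 1"
    and gf: "\<And>s. s \<in> {0..1} \<Longrightarrow> gen_fun f s = q / (1 - p * s)"
    using geo unfolding geometric_offspring_def by blast
  have p1: "p < 1" using pq by simp
  define a where "a j = measure f {j} - q * p ^ j" for j
  have sp: "summable (\<lambda>j. q * p ^ j)" using pq p1 by (intro summable_mult summable_geometric) auto
  have "a j = 0" for j
  proof (rule power_series_zero)
    show "summable (\<lambda>n. \<bar>a n\<bar>)"
    proof (rule summable_comparison_test'[OF summable_add[OF sums_summable[OF prob_nat_sums[OF f]] sp]])
      show "norm \<bar>a n\<bar> \<le> measure f {n} + q * p ^ n" for n
        unfolding a_def real_norm_def abs_abs
        using pq measure_nonneg[of f "{n}"] zero_le_power[of p n]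
        by (intro order_trans[OF abs_triangle_ineq4]) (simp add: abs_mult)
    qed
    fix s :: real assume s: "0 < s" "s < 1"
    have ps: "norm (p * s) < 1" 
    proof -
      have "p * s < 1 * 1" using s pq p1 by (intro mult_strict_mono) auto
      then show ?thesis using s pq by (simp add: abs_mult)
    qed
    have 1: "(\<lambda>n. q * (p * s) ^ n) sums (q * (1 / (1 - p * s)))"
      by (intro sums_mult geometric_sums ps)
    have 2: "(\<lambda>n. measure f {n} * s ^ n) sums gen_fun f s"
      unfolding gen_fun_def using gen_fun_bounds(1)[OF f, of s] s by (intro summable_sums) auto
    have "(\<lambda>n. measure f {n} * s ^ n - q * (p * s) ^ n) sums (gen_fun f s - q * (1 / (1 - p * s)))"
      by (intro sums_diff 1 2)
    moreover have "measure f {n} * s ^ n - q * (p * s) ^ n = a n * s ^ n" for n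
      by (simp add: a_def algebra_simps power_mult_distrib)
    ultimately show "(\<Sum>n. a n * s ^ n) = 0" using gf[of s] s by (simp add: sums_iff)
  qed
  then have coef: "measure f {j} = q * p ^ j" for j by (simp add: a_def)
  have "(\<lambda>j. of_nat (Suc j) * p ^ j) sums (1 / (1 - p)\<^sup>2)"
    using pq p1 by (intro geometric_deriv_sums) auto
  from sums_mult[OF this, of "q * p"] have "(\<lambda>j. real (Suc j) * measure f {Suc j}) sums (q * p * (1 / (1 - p)\<^sup>2))"
    by (simp add: coef mult_ac)
  then have "(\<lambda>j. real j * measure f {j}) sums (q * p * (1 / (1 - p)\<^sup>2))"
    by (subst (asm) sums_Suc_iff) simp
  moreover have "1 - p = q" using pq by simp
  ultimately have "mean_offspring f = p / q"
    using pq by (simp add: mean_offspring_def sums_iff power2_eq_square)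
  then have e: "exp (- log_mean f) = q / p" using pq by (simp add: log_mean_def exp_minus)
  have "gen_fun f (1 - w) = q / (q + p * w)"
    using gf[of "1 - w"] w pq by (simp add: algebra_simps)
  also have "\<dots> = 1 - w / (w + q / p)"
  proof -
    have "q + p * w > 0" "w + q / p > 0" using pq w by (auto intro: add_pos_nonneg add_nonneg_pos)
    then show ?thesis using pq by (simp add: field_simps)
  qed
  finally show ?thesis by (simp add: e)
qed

lemma measurable_measure_singleton [measurable]: "(\<lambda>f. measure f {j}) \<in> borel_measurable Delta"
  by (rule measurable_measure_prob_algebra) simp

lemma measurable_log_mean [measurable]: "log_mean \<in> borel_measurable Delta"
proof -
  have "(\<lambda>f. mean_offspring f) \<in> borel_measurable Delta"
    unfolding mean_offspring_def by measurable
  then show ?thesis unfolding log_mean_def[abs_def] by measurable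
qed

section \<open>Quenched clan probabilities\<close>

lemma nn_integral_eq_by_cases:
  fixes g :: "'a \<Rightarrow> 'b::countable"
  assumes [measurable]: "g \<in> measurable M (count_space UNIV)" "f \<in> borel_measurable M" "f' \<in> borel_measurable M"
    and eq: "\<And>h. (\<integral>\<^sup>+\<omega>. f \<omega> * of_bool (g \<omega> = h) \<partial>M) = (\<integral>\<^sup>+\<omega>. f' \<omega> * of_bool (g \<omega> = h) \<partial>M)"
  shows "(\<integral>\<^sup>+\<omega>. f \<omega> \<partial>M) = (\<integral>\<^sup>+\<omega>. f' \<omega> \<partial>M)"
proof -
  have *: "(\<integral>\<^sup>+\<omega>. f \<omega> \<partial>M) = (\<Sum>i. \<integral>\<^sup>+\<omega>. f \<omega> * of_bool (to_nat (g \<omega>) = i) \<partial>M)"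
    if [measurable]: "f \<in> borel_measurable M" for f
  proof -
    have "f \<omega> = (\<Sum>i. f \<omega> * of_bool (to_nat (g \<omega>) = i))" for \<omega>
    proof -
      have "(\<Sum>i. f \<omega> * of_bool (to_nat (g \<omega>) = i)) = (\<Sum>i\<in>{to_nat (g \<omega>)}. f \<omega> * of_bool (to_nat (g \<omega>) = i))"
        by (rule suminf_finite) auto
      then show ?thesis by simp
    qed
    then have "(\<integral>\<^sup>+\<omega>. f \<omega> \<partial>M) = (\<integral>\<^sup>+\<omega>. (\<Sum>i. f \<omega> * of_bool (to_nat (g \<omega>) = i)) \<partial>M)" by simp
    also have "\<dots> = (\<Sum>i. \<integral>\<^sup>+\<omega>. f \<omega> * of_bool (to_nat (g \<omega>) = i) \<partial>M)"
      by (rule nn_integral_suminf) measurable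
    finally show ?thesis .
  qed
  have "(\<integral>\<^sup>+\<omega>. f \<omega> * of_bool (to_nat (g \<omega>) = i) \<partial>M) = (\<integral>\<^sup>+\<omega>. f' \<omega> * of_bool (to_nat (g \<omega>) = i) \<partial>M)" for i
  proof (cases "\<exists>h::'b. i = to_nat h")
    case True
    then obtain h :: 'b where "i = to_nat h" by blast
    then show ?thesis using eq[of h] by simp
  next
    case False
    then have "to_nat (g \<omega>) \<noteq> i" for \<omega> by metis
    then show ?thesis by simp
  qed
  then show ?thesis unfolding *[OF assms(2)] *[OF assms(3)] by simp
qed

definition survival :: "(nat \<Rightarrow> real) \<Rightarrow> nat \<Rightarrow> nat \<Rightarrow> real \<Rightarrow> real" where
  "survival \<sigma> j n w = w / (w * (\<Sum>k\<in>{j..<n}. exp (\<sigma> j - \<sigma> k)) + exp (\<sigma> j - \<sigma> n))"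

lemma survival_self: "survival \<sigma> n n w = w"
  by (simp add: survival_def)

lemma survival_Suc:
  assumes "j \<le> n" "0 \<le> w"
  shows "survival \<sigma> j n (w / (w + exp (\<sigma> n - \<sigma> (Suc n)))) = survival \<sigma> j (Suc n) w"
proof -
  define c where "c = (\<Sum>k\<in>{j..<n}. exp (\<sigma> j - \<sigma> k))"
  define e where "e = exp (\<sigma> n - \<sigma> (Suc n))"
  define d where "d = exp (\<sigma> j - \<sigma> n)"
  have pos: "c \<ge> 0" "e > 0" "d > 0" by (auto simp: c_def e_def d_def sum_nonneg)
  have we: "w + e > 0" using assms pos by simp
  have eq: "exp (\<sigma> j - \<sigma> (Suc n)) = d * e" by (simp add: d_def e_def flip: exp_add)
  have "survival \<sigma> j (Suc n) w = w / (w * (c + d) + d * e)"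
    using assms by (simp add: survival_def c_def d_def eq[unfolded d_def])
  also have "w * (c + d) + d * e = (w / (w + e) * c + d) * (w + e)"
    using we by (simp add: field_simps)
  also have "w / ((w / (w + e) * c + d) * (w + e)) = w / (w + e) / (w / (w + e) * c + d)"
    by (simp add: mult.commute)
  also have "\<dots> = survival \<sigma> j n (w / (w + e))" by (simp add: survival_def c_def d_def)
  finally show ?thesis by (simp add: e_def)
qed

lemma survival_bounds:
  assumes "0 \<le> w" "w \<le> 1" "j \<le> n"
  shows "0 \<le> survival \<sigma> j n w" "survival \<sigma> j n w \<le> 1"
proof -
  let ?c = "\<Sum>k\<in>{j..<n}. exp (\<sigma> j - \<sigma> k)"
  have c: "0 \<le> ?c" by (intro sum_nonneg) auto
  have d: "0 < w * ?c + exp (\<sigma> j - \<sigma> n)" using c assms by (intro add_nonneg_pos) auto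
  then show "0 \<le> survival \<sigma> j n w" unfolding survival_def using assms by simp
  have "w \<le> w * ?c + exp (\<sigma> j - \<sigma> n)"
  proof (cases "j = n")
    case False
    then have "exp (\<sigma> j - \<sigma> j) \<le> ?c" using assms by (intro member_le_sum) auto
    then have "w * 1 \<le> w * ?c" using assms by (intro mult_left_mono) auto
    then show ?thesis by (simp add: add_increasing2)
  qed (use assms in simp)
  then show "survival \<sigma> j n w \<le> 1" unfolding survival_def using d by (simp add: divide_le_eq)
qed

definition clan_formula :: "(nat \<Rightarrow> real) \<Rightarrow> nat \<Rightarrow> nat \<Rightarrow> real" where
  "clan_formula \<sigma> i n = exp (- \<sigma> i) * exp (- \<sigma> n) / ((\<Sum>k\<in>{Suc i..n}. exp (- \<sigma> k)) * (\<Sum>k\<in>{0..n}. exp (- \<sigma> k)))"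

lemma clan_formula_eq:
  assumes "i < n"
  shows "(\<Prod>j\<le>n. 1 - survival \<sigma> j n (of_bool (j \<noteq> i \<and> j \<noteq> n))) - (\<Prod>j\<le>n. 1 - survival \<sigma> j n (of_bool (j \<noteq> n)))
    = clan_formula \<sigma> i n"
proof -
  define T where "T j = (\<Sum>k\<in>{j..n}. exp (- \<sigma> k))" for j
  have T_pos: "T j > 0" if "j \<le> n" for j unfolding T_def using that by (intro sum_pos) auto
  have T_step: "T j = exp (- \<sigma> j) + T (Suc j)" if "j \<le> n" for j
    unfolding T_def using that by (rule sum.atLeast_Suc_atMost)
  have s0: "survival \<sigma> j n 0 = 0" for j by (simp add: survival_def)
  have s1: "1 - survival \<sigma> j n 1 = T (Suc j) / T j" if "j < n" for j
  proof -
    have "(\<Sum>k\<in>{j..<n}. exp (\<sigma> j - \<sigma> k)) + exp (\<sigma> j - \<sigma> n) = (\<Sum>k\<in>{j..<Suc n}. exp (\<sigma> j - \<sigma> k))"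
      using that by simp
    also have "\<dots> = exp (\<sigma> j) * T j"
      by (simp add: T_def sum_distrib_left atLeastLessThanSuc_atLeastAtMost flip: exp_add)
    finally have "survival \<sigma> j n 1 = exp (- \<sigma> j) / T j" by (simp add: survival_def exp_minus field_simps)
    then show ?thesis using T_step[of j] T_pos[of j] that by (simp add: field_simps)
  qed
  have tele: "(\<Prod>j<m. T (Suc j) / T j) = T m / T 0" if "m \<le> n" for m
    using that
  proof (induction m)
    case 0
    then show ?case using T_pos[of 0] by simp
  next
    case (Suc m)
    then show ?case using T_pos[of m] by simp
  qed
  have P0: "(\<Prod>j\<le>n. 1 - survival \<sigma> j n (of_bool (j \<noteq> n))) = T n / T 0"
  proof -
    have "(\<Prod>j\<le>n. 1 - survival \<sigma> j n (of_bool (j \<noteq> n))) = (\<Prod>j<n. 1 - survival \<sigma> j n (of_bool (j \<noteq> n)))"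
      by (simp add: s0 lessThan_Suc_atMost[symmetric])
    also have "\<dots> = (\<Prod>j<n. T (Suc j) / T j)" by (intro prod.cong) (auto simp: s1)
    finally show ?thesis using tele by simp
  qed
  have P1: "(\<Prod>j\<le>n. 1 - survival \<sigma> j n (of_bool (j \<noteq> i \<and> j \<noteq> n))) * (T (Suc i) / T i) = T n / T 0"
  proof -
    have "(\<Prod>j\<le>n. 1 - survival \<sigma> j n (of_bool (j \<noteq> i \<and> j \<noteq> n))) = (\<Prod>j<n. 1 - survival \<sigma> j n (of_bool (j \<noteq> i \<and> j \<noteq> n)))"
      by (simp add: s0 lessThan_Suc_atMost[symmetric])
    also have "\<dots> = (1 - survival \<sigma> i n (of_bool (i \<noteq> i \<and> i \<noteq> n))) * (\<Prod>j\<in>{..<n} - {i}. 1 - survival \<sigma> j n (of_bool (j \<noteq> i \<and> j \<noteq> n)))"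
      using assms by (subst prod.remove[of _ i]) auto
    also have "\<dots> = (\<Prod>j\<in>{..<n} - {i}. T (Suc j) / T j)"
      by (simp add: s0) (intro prod.cong; auto simp: s1)
    finally have "(\<Prod>j\<le>n. 1 - survival \<sigma> j n (of_bool (j \<noteq> i \<and> j \<noteq> n))) * (T (Suc i) / T i) = (\<Prod>j<n. T (Suc j) / T j)"
      using assms by (simp add: prod.remove[of "{..<n}" i])
    then show ?thesis using tele by simp
  qed
  have Tn: "T n = exp (- \<sigma> n)" by (simp add: T_def)
  have pos: "T 0 > 0" "T i > 0" "T (Suc i) > 0" using assms T_pos by auto
  have "(\<Prod>j\<le>n. 1 - survival \<sigma> j n (of_bool (j \<noteq> i \<and> j \<noteq> n))) = T n / T 0 * (T i / T (Suc i))"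
    unfolding P1[symmetric] using pos by simp
  then have "(\<Prod>j\<le>n. 1 - survival \<sigma> j n (of_bool (j \<noteq> i \<and> j \<noteq> n))) - (\<Prod>j\<le>n. 1 - survival \<sigma> j n (of_bool (j \<noteq> n)))
      = T n / T 0 * ((T i - T (Suc i)) / T (Suc i))"
    unfolding P0 using pos by (simp add: field_simps)
  also have "T i - T (Suc i) = exp (- \<sigma> i)" using T_step[of i] assms by simp
  finally show ?thesis unfolding Tn clan_formula_def T_def by (simp add: mult.commute)
qed

context bpire
begin

abbreviation env_alg :: "'a measure" where
  "env_alg \<equiv> env_algebra M F"

lemma F_measurable: "1 \<le> n \<Longrightarrow> F n \<in> measurable M Delta"
  using env_indep by (auto simp: indep_vars_def)

lemma F_space: "1 \<le> n \<Longrightarrow> \<omega> \<in> space M \<Longrightarrow> F n \<omega> \<in> space Delta"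
  by (rule measurable_space[OF F_measurable])

lemma env_map_measurable: "(\<lambda>\<omega>. \<lambda>n\<in>{1..}. F n \<omega>) \<in> measurable M (\<Pi>\<^sub>M n\<in>{1..}. Delta)"
  by (intro measurable_restrict F_measurable) simp

lemma env_subalgebra: "subalgebra M env_alg"
  unfolding subalgebra_def env_algebra_def
  using sets_image_in_sets[OF refl env_map_measurable] by simp

sublocale env: finite_measure_subalgebra M env_alg
  by unfold_locales (rule env_subalgebra)

lemma F_measurable_env:
  assumes "1 \<le> n"
  shows "F n \<in> measurable env_alg Delta"
proof -
  have "(\<lambda>\<omega>. \<lambda>n\<in>{1..}. F n \<omega>) \<in> measurable env_alg (\<Pi>\<^sub>M n\<in>{1..}. Delta)"
    unfolding env_algebra_def
    by (rule measurable_vimage_algebra1) (intro Pi_I measurable_space[OF env_map_measurable])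
  then have "(\<lambda>\<omega>. (\<lambda>n\<in>{1..}. F n \<omega>) n) \<in> measurable env_alg Delta"
    by (rule measurable_compose) (use assms in \<open>auto intro!: measurable_component_singleton\<close>)
  then show ?thesis using assms by simp
qed

lemma env_measurable_imp: "f \<in> borel_measurable env_alg \<Longrightarrow> f \<in> borel_measurable M"
  by (rule measurable_from_subalg[OF env_subalgebra])

definition match :: "(nat \<times> nat) set \<Rightarrow> (nat \<Rightarrow> nat \<Rightarrow> nat) \<Rightarrow> 'a \<Rightarrow> bool" where
  "match J x \<omega> \<longleftrightarrow> (\<forall>(n, k)\<in>J. xi n k \<omega> = x n k)"

lemma match_measurable:
  assumes "finite J" "J \<subseteq> {1..} \<times> UNIV"
  shows "Measurable.pred M (match J x)"
proof -
  have "Measurable.pred M (\<lambda>\<omega>. \<forall>p\<in>J. xi (fst p) (snd p) \<omega> = x (fst p) (snd p))"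
  proof (intro pred_intros_finite assms(1))
    fix p assume "p \<in> J"
    then have [measurable]: "xi (fst p) (snd p) \<in> measurable M (count_space UNIV)"
      using assms(2) by (intro offspring_measurable) auto
    show "Measurable.pred M (\<lambda>\<omega>. xi (fst p) (snd p) \<omega> = x (fst p) (snd p))" by measurable
  qed
  then show ?thesis by (simp add: match_def[abs_def] case_prod_beta')
qed

lemma offspring_prod_measurable:
  assumes "J \<subseteq> {1..} \<times> UNIV"
  shows "(\<lambda>\<omega>. \<Prod>(n, k)\<in>J. measure (F n \<omega>) {x n k}) \<in> borel_measurable env_alg"
proof (rule borel_measurable_prod, clarsimp)
  fix n k assume "(n, k) \<in> J"
  then have "1 \<le> n" using assms by auto
  then show "(\<lambda>\<omega>. measure (F n \<omega>) {x n k}) \<in> borel_measurable env_alg"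
    by (intro measurable_compose[OF F_measurable_env measurable_measure_singleton])
qed

lemma offspring_prod_bounds:
  assumes "J \<subseteq> {1..} \<times> UNIV" "\<omega> \<in> space M"
  shows "0 \<le> (\<Prod>(n, k)\<in>J. measure (F n \<omega>) {x n k})" "(\<Prod>(n, k)\<in>J. measure (F n \<omega>) {x n k}) \<le> 1"
proof -
  have "0 \<le> measure (F n \<omega>) {x n k} \<and> measure (F n \<omega>) {x n k} \<le> 1" if "(n, k) \<in> J" for n k
    using F_space[of n \<omega>] assms that prob_space.prob_le_1 by (auto simp: space_prob_algebra)
  then show "0 \<le> (\<Prod>(n, k)\<in>J. measure (F n \<omega>) {x n k})" "(\<Prod>(n, k)\<in>J. measure (F n \<omega>) {x n k}) \<le> 1"
    by (auto intro!: prod_nonneg prod_le_1)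
qed

lemma nn_integral_match:
  assumes J: "finite J" "J \<subseteq> {1..} \<times> UNIV" and h: "h \<in> borel_measurable env_alg"
    and b: "\<And>\<omega>. \<omega> \<in> space M \<Longrightarrow> 0 \<le> h \<omega> \<and> h \<omega> \<le> 1"
  shows "(\<integral>\<^sup>+\<omega>. ennreal (h \<omega> * of_bool (match J x \<omega>)) \<partial>M)
    = (\<integral>\<^sup>+\<omega>. ennreal (h \<omega> * (\<Prod>(n, k)\<in>J. measure (F n \<omega>) {x n k})) \<partial>M)"
proof -
  have [measurable]: "h \<in> borel_measurable M" by (rule env_measurable_imp[OF h])
  have [measurable]: "Measurable.pred M (match J x)" by (rule match_measurable[OF J])
  have [measurable]: "(\<lambda>\<omega>. \<Prod>(n, k)\<in>J. measure (F n \<omega>) {x n k}) \<in> borel_measurable M"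
    by (rule env_measurable_imp[OF offspring_prod_measurable[OF J(2)]])
  let ?A = "{\<omega>' \<in> space M. \<forall>(n, k)\<in>J. xi n k \<omega>' = x n k}"
  have A: "?A = {\<omega> \<in> space M. match J x \<omega>}" by (simp add: match_def)
  have [measurable]: "?A \<in> sets M" unfolding A by measurable
  have int1: "integrable M (\<lambda>\<omega>. h \<omega> * indicator ?A \<omega>)"
    using b by (intro integrable_const_bound[where B = 1]) (auto simp: abs_mult indicator_def)
  have int2: "integrable M (\<lambda>\<omega>. h \<omega> * (\<Prod>(n, k)\<in>J. measure (F n \<omega>) {x n k}))"
  proof (rule integrable_const_bound[where B = 1])
    show "AE \<omega> in M. norm (h \<omega> * (\<Prod>(n, k)\<in>J. measure (F n \<omega>) {x n k})) \<le> 1"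
    proof (rule AE_I2)
      fix \<omega> assume \<omega>: "\<omega> \<in> space M"
      show "norm (h \<omega> * (\<Prod>(n, k)\<in>J. measure (F n \<omega>) {x n k})) \<le> 1"
        using b[OF \<omega>] offspring_prod_bounds[OF J(2) \<omega>, of x] by (simp add: abs_mult mult_le_one)
    qed
  qed measurable
  have "(\<integral>\<^sup>+\<omega>. ennreal (h \<omega> * of_bool (match J x \<omega>)) \<partial>M) = (\<integral>\<^sup>+\<omega>. ennreal (h \<omega> * indicator ?A \<omega>) \<partial>M)"
    by (intro nn_integral_cong) (auto simp: match_def indicator_def)
  also have "\<dots> = ennreal (\<integral>\<omega>. h \<omega> * indicator ?A \<omega> \<partial>M)"
    using b by (intro nn_integral_eq_integral int1 AE_I2) auto
  also have "(\<integral>\<omega>. h \<omega> * indicator ?A \<omega> \<partial>M) = (\<integral>\<omega>. h \<omega> * real_cond_exp M env_alg (indicator ?A) \<omega> \<partial>M)"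
    using int1 h by (intro env.real_cond_exp_intg(2)[symmetric]) auto
  also have "\<dots> = (\<integral>\<omega>. h \<omega> * (\<Prod>(n, k)\<in>J. measure (F n \<omega>) {x n k}) \<partial>M)"
  proof (rule integral_cong_AE)
    show "AE \<omega> in M. h \<omega> * real_cond_exp M env_alg (indicator ?A) \<omega> = h \<omega> * (\<Prod>(n, k)\<in>J. measure (F n \<omega>) {x n k})"
      using offspring_given_env[OF J, of x] by eventually_elim simp
  qed measurable
  also have "ennreal \<dots> = (\<integral>\<^sup>+\<omega>. ennreal (h \<omega> * (\<Prod>(n, k)\<in>J. measure (F n \<omega>) {x n k})) \<partial>M)"
    using b offspring_prod_bounds(1)[OF J(2)] by (intro nn_integral_eq_integral[symmetric] int2 AE_I2) auto
  finally show ?thesis .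
qed

lemma gen_fun_measurable:
  assumes "1 \<le> n" and [measurable]: "s \<in> borel_measurable env_alg"
  shows "(\<lambda>\<omega>. gen_fun (F n \<omega>) (s \<omega>)) \<in> borel_measurable env_alg"
proof -
  have [measurable]: "(\<lambda>\<omega>. measure (F n \<omega>) {j}) \<in> borel_measurable env_alg" for j
    by (intro measurable_compose[OF F_measurable_env measurable_measure_singleton] assms)
  show ?thesis unfolding gen_fun_def by measurable
qed

lemma power_xi_measurable:
  assumes "1 \<le> n" and [measurable]: "s \<in> borel_measurable M"
  shows "(\<lambda>\<omega>. s \<omega> ^ xi n k \<omega> :: real) \<in> borel_measurable M"
  by (rule measurable_compose_countable[where f = "\<lambda>i \<omega>. s \<omega> ^ i" and g = "xi n k"])
     (auto intro: offspring_measurable assms)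

lemma one_generation:
  assumes N: "1 \<le> N" and K: "finite K"
    and s: "\<And>k. s k \<in> borel_measurable env_alg" "\<And>k \<omega>. \<omega> \<in> space M \<Longrightarrow> 0 \<le> s k \<omega> \<and> s k \<omega> \<le> 1"
    and J: "finite J" "J \<subseteq> {1..} \<times> UNIV" "\<And>k. k \<in> K \<Longrightarrow> (N, k) \<notin> J"
    and h: "h \<in> borel_measurable env_alg" "\<And>\<omega>. \<omega> \<in> space M \<Longrightarrow> 0 \<le> h \<omega> \<and> h \<omega> \<le> 1"
  shows "(\<integral>\<^sup>+\<omega>. ennreal (h \<omega> * of_bool (match J x \<omega>) * (\<Prod>k\<in>K. s k \<omega> ^ xi N k \<omega>)) \<partial>M)
    = (\<integral>\<^sup>+\<omega>. ennreal (h \<omega> * of_bool (match J x \<omega>) * (\<Prod>k\<in>K. gen_fun (F N \<omega>) (s k \<omega>))) \<partial>M)"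
  using K J h
proof (induction K arbitrary: J x h rule: finite_induct)
  case (insert k K)
  note J = insert.prems(1-3) and h = insert.prems(4,5)
  have sM [measurable]: "s l \<in> borel_measurable M" for l by (rule env_measurable_imp[OF s(1)])
  have [measurable]: "h \<in> borel_measurable M" by (rule env_measurable_imp[OF h(1)])
  have [measurable]: "(\<lambda>\<omega>. s l \<omega> ^ xi N l \<omega>) \<in> borel_measurable M" for l
    by (rule power_xi_measurable[OF N sM])
  define P where "P \<omega> = (\<Prod>l\<in>K. gen_fun (F N \<omega>) (s l \<omega>))" for \<omega>
  have P_env: "P \<in> borel_measurable env_alg"
    unfolding P_def by (intro borel_measurable_prod gen_fun_measurable N s)
  have g01: "0 \<le> gen_fun (F N \<omega>) (s l \<omega>) \<and> gen_fun (F N \<omega>) (s l \<omega>) \<le> 1" if "\<omega> \<in> space M" for \<omega> l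
    using gen_fun_bounds[OF F_space[OF N that]] s(2)[OF that] by auto
  have P01: "0 \<le> P \<omega> \<and> P \<omega> \<le> 1" if "\<omega> \<in> space M" for \<omega>
    unfolding P_def using g01[OF that] by (auto intro!: prod_nonneg prod_le_1)
  define J' where "J' = insert (N, k) J"
  have J': "finite J'" "J' \<subseteq> {1..} \<times> UNIV" "\<And>l. l \<in> K \<Longrightarrow> (N, l) \<notin> J'"
    using J N insert.hyps by (auto simp: J'_def)
  have kJ: "(N, k) \<notin> J" using J by auto
  define x' where "x' y = (\<lambda>m l. if m = N \<and> l = k then y else x m l)" for y
  have match': "match J' (x' y) \<omega> \<longleftrightarrow> xi N k \<omega> = y \<and> match J x \<omega>" for y \<omega>
  proof -
    have "(\<forall>(m, l)\<in>J. xi m l \<omega> = x' y m l) \<longleftrightarrow> (\<forall>(m, l)\<in>J. xi m l \<omega> = x m l)"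
      using kJ by (intro ball_cong refl) (auto simp: x'_def)
    then show ?thesis by (auto simp: match_def J'_def x'_def)
  qed
  have [measurable]: "Measurable.pred M (match J' (x' y))" for y by (rule match_measurable[OF J'(1,2)])
  have prodJ': "(\<Prod>(m, l)\<in>J'. measure (F m \<omega>) {x' y m l}) = measure (F N \<omega>) {y} * (\<Prod>(m, l)\<in>J. measure (F m \<omega>) {x m l})" for y \<omega>
  proof -
    have "(\<Prod>(m, l)\<in>J'. measure (F m \<omega>) {x' y m l}) = measure (F N \<omega>) {y} * (\<Prod>(m, l)\<in>J. measure (F m \<omega>) {x' y m l})"
      unfolding J'_def using J(1) kJ by (subst prod.insert) (auto simp: x'_def)
    also have "(\<Prod>(m, l)\<in>J. measure (F m \<omega>) {x' y m l}) = (\<Prod>(m, l)\<in>J. measure (F m \<omega>) {x m l})"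
      using kJ by (intro prod.cong refl) (auto simp: x'_def)
    finally show ?thesis .
  qed
  have hs: "(\<lambda>\<omega>. h \<omega> * s k \<omega> ^ y) \<in> borel_measurable env_alg" for y
    using h(1) s(1) by measurable
  have hs01: "0 \<le> h \<omega> * s k \<omega> ^ y \<and> h \<omega> * s k \<omega> ^ y \<le> 1" if "\<omega> \<in> space M" for y \<omega>
    using h(2)[OF that] s(2)[OF that, of k] by (auto intro!: mult_le_one power_le_one)
  have hsP: "(\<lambda>\<omega>. h \<omega> * s k \<omega> ^ y * P \<omega>) \<in> borel_measurable env_alg" for y
    using h(1) s(1) P_env by measurable
  have hsP01: "0 \<le> h \<omega> * s k \<omega> ^ y * P \<omega> \<and> h \<omega> * s k \<omega> ^ y * P \<omega> \<le> 1" if "\<omega> \<in> space M" for y \<omega>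
    using hs01[OF that, of y] P01[OF that] by (auto intro!: mult_le_one)
  have "(\<integral>\<^sup>+\<omega>. ennreal (h \<omega> * of_bool (match J x \<omega>) * (\<Prod>l\<in>insert k K. s l \<omega> ^ xi N l \<omega>)) \<partial>M)
    = (\<integral>\<^sup>+\<omega>. (\<Sum>y. ennreal (h \<omega> * s k \<omega> ^ y * of_bool (match J' (x' y) \<omega>) * (\<Prod>l\<in>K. s l \<omega> ^ xi N l \<omega>))) \<partial>M)"
  proof (rule nn_integral_cong)
    fix \<omega>
    have "(\<Sum>y. ennreal (h \<omega> * s k \<omega> ^ y * of_bool (match J' (x' y) \<omega>) * (\<Prod>l\<in>K. s l \<omega> ^ xi N l \<omega>)))
        = (\<Sum>y\<in>{xi N k \<omega>}. ennreal (h \<omega> * s k \<omega> ^ y * of_bool (match J' (x' y) \<omega>) * (\<Prod>l\<in>K. s l \<omega> ^ xi N l \<omega>)))"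
      by (rule suminf_finite) (auto simp: match')
    then show "ennreal (h \<omega> * of_bool (match J x \<omega>) * (\<Prod>l\<in>insert k K. s l \<omega> ^ xi N l \<omega>))
        = (\<Sum>y. ennreal (h \<omega> * s k \<omega> ^ y * of_bool (match J' (x' y) \<omega>) * (\<Prod>l\<in>K. s l \<omega> ^ xi N l \<omega>)))"
      using insert.hyps by (simp add: match' mult_ac)
  qed
  also have "\<dots> = (\<Sum>y. \<integral>\<^sup>+\<omega>. ennreal (h \<omega> * s k \<omega> ^ y * of_bool (match J' (x' y) \<omega>) * (\<Prod>l\<in>K. s l \<omega> ^ xi N l \<omega>)) \<partial>M)"
    by (rule nn_integral_suminf) measurable
  also have "\<dots> = (\<Sum>y. \<integral>\<^sup>+\<omega>. ennreal (h \<omega> * s k \<omega> ^ y * of_bool (match J' (x' y) \<omega>) * P \<omega>) \<partial>M)"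
    unfolding P_def by (intro suminf_cong insert.IH J' hs hs01)
  also have "\<dots> = (\<Sum>y. \<integral>\<^sup>+\<omega>. ennreal (h \<omega> * s k \<omega> ^ y * P \<omega> * of_bool (match J' (x' y) \<omega>)) \<partial>M)"
    by (simp add: mult_ac)
  also have "\<dots> = (\<Sum>y. \<integral>\<^sup>+\<omega>. ennreal (h \<omega> * s k \<omega> ^ y * P \<omega> * (\<Prod>(m, l)\<in>J'. measure (F m \<omega>) {x' y m l})) \<partial>M)"
    by (intro suminf_cong nn_integral_match J' hsP hsP01)
  also have "\<dots> = (\<integral>\<^sup>+\<omega>. (\<Sum>y. ennreal (h \<omega> * s k \<omega> ^ y * P \<omega> * (\<Prod>(m, l)\<in>J'. measure (F m \<omega>) {x' y m l}))) \<partial>M)"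
  proof (rule nn_integral_suminf[symmetric])
    fix y
    have [measurable]: "(\<lambda>\<omega>. h \<omega> * s k \<omega> ^ y * P \<omega>) \<in> borel_measurable M"
      "(\<lambda>\<omega>. \<Prod>(m, l)\<in>J'. measure (F m \<omega>) {x' y m l}) \<in> borel_measurable M"
      using env_measurable_imp hsP offspring_prod_measurable[OF J'(2)] by blast+
    show "(\<lambda>\<omega>. ennreal (h \<omega> * s k \<omega> ^ y * P \<omega> * (\<Prod>(m, l)\<in>J'. measure (F m \<omega>) {x' y m l}))) \<in> borel_measurable M"
      by measurable
  qed
  also have "\<dots> = (\<integral>\<^sup>+\<omega>. ennreal (h \<omega> * P \<omega> * gen_fun (F N \<omega>) (s k \<omega>) * (\<Prod>(m, l)\<in>J. measure (F m \<omega>) {x m l})) \<partial>M)"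
  proof (rule nn_integral_cong)
    fix \<omega> assume \<omega>: "\<omega> \<in> space M"
    let ?c = "h \<omega> * P \<omega> * (\<Prod>(m, l)\<in>J. measure (F m \<omega>) {x m l})"
    have c: "0 \<le> ?c" using h(2)[OF \<omega>] P01[OF \<omega>] offspring_prod_bounds(1)[OF J(2) \<omega>, of x] by simp
    have sm: "summable (\<lambda>y. measure (F N \<omega>) {y} * s k \<omega> ^ y)"
      using gen_fun_bounds(1)[OF F_space[OF N \<omega>]] s(2)[OF \<omega>] by blast
    have "(\<Sum>y. ennreal (h \<omega> * s k \<omega> ^ y * P \<omega> * (\<Prod>(m, l)\<in>J'. measure (F m \<omega>) {x' y m l})))
        = (\<Sum>y. ennreal (?c * (measure (F N \<omega>) {y} * s k \<omega> ^ y)))"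
      unfolding prodJ' by (simp add: mult_ac)
    also have "\<dots> = ennreal (\<Sum>y. ?c * (measure (F N \<omega>) {y} * s k \<omega> ^ y))"
      using s(2)[OF \<omega>, of k] by (intro suminf_ennreal2 summable_mult sm mult_nonneg_nonneg[OF c]) auto
    also have "(\<Sum>y. ?c * (measure (F N \<omega>) {y} * s k \<omega> ^ y)) = ?c * gen_fun (F N \<omega>) (s k \<omega>)"
      unfolding gen_fun_def by (rule suminf_mult[OF sm])
    finally show "(\<Sum>y. ennreal (h \<omega> * s k \<omega> ^ y * P \<omega> * (\<Prod>(m, l)\<in>J'. measure (F m \<omega>) {x' y m l})))
        = ennreal (h \<omega> * P \<omega> * gen_fun (F N \<omega>) (s k \<omega>) * (\<Prod>(m, l)\<in>J. measure (F m \<omega>) {x m l}))"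
      by (simp add: mult_ac)
  qed
  also have "\<dots> = (\<integral>\<^sup>+\<omega>. ennreal (h \<omega> * P \<omega> * gen_fun (F N \<omega>) (s k \<omega>) * of_bool (match J x \<omega>)) \<partial>M)"
  proof (rule nn_integral_match[symmetric, OF J(1,2)])
    show "(\<lambda>\<omega>. h \<omega> * P \<omega> * gen_fun (F N \<omega>) (s k \<omega>)) \<in> borel_measurable env_alg"
      using h(1) P_env gen_fun_measurable[OF N s(1)] by measurable
    show "0 \<le> h \<omega> * P \<omega> * gen_fun (F N \<omega>) (s k \<omega>) \<and> h \<omega> * P \<omega> * gen_fun (F N \<omega>) (s k \<omega>) \<le> 1" if "\<omega> \<in> space M" for \<omega>
      using h(2)[OF that] P01[OF that] g01[OF that, of k] by (auto intro!: mult_le_one)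
  qed
  also have "\<dots> = (\<integral>\<^sup>+\<omega>. ennreal (h \<omega> * of_bool (match J x \<omega>) * (\<Prod>l\<in>insert k K. gen_fun (F N \<omega>) (s l \<omega>))) \<partial>M)"
    using insert.hyps by (simp add: P_def mult_ac)
  finally show ?case .
qed simp

abbreviation offspring :: "'a \<Rightarrow> nat \<Rightarrow> nat \<Rightarrow> nat" where
  "offspring \<omega> \<equiv> \<lambda>m k. xi m k \<omega>"

lemma explored_subset: "explored x n \<subseteq> {1..} \<times> UNIV"
  by (auto simp: explored_def)

lemma history_eq_iff_match: "history (offspring \<omega>) n = history x n \<longleftrightarrow> match (explored x n) x \<omega>"
  by (simp add: history_eq_iff_explored match_def)

lemma history_measurable: "(\<lambda>\<omega>. history (offspring \<omega>) n) \<in> measurable M (count_space UNIV)"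
proof (subst measurable_count_space_eq2_countable, intro conjI ballI)
  fix h :: "nat list list"
  show "(\<lambda>\<omega>. history (offspring \<omega>) n) -` {h} \<inter> space M \<in> sets M"
  proof (cases "\<exists>x. history x n = h")
    case True
    then obtain x where x: "history x n = h" by blast
    have [measurable]: "Measurable.pred M (match (explored x n) x)"
      by (intro match_measurable finite_explored explored_subset)
    have "(\<lambda>\<omega>. history (offspring \<omega>) n) -` {h} \<inter> space M = {\<omega> \<in> space M. match (explored x n) x \<omega>}"
      using history_eq_iff_match[of _ n x] x by auto
    then show ?thesis by simp
  next
    case False
    then have "(\<lambda>\<omega>. history (offspring \<omega>) n) -` {h} \<inter> space M = {}" by auto
    then show ?thesis by simp
  qed
qed auto

lemma history_function_measurable:
  assumes "\<And>k j. f k j \<in> borel_measurable M"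
  shows "(\<lambda>\<omega>. \<Prod>k<pop (offspring \<omega>) n. f k (origin (offspring \<omega>) n k) \<omega> :: real) \<in> borel_measurable M"
proof -
  define rep where "rep h = (SOME x. history x n = h)" for h
  have rep: "history (rep (history x n)) n = history x n" for x
    unfolding rep_def by (rule someI[of _ x]) simp
  have "(\<Prod>k<pop x n. f k (origin x n k) \<omega>) = (\<Prod>k<pop (rep (history x n)) n. f k (origin (rep (history x n)) n k) \<omega>)" for x \<omega>
  proof (rule prod.cong)
    show "{..<pop x n} = {..<pop (rep (history x n)) n}" using history_eqD(1)[OF rep[of x], of n] by simp
    fix k assume "k \<in> {..<pop (rep (history x n)) n}"
    then have "origin (rep (history x n)) n k = origin x n k"
      using history_eqD[OF rep[of x]] by (intro origin_cong) auto
    then show "f k (origin x n k) \<omega> = f k (origin (rep (history x n)) n k) \<omega>" by simp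
  qed
  then have "(\<lambda>\<omega>. \<Prod>k<pop (offspring \<omega>) n. f k (origin (offspring \<omega>) n k) \<omega>)
    = (\<lambda>\<omega>. (\<lambda>h \<omega>. \<Prod>k<pop (rep h) n. f k (origin (rep h) n k) \<omega>) (history (offspring \<omega>) n) \<omega>)"
    by (simp add: fun_eq_iff)
  also have "\<dots> \<in> borel_measurable M"
    by (rule measurable_compose_countable[OF _ history_measurable]) (intro borel_measurable_prod assms)
  finally show ?thesis .
qed

lemma generation_step:
  assumes s: "\<And>j. s j \<in> borel_measurable env_alg" "\<And>j \<omega>. \<omega> \<in> space M \<Longrightarrow> 0 \<le> s j \<omega> \<and> s j \<omega> \<le> 1"
    and h: "h \<in> borel_measurable env_alg" "\<And>\<omega>. \<omega> \<in> space M \<Longrightarrow> 0 \<le> h \<omega> \<and> h \<omega> \<le> 1"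
  shows "(\<integral>\<^sup>+\<omega>. ennreal (h \<omega> * (\<Prod>k<pop (offspring \<omega>) n. s (origin (offspring \<omega>) n k) \<omega> ^ xi (Suc n) k \<omega>)) \<partial>M)
    = (\<integral>\<^sup>+\<omega>. ennreal (h \<omega> * (\<Prod>k<pop (offspring \<omega>) n. gen_fun (F (Suc n) \<omega>) (s (origin (offspring \<omega>) n k) \<omega>))) \<partial>M)"
proof (rule nn_integral_eq_by_cases[OF history_measurable[of n]])
  have [measurable]: "h \<in> borel_measurable M" by (rule env_measurable_imp[OF h(1)])
  have [measurable]: "(\<lambda>\<omega>. \<Prod>k<pop (offspring \<omega>) n. s (origin (offspring \<omega>) n k) \<omega> ^ xi (Suc n) k \<omega>) \<in> borel_measurable M"
    by (rule history_function_measurable) (intro power_xi_measurable env_measurable_imp s, simp)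
  have [measurable]: "(\<lambda>\<omega>. \<Prod>k<pop (offspring \<omega>) n. gen_fun (F (Suc n) \<omega>) (s (origin (offspring \<omega>) n k) \<omega>)) \<in> borel_measurable M"
    by (rule history_function_measurable) (intro env_measurable_imp gen_fun_measurable s, simp)
  show "(\<lambda>\<omega>. ennreal (h \<omega> * (\<Prod>k<pop (offspring \<omega>) n. s (origin (offspring \<omega>) n k) \<omega> ^ xi (Suc n) k \<omega>))) \<in> borel_measurable M"
    "(\<lambda>\<omega>. ennreal (h \<omega> * (\<Prod>k<pop (offspring \<omega>) n. gen_fun (F (Suc n) \<omega>) (s (origin (offspring \<omega>) n k) \<omega>)))) \<in> borel_measurable M"
    by measurable
  fix hh :: "nat list list"
  show "(\<integral>\<^sup>+\<omega>. ennreal (h \<omega> * (\<Prod>k<pop (offspring \<omega>) n. s (origin (offspring \<omega>) n k) \<omega> ^ xi (Suc n) k \<omega>)) * of_bool (history (offspring \<omega>) n = hh) \<partial>M)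
    = (\<integral>\<^sup>+\<omega>. ennreal (h \<omega> * (\<Prod>k<pop (offspring \<omega>) n. gen_fun (F (Suc n) \<omega>) (s (origin (offspring \<omega>) n k) \<omega>))) * of_bool (history (offspring \<omega>) n = hh) \<partial>M)"
  proof (cases "\<exists>x. history x n = hh")
    case False
    then have "history (offspring \<omega>) n \<noteq> hh" for \<omega> by blast
    then show ?thesis by simp
  next
    case True
    then obtain x where x: "history x n = hh" by blast
    let ?J = "explored x n"
    have eq: "ennreal (h \<omega> * (\<Prod>k<pop (offspring \<omega>) n. f k (origin (offspring \<omega>) n k) \<omega>)) * of_bool (history (offspring \<omega>) n = hh)
       = ennreal (h \<omega> * of_bool (match ?J x \<omega>) * (\<Prod>k<pop x n. f k (origin x n k) \<omega>))" for f :: "nat \<Rightarrow> nat \<Rightarrow> 'a \<Rightarrow> real" and \<omega>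
    proof (cases "history (offspring \<omega>) n = hh")
      case True
      then have hx: "history x n = history (offspring \<omega>) n" using x by simp
      have "(\<Prod>k<pop (offspring \<omega>) n. f k (origin (offspring \<omega>) n k) \<omega>) = (\<Prod>k<pop x n. f k (origin x n k) \<omega>)"
      proof (rule prod.cong)
        show "{..<pop (offspring \<omega>) n} = {..<pop x n}" using history_eqD(1)[OF hx, of n] by simp
        fix k assume "k \<in> {..<pop x n}"
        then have "origin x n k = origin (offspring \<omega>) n k"
          using history_eqD[OF hx] by (intro origin_cong) auto
        then show "f k (origin (offspring \<omega>) n k) \<omega> = f k (origin x n k) \<omega>" by simp
      qed
      moreover have "match ?J x \<omega>" using hx history_eq_iff_match[of \<omega> n x] by simp
      ultimately show ?thesis using True by simp
    next
      case False
      then have "\<not> match ?J x \<omega>" using x history_eq_iff_match[of \<omega> n x] by simp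
      then show ?thesis using False by simp
    qed
    show ?thesis
      unfolding eq[of _ "\<lambda>k j \<omega>. s j \<omega> ^ xi (Suc n) k \<omega>"] eq[of _ "\<lambda>k j \<omega>. gen_fun (F (Suc n) \<omega>) (s j \<omega>)"]
      using s h by (intro one_generation finite_explored explored_subset) (auto simp: explored_def)
  qed
qed

definition env_walk :: "'a \<Rightarrow> nat \<Rightarrow> real" where
  "env_walk \<omega> n = partial_sum (\<lambda>i. log_mean (F (Suc i) \<omega>)) n"

lemma log_mean_measurable_env: "1 \<le> n \<Longrightarrow> (\<lambda>\<omega>. log_mean (F n \<omega>)) \<in> borel_measurable env_alg"
  by (rule measurable_compose[OF F_measurable_env measurable_log_mean])

lemma env_walk_measurable: "(\<lambda>\<omega>. env_walk \<omega> n) \<in> borel_measurable env_alg"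
  unfolding env_walk_def partial_sum_def
  by (intro borel_measurable_sum log_mean_measurable_env) simp

lemma AE_geometric:
  assumes "AE f in L. geometric_offspring f" "1 \<le> n"
  shows "AE \<omega> in M. geometric_offspring (F n \<omega>)"
  using assms(1) AE_distrD[OF F_measurable[OF assms(2)]] env_law[OF assms(2)] by metis

lemma clan_generating_function:
  assumes geo: "AE f in L. geometric_offspring f"
    and w: "\<And>j. w j \<in> borel_measurable env_alg" "\<And>j \<omega>. \<omega> \<in> space M \<Longrightarrow> 0 \<le> w j \<omega> \<and> w j \<omega> \<le> 1"
    and h: "h \<in> borel_measurable env_alg" "\<And>\<omega>. \<omega> \<in> space M \<Longrightarrow> 0 \<le> h \<omega> \<and> h \<omega> \<le> 1"
  shows "(\<integral>\<^sup>+\<omega>. ennreal (h \<omega> * (\<Prod>k<pop (offspring \<omega>) n. 1 - w (origin (offspring \<omega>) n k) \<omega>)) \<partial>M)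
    = (\<integral>\<^sup>+\<omega>. ennreal (h \<omega> * (\<Prod>j\<le>n. 1 - survival (env_walk \<omega>) j n (w j \<omega>))) \<partial>M)"
  using w h
proof (induction n arbitrary: w h)
  case 0
  then show ?case by (simp add: survival_self)
next
  case (Suc n)
  note w = Suc.prems(1,2) and h = Suc.prems(3,4)
  define w' where "w' j \<omega> = w j \<omega> / (w j \<omega> + exp (- log_mean (F (Suc n) \<omega>)))" for j \<omega>
  define h' where "h' \<omega> = h \<omega> * (1 - w (Suc n) \<omega>)" for \<omega>
  have lm [measurable]: "(\<lambda>\<omega>. log_mean (F (Suc n) \<omega>)) \<in> borel_measurable env_alg"
    by (rule log_mean_measurable_env) simp
  have w': "w' j \<in> borel_measurable env_alg" for j
    unfolding w'_def using w(1) by measurable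
  have w'01: "0 \<le> w' j \<omega> \<and> w' j \<omega> \<le> 1" if "\<omega> \<in> space M" for j \<omega>
  proof -
    have "0 < w j \<omega> + exp (- log_mean (F (Suc n) \<omega>))" using w(2)[OF that, of j] by (simp add: add_nonneg_pos)
    then show ?thesis unfolding w'_def using w(2)[OF that, of j] by (simp add: divide_le_eq)
  qed
  have h': "h' \<in> borel_measurable env_alg" unfolding h'_def using h(1) w(1) by measurable
  have h'01: "0 \<le> h' \<omega> \<and> h' \<omega> \<le> 1" if "\<omega> \<in> space M" for \<omega>
    unfolding h'_def using h(2)[OF that] w(2)[OF that, of "Suc n"] by (auto intro!: mult_le_one)
  have "(\<integral>\<^sup>+\<omega>. ennreal (h \<omega> * (\<Prod>k<pop (offspring \<omega>) (Suc n). 1 - w (origin (offspring \<omega>) (Suc n) k) \<omega>)) \<partial>M)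
    = (\<integral>\<^sup>+\<omega>. ennreal (h' \<omega> * (\<Prod>k<pop (offspring \<omega>) n. (1 - w (origin (offspring \<omega>) n k) \<omega>) ^ xi (Suc n) k \<omega>)) \<partial>M)"
    unfolding h'_def prod_origin_Suc[of "\<lambda>j. 1 - w j _"] by (simp only: mult.assoc)
  also have "\<dots> = (\<integral>\<^sup>+\<omega>. ennreal (h' \<omega> * (\<Prod>k<pop (offspring \<omega>) n. gen_fun (F (Suc n) \<omega>) (1 - w (origin (offspring \<omega>) n k) \<omega>))) \<partial>M)"
    using w by (intro generation_step[where s = "\<lambda>j \<omega>. 1 - w j \<omega>"] h' h'01) auto
  also have "\<dots> = (\<integral>\<^sup>+\<omega>. ennreal (h' \<omega> * (\<Prod>k<pop (offspring \<omega>) n. 1 - w' (origin (offspring \<omega>) n k) \<omega>)) \<partial>M)"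
  proof (rule nn_integral_cong_AE)
    show "AE \<omega> in M. ennreal (h' \<omega> * (\<Prod>k<pop (offspring \<omega>) n. gen_fun (F (Suc n) \<omega>) (1 - w (origin (offspring \<omega>) n k) \<omega>)))
        = ennreal (h' \<omega> * (\<Prod>k<pop (offspring \<omega>) n. 1 - w' (origin (offspring \<omega>) n k) \<omega>))"
      using AE_geometric[OF geo, of "Suc n", simplified] AE_space
    proof eventually_elim
      case (elim \<omega>)
      have "gen_fun (F (Suc n) \<omega>) (1 - w j \<omega>) = 1 - w' j \<omega>" for j
        unfolding w'_def using w(2)[OF elim(2), of j]
        by (intro gen_fun_geometric F_space elim) auto
      then show ?case by simp
    qed
  qed
  also have "\<dots> = (\<integral>\<^sup>+\<omega>. ennreal (h' \<omega> * (\<Prod>j\<le>n. 1 - survival (env_walk \<omega>) j n (w' j \<omega>))) \<partial>M)"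
    by (rule Suc.IH[OF w' w'01 h' h'01])
  also have "\<dots> = (\<integral>\<^sup>+\<omega>. ennreal (h \<omega> * (\<Prod>j\<le>Suc n. 1 - survival (env_walk \<omega>) j (Suc n) (w j \<omega>))) \<partial>M)"
  proof (rule nn_integral_cong)
    fix \<omega> assume \<omega>: "\<omega> \<in> space M"
    have "- log_mean (F (Suc n) \<omega>) = env_walk \<omega> n - env_walk \<omega> (Suc n)"
      by (simp add: env_walk_def partial_sum_Suc)
    then have "survival (env_walk \<omega>) j n (w' j \<omega>) = survival (env_walk \<omega>) j (Suc n) (w j \<omega>)" if "j \<le> n" for j
      unfolding w'_def using survival_Suc[OF that, of "w j \<omega>" "env_walk \<omega>"] w(2)[OF \<omega>, of j] by simp
    then have "(\<Prod>j\<le>n. 1 - survival (env_walk \<omega>) j n (w' j \<omega>)) = (\<Prod>j\<le>n. 1 - survival (env_walk \<omega>) j (Suc n) (w j \<omega>))"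
      by (intro prod.cong) auto
    then show "ennreal (h' \<omega> * (\<Prod>j\<le>n. 1 - survival (env_walk \<omega>) j n (w' j \<omega>)))
        = ennreal (h \<omega> * (\<Prod>j\<le>Suc n. 1 - survival (env_walk \<omega>) j (Suc n) (w j \<omega>)))"
      by (simp add: h'_def survival_self mult_ac)
  qed
  finally show ?case .
qed

lemma prob_clan_event:
  assumes geo: "AE f in L. geometric_offspring f" and i: "i < n"
  shows "measure M (clan_event M xi i n) = (\<integral>\<omega>. clan_formula (env_walk \<omega>) i n \<partial>M)"
proof -
  define w1 where "w1 j = (of_bool (j \<noteq> i \<and> j \<noteq> n) :: real)" for j
  define w0 where "w0 j = (of_bool (j \<noteq> n) :: real)" for j
  have [measurable]: "(\<lambda>\<omega>. env_walk \<omega> j) \<in> borel_measurable M" for j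
    by (rule env_measurable_imp[OF env_walk_measurable])
  define A where "A w \<omega> = (\<Prod>k<pop (offspring \<omega>) n. 1 - w (origin (offspring \<omega>) n k) :: real)" for w \<omega>
  define B where "B w \<omega> = (\<Prod>j\<le>n. 1 - survival (env_walk \<omega>) j n (w j))" for w \<omega>
  have [measurable]: "A w \<in> borel_measurable M" for w
    unfolding A_def by (rule history_function_measurable) simp
  have [measurable]: "B w \<in> borel_measurable M" for w
    unfolding B_def survival_def by measurable
  have eq: "(\<integral>\<omega>. A w \<omega> \<partial>M) = (\<integral>\<omega>. B w \<omega> \<partial>M)" "integrable M (A w)" "integrable M (B w)"
    if w: "\<And>j. 0 \<le> w j \<and> w j \<le> 1" for w
  proof -
    have A01: "0 \<le> A w \<omega>" "A w \<omega> \<le> 1" for \<omega>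
      unfolding A_def using w by (auto intro!: prod_nonneg prod_le_1)
    have B01: "0 \<le> B w \<omega>" "B w \<omega> \<le> 1" for \<omega>
      unfolding B_def using w survival_bounds[of "w _" _ n "env_walk \<omega>"] by (auto intro!: prod_nonneg prod_le_1)
    have "(\<integral>\<^sup>+\<omega>. ennreal (A w \<omega>) \<partial>M) = (\<integral>\<^sup>+\<omega>. ennreal (B w \<omega>) \<partial>M)"
      using clan_generating_function[OF geo, of "\<lambda>j _. w j" "\<lambda>_. 1" n] w by (simp add: A_def B_def)
    then show "(\<integral>\<omega>. A w \<omega> \<partial>M) = (\<integral>\<omega>. B w \<omega> \<partial>M)"
      using A01 B01 by (simp add: integral_eq_nn_integral)
    show "integrable M (A w)" "integrable M (B w)"
      using A01 B01 by (auto intro!: integrable_const_bound[where B = 1])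
  qed
  have ind: "of_bool (only_clan_survives (offspring \<omega>) i n) = A w1 \<omega> - A w0 \<omega>" for \<omega>
  proof -
    have "1 - w1 j = of_bool (j = i \<or> j = n)" "1 - w0 j = of_bool (j = n)" for j
      by (auto simp: w1_def w0_def)
    then show ?thesis unfolding A_def clan_indicator[OF i] by simp
  qed
  have "indicator (clan_event M xi i n) \<omega> = A w1 \<omega> - A w0 \<omega>" if "\<omega> \<in> space M" for \<omega>
    using ind[of \<omega>] that by (simp add: clan_event_def indicator_def)
  moreover have "clan_event M xi i n \<in> sets M"
  proof -
    have "clan_event M xi i n = {\<omega> \<in> space M. A w1 \<omega> - A w0 \<omega> = 1}"
      unfolding clan_event_def using ind by (auto simp flip: ind)
    then show ?thesis by simp
  qed
  ultimately have "measure M (clan_event M xi i n) = (\<integral>\<omega>. A w1 \<omega> - A w0 \<omega> \<partial>M)"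
    by (subst Bochner_Integration.integral_cong[OF refl, of M _ "indicator (clan_event M xi i n)"]) auto
  also have "\<dots> = (\<integral>\<omega>. B w1 \<omega> - B w0 \<omega> \<partial>M)"
    using eq[of w1] eq[of w0] by (simp add: w1_def w0_def)
  also have "\<dots> = (\<integral>\<omega>. clan_formula (env_walk \<omega>) i n \<partial>M)"
    unfolding B_def w1_def w0_def clan_formula_eq[OF i] ..
  finally show ?thesis .
qed

end

section \<open>Change of measure\<close>

definition early_expsum :: "(nat \<Rightarrow> real) \<Rightarrow> nat \<Rightarrow> real" where
  "early_expsum \<omega> m = (\<Sum>k<m. exp (partial_sum \<omega> k))"

lemma early_expsum_ge_1: "1 \<le> m \<Longrightarrow> 1 \<le> early_expsum \<omega> m"
  using member_le_sum[of 0 "{..<m}" "\<lambda>k. exp (partial_sum \<omega> k)"] by (simp add: early_expsum_def)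

lemma expsum_early: "expsum \<omega> m = early_expsum \<omega> m + exp (partial_sum \<omega> m)"
  by (simp add: expsum_def early_expsum_def lessThan_Suc_atMost[symmetric])

definition reversed_formula :: "(nat \<Rightarrow> real) \<Rightarrow> nat \<Rightarrow> nat \<Rightarrow> real" where
  "reversed_formula \<omega> m n = exp (partial_sum \<omega> m) / (early_expsum \<omega> m * expsum \<omega> n)"

lemma partial_sum_reverse:
  assumes "k \<le> n"
  shows "partial_sum (\<lambda>i. \<omega> (rev [0..<n] ! i)) k = partial_sum \<omega> n - partial_sum \<omega> (n - k)"
  using assms
proof (induction k)
  case (Suc k)
  have "rev [0..<n] ! k = n - Suc k" using Suc.prems by (simp add: rev_nth)
  moreover have "partial_sum \<omega> (n - k) = partial_sum \<omega> (n - Suc k) + \<omega> (n - Suc k)"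
    using Suc.prems partial_sum_Suc[of \<omega> "n - Suc k"] by (simp add: Suc_diff_Suc)
  ultimately show ?case using Suc by (simp add: partial_sum_Suc)
qed simp

lemma clan_formula_reverse:
  assumes "1 \<le> m" "m \<le> n"
  shows "clan_formula (partial_sum (\<lambda>i. \<omega> (rev [0..<n] ! i))) (n - m) n = reversed_formula \<omega> m n"
proof -
  let ?S = "partial_sum \<omega>"
  let ?R = "partial_sum (\<lambda>i. \<omega> (rev [0..<n] ! i))"
  have R: "exp (- ?R k) = exp (- ?S n) * exp (?S (n - k))" if "k \<le> n" for k
    using partial_sum_reverse[OF that, of \<omega>] by (simp flip: exp_add)
  have "(\<Sum>k\<in>{Suc (n - m)..n}. exp (- ?R k)) = (\<Sum>k\<in>{Suc (n - m)..n}. exp (- ?S n) * exp (?S (n - k)))"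
    by (intro sum.cong) (auto simp: R)
  also have "\<dots> = (\<Sum>l<m. exp (- ?S n) * exp (?S l))"
    by (rule sum.reindex_bij_witness[of _ "\<lambda>l. n - l" "\<lambda>k. n - k"]) (use assms in auto)
  finally have 1: "(\<Sum>k\<in>{Suc (n - m)..n}. exp (- ?R k)) = exp (- ?S n) * early_expsum \<omega> m"
    by (simp add: early_expsum_def sum_distrib_left)
  have "(\<Sum>k\<in>{0..n}. exp (- ?R k)) = (\<Sum>k\<in>{0..n}. exp (- ?S n) * exp (?S (n - k)))"
    by (intro sum.cong) (auto simp: R)
  also have "\<dots> = (\<Sum>l\<le>n. exp (- ?S n) * exp (?S l))"
    by (rule sum.reindex_bij_witness[of _ "\<lambda>l. n - l" "\<lambda>k. n - k"]) auto
  finally have 2: "(\<Sum>k\<in>{0..n}. exp (- ?R k)) = exp (- ?S n) * expsum \<omega> n"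
    by (simp add: expsum_def sum_distrib_left)
  have 3: "exp (- ?R (n - m)) = exp (- ?S n) * exp (?S m)" "exp (- ?R n) = exp (- ?S n)"
    using R[of "n - m"] R[of n] assms by auto
  show ?thesis unfolding clan_formula_def 1 2 3 reversed_formula_def
    by (simp add: mult_ac divide_simps)
qed

lemma reversed_formula_bounds:
  assumes "1 \<le> m" "m \<le> n"
  shows "0 \<le> reversed_formula \<omega> m n" "reversed_formula \<omega> m n \<le> 1"
proof -
  have b: "1 \<le> early_expsum \<omega> m" by (rule early_expsum_ge_1[OF assms(1)])
  have Q: "exp (partial_sum \<omega> m) \<le> expsum \<omega> n" by (rule exp_le_expsum[OF assms(2)])
  have pos: "0 < expsum \<omega> n" using expsum_ge_1[of \<omega> n] by linarith
  show "0 \<le> reversed_formula \<omega> m n" unfolding reversed_formula_def using b pos by simp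
  have "1 * expsum \<omega> n \<le> early_expsum \<omega> m * expsum \<omega> n" using b pos by (intro mult_right_mono) auto
  with Q have "exp (partial_sum \<omega> m) \<le> early_expsum \<omega> m * expsum \<omega> n" by linarith
  then show "reversed_formula \<omega> m n \<le> 1" unfolding reversed_formula_def using Q pos b by (auto simp: divide_le_eq)
qed

context iid_walk
begin

lemma measurable_early_expsum [measurable]: "(\<lambda>\<omega>. early_expsum \<omega> m) \<in> borel_measurable paths"
  unfolding early_expsum_def by measurable

lemma measurable_reversed_formula [measurable]: "(\<lambda>\<omega>. reversed_formula \<omega> m n) \<in> borel_measurable paths"
  unfolding reversed_formula_def by measurable

lemma measurable_clan_formula [measurable]: "(\<lambda>\<omega>. clan_formula (partial_sum \<omega>) i n) \<in> borel_measurable paths"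
  unfolding clan_formula_def by measurable

lemma integral_clan_formula:
  assumes "1 \<le> m" "m \<le> n"
  shows "(\<integral>\<omega>. clan_formula (partial_sum \<omega>) (n - m) n \<partial>paths) = (\<integral>\<omega>. reversed_formula \<omega> m n \<partial>paths)"
proof -
  have "rev [0..<n] \<in> permutations_of_set {..<n}" by (auto simp: permutations_of_set_def)
  then have "(\<integral>\<omega>. clan_formula (partial_sum (\<lambda>i. \<omega> (rev [0..<n] ! i))) (n - m) n \<partial>paths)
      = (\<integral>\<omega>. clan_formula (partial_sum \<omega>) (n - m) n \<partial>paths)"
  proof (rule integral_perm[where f = "\<lambda>\<omega>. clan_formula (partial_sum \<omega>) (n - m) n"])
    fix \<omega> \<omega>' :: "nat \<Rightarrow> real" assume *: "\<And>i. i < n \<Longrightarrow> \<omega> i = \<omega>' i"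
    have "partial_sum \<omega> k = partial_sum \<omega>' k" if "k \<le> n" for k
      using * that by (intro partial_sum_cong) auto
    then show "clan_formula (partial_sum \<omega>) (n - m) n = clan_formula (partial_sum \<omega>') (n - m) n"
      by (simp add: clan_formula_def)
  qed measurable
  then show ?thesis by (simp add: clan_formula_reverse[OF assms])
qed

lemma nn_integral_split_product:
  assumes [measurable]: "f \<in> borel_measurable paths" "g \<in> borel_measurable paths"
    and f: "\<And>\<omega> \<omega>'. f (comb_seq k \<omega> \<omega>') = f \<omega>"
  shows "(\<integral>\<^sup>+\<omega>. f \<omega> * g (\<lambda>i. \<omega> (k + i)) \<partial>paths) = (\<integral>\<^sup>+\<omega>. f \<omega> \<partial>paths) * (\<integral>\<^sup>+\<omega>. g \<omega> \<partial>paths)"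
proof -
  interpret PP: pair_prob_space paths paths ..
  have [measurable]: "(\<lambda>\<omega>. g (\<lambda>i. \<omega> (k + i))) \<in> borel_measurable paths"
    by (rule measurable_compose[OF measurable_reindex assms(2)])
  have "(\<integral>\<^sup>+\<omega>. f \<omega> * g (\<lambda>i. \<omega> (k + i)) \<partial>paths)
      = (\<integral>\<^sup>+\<omega>. f \<omega> * g (\<lambda>i. \<omega> (k + i)) \<partial>distr (paths \<Otimes>\<^sub>M paths) paths (\<lambda>(\<omega>, \<omega>'). comb_seq k \<omega> \<omega>'))"
    by (subst PiM_comb_seq) simp
  also have "\<dots> = (\<integral>\<^sup>+z. f (case z of (\<omega>, \<omega>') \<Rightarrow> comb_seq k \<omega> \<omega>') * g (\<lambda>i. (case z of (\<omega>, \<omega>') \<Rightarrow> comb_seq k \<omega> \<omega>') (k + i)) \<partial>(paths \<Otimes>\<^sub>M paths))"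
    by (rule nn_integral_distr) (auto intro: measurable_comb_seq)
  also have "\<dots> = (\<integral>\<^sup>+z. f (fst z) * g (snd z) \<partial>(paths \<Otimes>\<^sub>M paths))"
    by (simp add: case_prod_beta' f comb_seq_shift)
  also have "\<dots> = (\<integral>\<^sup>+\<omega>. \<integral>\<^sup>+\<omega>'. f \<omega> * g \<omega>' \<partial>paths \<partial>paths)"
    by (subst P.nn_integral_fst[symmetric]) auto
  also have "\<dots> = (\<integral>\<^sup>+\<omega>. f \<omega> \<partial>paths) * (\<integral>\<^sup>+\<omega>. g \<omega> \<partial>paths)"
    by (simp add: nn_integral_cmult nn_integral_multc)
  finally show ?thesis .
qed

lemma nn_integral_first_step:
  assumes [measurable]: "f \<in> borel_measurable paths"
  shows "(\<integral>\<^sup>+\<omega>. f \<omega> \<partial>paths) = (\<integral>\<^sup>+x. (\<integral>\<^sup>+\<omega>. f (case_nat x \<omega>) \<partial>paths) \<partial>\<nu>)"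
proof -
  have "(\<integral>\<^sup>+\<omega>. f \<omega> \<partial>paths) = (\<integral>\<^sup>+\<omega>. f \<omega> \<partial>distr (\<nu> \<Otimes>\<^sub>M paths) paths (\<lambda>(x, \<omega>). case_nat x \<omega>))"
    by (subst PiM_iter) simp
  also have "\<dots> = (\<integral>\<^sup>+z. f (case z of (x, \<omega>) \<Rightarrow> case_nat x \<omega>) \<partial>(\<nu> \<Otimes>\<^sub>M paths))"
    by (rule nn_integral_distr) measurable
  also have "\<dots> = (\<integral>\<^sup>+x. (\<integral>\<^sup>+\<omega>. f (case_nat x \<omega>) \<partial>paths) \<partial>\<nu>)"
    by (subst P.nn_integral_fst[symmetric]) auto
  finally show ?thesis .
qed

end

lemma partial_sum_case_nat: "partial_sum (case_nat x \<omega>) (Suc m) = x + partial_sum \<omega> m"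
  by (induction m) (simp_all add: partial_sum_Suc)

locale tilted_walks = base: iid_walk \<nu>0 + tilt: iid_walk \<nu> for \<nu>0 \<nu> +
  fixes \<gamma> :: real
  assumes \<gamma>: "0 < \<gamma>" "\<gamma> < 1"
    and tilt_density: "\<nu> = density \<nu>0 (\<lambda>x. ennreal (exp x / \<gamma>))"
begin

lemma sets_base_tilt: "sets base.paths = sets tilt.paths"
  by (intro sets_PiM_cong) (auto simp: base.sets_\<nu> tilt.sets_\<nu>)

lemma nn_integral_tilt:
  assumes "f \<in> borel_measurable base.paths" "\<And>\<omega> \<omega>'. (\<And>i. i < m \<Longrightarrow> \<omega> i = \<omega>' i) \<Longrightarrow> f \<omega> = f \<omega>'"
  shows "(\<integral>\<^sup>+\<omega>. ennreal (exp (partial_sum \<omega> m)) * f \<omega> \<partial>base.paths) = ennreal (\<gamma> ^ m) * (\<integral>\<^sup>+\<omega>. f \<omega> \<partial>tilt.paths)"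
  using assms
proof (induction m arbitrary: f)
  case 0
  then have "f \<omega> = f (\<lambda>_. 0)" for \<omega> by blast
  then obtain c where "f = (\<lambda>_. c)" by blast
  then show ?case
    using base.P.emeasure_space_1 tilt.P.emeasure_space_1 by simp
next
  case (Suc m)
  note [measurable] = Suc.prems(1)
  have ft [measurable]: "f \<in> borel_measurable tilt.paths"
    using Suc.prems(1) sets_base_tilt measurable_cong_sets by blast
  have step: "(\<lambda>\<omega>. f (case_nat x \<omega>)) \<in> borel_measurable base.paths" for x
  proof -
    have "x \<in> space \<nu>0" using sets_eq_imp_space_eq[OF base.sets_\<nu>] by simp
    then show ?thesis by measurable
  qed
  have "(\<integral>\<^sup>+\<omega>. ennreal (exp (partial_sum \<omega> (Suc m))) * f \<omega> \<partial>base.paths)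
      = (\<integral>\<^sup>+x. (\<integral>\<^sup>+\<omega>. ennreal (exp x) * (ennreal (exp (partial_sum \<omega> m)) * f (case_nat x \<omega>)) \<partial>base.paths) \<partial>\<nu>0)"
    by (subst base.nn_integral_first_step)
       (simp_all add: partial_sum_case_nat exp_add ennreal_mult' mult.assoc)
  also have "\<dots> = (\<integral>\<^sup>+x. ennreal (exp x) * (\<integral>\<^sup>+\<omega>. ennreal (exp (partial_sum \<omega> m)) * f (case_nat x \<omega>) \<partial>base.paths) \<partial>\<nu>0)"
    using step by (intro nn_integral_cong nn_integral_cmult) measurable
  also have "\<dots> = (\<integral>\<^sup>+x. ennreal (exp x) * (ennreal (\<gamma> ^ m) * (\<integral>\<^sup>+\<omega>. f (case_nat x \<omega>) \<partial>tilt.paths)) \<partial>\<nu>0)"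
  proof (intro nn_integral_cong arg_cong2[where f = "(*)"] refl Suc.IH step)
    fix x \<omega> \<omega>' assume "\<And>i. i < m \<Longrightarrow> \<omega> i = (\<omega>' i :: real)"
    then show "f (case_nat x \<omega>) = f (case_nat x \<omega>')"
      by (intro Suc.prems(2)) (auto split: nat.split)
  qed
  also have "\<dots> = (\<integral>\<^sup>+x. ennreal (\<gamma> ^ Suc m) * (ennreal (exp x / \<gamma>) * (\<integral>\<^sup>+\<omega>. f (case_nat x \<omega>) \<partial>tilt.paths)) \<partial>\<nu>0)"
  proof (intro nn_integral_cong)
    fix x
    have "ennreal (\<gamma> ^ Suc m) * ennreal (exp x / \<gamma>) = ennreal (exp x) * ennreal (\<gamma> ^ m)"
      using \<gamma> by (simp flip: ennreal_mult)
    then show "ennreal (exp x) * (ennreal (\<gamma> ^ m) * (\<integral>\<^sup>+\<omega>. f (case_nat x \<omega>) \<partial>tilt.paths)) =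
        ennreal (\<gamma> ^ Suc m) * (ennreal (exp x / \<gamma>) * (\<integral>\<^sup>+\<omega>. f (case_nat x \<omega>) \<partial>tilt.paths))"
      by (metis mult.assoc)
  qed
  also have "\<dots> = ennreal (\<gamma> ^ Suc m) * (\<integral>\<^sup>+x. ennreal (exp x / \<gamma>) * (\<integral>\<^sup>+\<omega>. f (case_nat x \<omega>) \<partial>tilt.paths) \<partial>\<nu>0)"
  proof (rule nn_integral_cmult)
    have "(\<lambda>x. \<integral>\<^sup>+\<omega>. f (case_nat x \<omega>) \<partial>tilt.paths) \<in> borel_measurable \<nu>"
      by measurable
    then have [measurable]: "(\<lambda>x. \<integral>\<^sup>+\<omega>. f (case_nat x \<omega>) \<partial>tilt.paths) \<in> borel_measurable \<nu>0"
      unfolding tilt_density by simp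
    show "(\<lambda>x. ennreal (exp x / \<gamma>) * (\<integral>\<^sup>+\<omega>. f (case_nat x \<omega>) \<partial>tilt.paths)) \<in> borel_measurable \<nu>0"
      by measurable
  qed
  also have "(\<integral>\<^sup>+x. ennreal (exp x / \<gamma>) * (\<integral>\<^sup>+\<omega>. f (case_nat x \<omega>) \<partial>tilt.paths) \<partial>\<nu>0)
      = (\<integral>\<^sup>+x. (\<integral>\<^sup>+\<omega>. f (case_nat x \<omega>) \<partial>tilt.paths) \<partial>\<nu>)"
  proof -
    have "(\<lambda>x. \<integral>\<^sup>+\<omega>. f (case_nat x \<omega>) \<partial>tilt.paths) \<in> borel_measurable \<nu>"
      by measurable
    then have m: "(\<lambda>x. \<integral>\<^sup>+\<omega>. f (case_nat x \<omega>) \<partial>tilt.paths) \<in> borel_measurable \<nu>0"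
      by (simp add: measurable_cong_sets[OF trans[OF tilt.sets_\<nu> base.sets_\<nu>[symmetric]] refl])
    have "(\<integral>\<^sup>+x. (\<integral>\<^sup>+\<omega>. f (case_nat x \<omega>) \<partial>tilt.paths) \<partial>density \<nu>0 (\<lambda>x. ennreal (exp x / \<gamma>)))
       = (\<integral>\<^sup>+x. ennreal (exp x / \<gamma>) * (\<integral>\<^sup>+\<omega>. f (case_nat x \<omega>) \<partial>tilt.paths) \<partial>\<nu>0)"
      by (rule nn_integral_density) (auto intro: m)
    then show ?thesis by (simp flip: tilt_density)
  qed
  also have "\<dots> = (\<integral>\<^sup>+\<omega>. f \<omega> \<partial>tilt.paths)" by (rule tilt.nn_integral_first_step[symmetric, OF ft])
  finally show ?case .
qed

lemma nn_integral_exp_partial_sum: "(\<integral>\<^sup>+\<omega>. ennreal (exp (partial_sum \<omega> k)) \<partial>base.paths) = ennreal (\<gamma> ^ k)"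
  using nn_integral_tilt[of "\<lambda>_. 1" k] tilt.P.emeasure_space_1 by simp

lemma integrable_exp_partial_sum: "integrable base.paths (\<lambda>\<omega>. exp (partial_sum \<omega> k))"
  by (intro integrableI_nonneg) (auto simp: nn_integral_exp_partial_sum)

lemma integral_exp_partial_sum: "(\<integral>\<omega>. exp (partial_sum \<omega> k) \<partial>base.paths) = \<gamma> ^ k"
  using \<gamma> by (subst integral_eq_nn_integral) (auto simp: nn_integral_exp_partial_sum)

lemma power_sum_le: "(\<Sum>k\<in>A. \<gamma> ^ k) \<le> 1 / (1 - \<gamma>)" if "finite A"
proof -
  have "(\<Sum>k\<in>A. \<gamma> ^ k) \<le> (\<Sum>k. \<gamma> ^ k)"
    using that \<gamma> by (intro sum_le_suminf summable_geometric) auto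
  then show ?thesis using \<gamma> by (simp add: suminf_geometric)
qed

lemma integral_expsum_le: "integrable base.paths (\<lambda>\<omega>. expsum \<omega> n)" "(\<integral>\<omega>. expsum \<omega> n \<partial>base.paths) \<le> 1 / (1 - \<gamma>)"
proof -
  show "integrable base.paths (\<lambda>\<omega>. expsum \<omega> n)"
    unfolding expsum_def by (intro Bochner_Integration.integrable_sum integrable_exp_partial_sum)
  have "(\<integral>\<omega>. expsum \<omega> n \<partial>base.paths) = (\<Sum>k\<le>n. \<gamma> ^ k)"
    unfolding expsum_def by (subst Bochner_Integration.integral_sum) (simp_all add: integrable_exp_partial_sum integral_exp_partial_sum)
  then show "(\<integral>\<omega>. expsum \<omega> n \<partial>base.paths) \<le> 1 / (1 - \<gamma>)" using power_sum_le[of "{..n}"] by simp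
qed

definition clan_prob :: "nat \<Rightarrow> nat \<Rightarrow> real" where
  "clan_prob m n = (\<integral>\<omega>. reversed_formula \<omega> m n \<partial>base.paths)"

lemma reversed_formula_integrable:
  "1 \<le> m \<Longrightarrow> m \<le> n \<Longrightarrow> integrable base.paths (\<lambda>\<omega>. reversed_formula \<omega> m n)"
  using reversed_formula_bounds by (intro base.integrable_bounded[where B = 1]) auto

lemma clan_prob_limit:
  assumes m: "1 \<le> m"
  shows "\<exists>r>0. (\<lambda>n. clan_prob m n) \<longlonglongrightarrow> r"
proof -
  define Z where "Z \<omega> = min 1 (exp (partial_sum \<omega> m) / early_expsum \<omega> m)" for \<omega>
  have Z_meas [measurable]: "Z \<in> borel_measurable base.paths" unfolding Z_def by measurable
  have Z: "0 < Z \<omega>" "Z \<omega> \<le> 1" for \<omega>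
    unfolding Z_def using early_expsum_ge_1[OF m, of \<omega>] by auto
  define s where "s = (\<integral>\<omega>. sqrt (Z \<omega>) \<partial>base.paths)"
  have int: "integrable base.paths (\<lambda>\<omega>. sqrt (Z \<omega>))"
    using Z by (intro base.integrable_bounded[where B = 1]) (auto simp: less_imp_le)
  have "s \<noteq> 0"
  proof
    assume "s = 0"
    then have "AE \<omega> in base.paths. sqrt (Z \<omega>) = 0"
      unfolding s_def using Z by (subst (asm) integral_nonneg_eq_0_iff_AE[OF int]) (auto simp: less_imp_le)
    then have "AE \<omega> in base.paths. False" by eventually_elim (metis Z(1) less_irrefl real_sqrt_eq_0_iff)
    then show False using base.P.AE_False by simp
  qed
  moreover have "0 \<le> s" unfolding s_def using Z by (intro integral_nonneg_AE) (auto simp: less_imp_le)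
  ultimately have s: "0 < s" by simp
  define t where "t = s * (1 - \<gamma>)"
  have t: "t > 0" using s \<gamma> by (simp add: t_def)
  have lower: "s\<^sup>2 * (1 - \<gamma>) \<le> clan_prob m n" if "m \<le> n" for n
  proof -
    have "2 * t * sqrt (Z \<omega>) - t\<^sup>2 * expsum \<omega> n \<le> reversed_formula \<omega> m n" for \<omega>
    proof -
      let ?T = "expsum \<omega> n"
      have T: "?T > 0" using expsum_ge_1[of \<omega> n] by linarith
      have "0 \<le> (sqrt (Z \<omega>) - t * ?T)\<^sup>2" by simp
      then have "(2 * t * sqrt (Z \<omega>) - t\<^sup>2 * ?T) * ?T \<le> Z \<omega>"
        using Z(1)[of \<omega>] by (simp add: power2_diff power_mult_distrib algebra_simps power2_eq_square)
      then have "2 * t * sqrt (Z \<omega>) - t\<^sup>2 * ?T \<le> Z \<omega> / ?T" using T by (simp add: pos_le_divide_eq)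
      also have "\<dots> \<le> (exp (partial_sum \<omega> m) / early_expsum \<omega> m) / ?T"
        using T by (intro divide_right_mono) (auto simp: Z_def)
      finally show ?thesis by (simp add: reversed_formula_def)
    qed
    then have "(\<integral>\<omega>. 2 * t * sqrt (Z \<omega>) - t\<^sup>2 * expsum \<omega> n \<partial>base.paths) \<le> clan_prob m n"
      unfolding clan_prob_def
      by (intro integral_mono Bochner_Integration.integrable_diff integrable_mult_right int integral_expsum_le
          reversed_formula_integrable m that)
    also have "(\<integral>\<omega>. 2 * t * sqrt (Z \<omega>) - t\<^sup>2 * expsum \<omega> n \<partial>base.paths) = 2 * t * s - t\<^sup>2 * (\<integral>\<omega>. expsum \<omega> n \<partial>base.paths)"
      using int integral_expsum_le(1)[of n] by (subst Bochner_Integration.integral_diff) (auto simp: s_def)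
    finally have "2 * t * s - t\<^sup>2 * (\<integral>\<omega>. expsum \<omega> n \<partial>base.paths) \<le> clan_prob m n" .
    moreover have "t\<^sup>2 * (\<integral>\<omega>. expsum \<omega> n \<partial>base.paths) \<le> t\<^sup>2 * (1 / (1 - \<gamma>))"
      by (intro mult_left_mono integral_expsum_le) simp
    moreover have "t\<^sup>2 * (1 / (1 - \<gamma>)) = s\<^sup>2 * (1 - \<gamma>)"
      using \<gamma> by (simp add: t_def power2_eq_square)
    moreover have "2 * t * s = 2 * (s\<^sup>2 * (1 - \<gamma>))" by (simp add: t_def power2_eq_square)
    ultimately show ?thesis by linarith
  qed
  have dec: "clan_prob m n' \<le> clan_prob m n" if "m \<le> n" "n \<le> n'" for n n'
    unfolding clan_prob_def
  proof (intro integral_mono reversed_formula_integrable m that order_trans[OF that])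
    fix \<omega>
    have "expsum \<omega> n \<le> expsum \<omega> n'" unfolding expsum_def using that by (intro sum_mono2) auto
    then show "reversed_formula \<omega> m n' \<le> reversed_formula \<omega> m n"
      unfolding reversed_formula_def using early_expsum_ge_1[OF m, of \<omega>] expsum_ge_1[of \<omega> n]
      by (intro divide_left_mono mult_left_mono mult_pos_pos) auto
  qed
  have "decseq (\<lambda>k. clan_prob m (k + m))" unfolding decseq_def using dec by auto
  then obtain r where r: "(\<lambda>k. clan_prob m (k + m)) \<longlonglongrightarrow> r" "\<forall>k. r \<le> clan_prob m (k + m)"
    using decseq_convergent[of "\<lambda>k. clan_prob m (k + m)" "s\<^sup>2 * (1 - \<gamma>)"] lower by auto
  have "s\<^sup>2 * (1 - \<gamma>) \<le> r" by (rule LIMSEQ_le_const[OF r(1)]) (use lower in auto)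
  moreover have "0 < s\<^sup>2 * (1 - \<gamma>)" using s \<gamma> by simp
  moreover have "(\<lambda>n. clan_prob m n) \<longlonglongrightarrow> r" using r(1) by (rule LIMSEQ_offset)
  ultimately show ?thesis by (intro exI[of _ r]) auto
qed

lemma expsum_cong: "(\<And>i. i < m \<Longrightarrow> \<omega> i = \<omega>' i) \<Longrightarrow> expsum \<omega> m = expsum \<omega>' m"
  unfolding expsum_def by (intro sum.cong refl arg_cong[where f = exp] partial_sum_cong) auto

lemma tilt_integrable:
  "integrable tilt.paths (\<lambda>\<omega>. 1 / (expsum \<omega> m)\<^sup>2)" "integrable tilt.paths (\<lambda>\<omega>. exp (partial_sum \<omega> m) / (expsum \<omega> m)\<^sup>2)"
  using inverse_square_le_1[of 0] exp_over_expsum_bounds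
  by (auto intro!: tilt.integrable_bounded[where B = 1])

lemma nn_integral_clan_prob:
  assumes "1 \<le> m" "m \<le> n"
  shows "(\<integral>\<^sup>+\<omega>. ennreal (reversed_formula \<omega> m n) \<partial>base.paths) = ennreal (clan_prob m n)"
  unfolding clan_prob_def using assms reversed_formula_bounds
  by (intro nn_integral_eq_integral reversed_formula_integrable) auto

lemma clan_prob_nonneg: "1 \<le> m \<Longrightarrow> m \<le> n \<Longrightarrow> 0 \<le> clan_prob m n"
  unfolding clan_prob_def using reversed_formula_bounds by (intro integral_nonneg_AE) auto

lemma clan_prob_upper:
  assumes m: "1 \<le> m" "m \<le> n"
  shows "clan_prob m n \<le> \<gamma> ^ m * ((\<integral>\<omega>. 1 / (expsum \<omega> m)\<^sup>2 \<partial>tilt.paths) + (\<integral>\<omega>. exp (partial_sum \<omega> m) / (expsum \<omega> m)\<^sup>2 \<partial>tilt.paths))"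
proof -
  let ?f = "\<lambda>\<omega>. 1 / (expsum \<omega> m)\<^sup>2 + exp (partial_sum \<omega> m) / (expsum \<omega> m)\<^sup>2"
  have "ennreal (clan_prob m n) \<le> (\<integral>\<^sup>+\<omega>. ennreal (exp (partial_sum \<omega> m)) * ennreal (?f \<omega>) \<partial>base.paths)"
    unfolding nn_integral_clan_prob[OF m, symmetric]
  proof (intro nn_integral_mono)
    fix \<omega>
    define b Q e where "b = early_expsum \<omega> m" and "Q = expsum \<omega> m" and "e = exp (partial_sum \<omega> m)"
    have b: "1 \<le> b" using early_expsum_ge_1[OF m(1)] by (simp add: b_def)
    have e: "0 < e" by (simp add: e_def)
    have Q: "Q = b + e" by (simp add: Q_def b_def e_def expsum_early)
    have "Q \<le> expsum \<omega> n" unfolding Q_def expsum_def using m by (intro sum_mono2) auto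
    then have "reversed_formula \<omega> m n \<le> e / (b * Q)"
      unfolding reversed_formula_def e_def[symmetric] b_def[symmetric]
      using b e Q by (intro divide_left_mono mult_left_mono mult_pos_pos) auto
    also have "\<dots> = e * (1 / Q\<^sup>2 + e / (b * Q\<^sup>2))"
    proof -
      have pos: "b > 0" "Q > 0" using b e Q by auto
      then have "1 / Q\<^sup>2 + e / (b * Q\<^sup>2) = (b + e) / (b * Q\<^sup>2)" by (simp add: add_divide_distrib)
      also have "\<dots> = 1 / (b * Q)" unfolding Q[symmetric] using pos by (simp add: power2_eq_square)
      finally show ?thesis by simp
    qed
    also have "\<dots> \<le> e * (1 / Q\<^sup>2 + e / Q\<^sup>2)"
    proof -
      have "Q\<^sup>2 > 0" using b e Q by simp
      then have "e / (b * Q\<^sup>2) \<le> e / (1 * Q\<^sup>2)" using b e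
        by (intro divide_left_mono mult_right_mono mult_pos_pos) auto
      then show ?thesis using e by (intro mult_left_mono) auto
    qed
    finally have "reversed_formula \<omega> m n \<le> e * (1 / Q\<^sup>2 + e / Q\<^sup>2)" .
    then have "ennreal (reversed_formula \<omega> m n) \<le> ennreal (e * (1 / Q\<^sup>2 + e / Q\<^sup>2))" by (rule ennreal_leI)
    also have "\<dots> = ennreal e * ennreal (1 / Q\<^sup>2 + e / Q\<^sup>2)" using e by (intro ennreal_mult) auto
    finally show "ennreal (reversed_formula \<omega> m n) \<le> ennreal (exp (partial_sum \<omega> m)) * ennreal (?f \<omega>)"
      by (simp add: e_def Q_def)
  qed
  also have "\<dots> = ennreal (\<gamma> ^ m) * (\<integral>\<^sup>+\<omega>. ennreal (?f \<omega>) \<partial>tilt.paths)"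
  proof (rule nn_integral_tilt)
    show "ennreal (?f \<omega>) = ennreal (?f \<omega>')" if "\<And>i. i < m \<Longrightarrow> \<omega> i = \<omega>' i" for \<omega> \<omega>'
      using expsum_cong[OF that] partial_sum_cong[OF that] by simp
  qed measurable
  also have "(\<integral>\<^sup>+\<omega>. ennreal (?f \<omega>) \<partial>tilt.paths) = ennreal (\<integral>\<omega>. ?f \<omega> \<partial>tilt.paths)"
    by (intro nn_integral_eq_integral Bochner_Integration.integrable_add tilt_integrable) auto
  also have "(\<integral>\<omega>. ?f \<omega> \<partial>tilt.paths) = (\<integral>\<omega>. 1 / (expsum \<omega> m)\<^sup>2 \<partial>tilt.paths) + (\<integral>\<omega>. exp (partial_sum \<omega> m) / (expsum \<omega> m)\<^sup>2 \<partial>tilt.paths)"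
    by (intro Bochner_Integration.integral_add tilt_integrable)
  also have "ennreal (\<gamma> ^ m) * ennreal \<dots> = ennreal (\<gamma> ^ m * \<dots>)"
    using \<gamma> by (intro ennreal_mult[symmetric] add_nonneg_nonneg integral_nonneg_AE) auto
  finally show ?thesis
    using \<gamma> by (subst (asm) ennreal_le_iff) (auto intro!: mult_nonneg_nonneg add_nonneg_nonneg integral_nonneg_AE)
qed

lemma clan_prob_lower:
  assumes m: "1 \<le> m" "m \<le> n"
  shows "\<gamma> ^ m * ((\<integral>\<omega>. 1 / (expsum \<omega> m)\<^sup>2 \<partial>tilt.paths) - 1 / (1 - \<gamma>) * (\<integral>\<omega>. exp (partial_sum \<omega> m) / (expsum \<omega> m)\<^sup>2 \<partial>tilt.paths)) \<le> clan_prob m n"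
proof -
  let ?A = "\<integral>\<omega>. 1 / (expsum \<omega> m)\<^sup>2 \<partial>tilt.paths"
  let ?B = "\<integral>\<omega>. exp (partial_sum \<omega> m) / (expsum \<omega> m)\<^sup>2 \<partial>tilt.paths"
  let ?W = "\<lambda>\<omega>. \<Sum>k\<in>{1..n - m}. exp (partial_sum \<omega> k)"
  let ?e = "\<lambda>\<omega>. exp (partial_sum \<omega> m)"
  let ?q = "\<lambda>\<omega>. 1 / (expsum \<omega> m)\<^sup>2"
  let ?g = "\<lambda>\<omega>. exp (partial_sum \<omega> m) / (expsum \<omega> m)\<^sup>2"
  have A0: "0 \<le> ?A" by (intro integral_nonneg_AE) auto
  have B0: "0 \<le> ?B" by (intro integral_nonneg_AE) auto
  have tA: "(\<integral>\<^sup>+\<omega>. ennreal (?e \<omega>) * ennreal (?q \<omega>) \<partial>base.paths) = ennreal (\<gamma> ^ m * ?A)"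
  proof -
    have "(\<integral>\<^sup>+\<omega>. ennreal (?e \<omega>) * ennreal (?q \<omega>) \<partial>base.paths) = ennreal (\<gamma> ^ m) * (\<integral>\<^sup>+\<omega>. ennreal (?q \<omega>) \<partial>tilt.paths)"
    proof (rule nn_integral_tilt)
      show "ennreal (?q \<omega>) = ennreal (?q \<omega>')" if "\<And>i. i < m \<Longrightarrow> \<omega> i = \<omega>' i" for \<omega> \<omega>'
        using expsum_cong[OF that] by simp
    qed measurable
    also have "(\<integral>\<^sup>+\<omega>. ennreal (?q \<omega>) \<partial>tilt.paths) = ennreal ?A"
      by (intro nn_integral_eq_integral tilt_integrable) auto
    also have "ennreal (\<gamma> ^ m) * ennreal ?A = ennreal (\<gamma> ^ m * ?A)" using \<gamma> A0 by (intro ennreal_mult[symmetric]) auto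
    finally show ?thesis .
  qed
  have tB: "(\<integral>\<^sup>+\<omega>. ennreal (?e \<omega>) * ennreal (?g \<omega>) \<partial>base.paths) = ennreal (\<gamma> ^ m * ?B)"
  proof -
    have "(\<integral>\<^sup>+\<omega>. ennreal (?e \<omega>) * ennreal (?g \<omega>) \<partial>base.paths) = ennreal (\<gamma> ^ m) * (\<integral>\<^sup>+\<omega>. ennreal (?g \<omega>) \<partial>tilt.paths)"
    proof (rule nn_integral_tilt)
      show "ennreal (?g \<omega>) = ennreal (?g \<omega>')" if "\<And>i. i < m \<Longrightarrow> \<omega> i = \<omega>' i" for \<omega> \<omega>'
        using expsum_cong[OF that] partial_sum_cong[OF that] by simp
    qed measurable
    also have "(\<integral>\<^sup>+\<omega>. ennreal (?g \<omega>) \<partial>tilt.paths) = ennreal ?B"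
      by (intro nn_integral_eq_integral tilt_integrable) auto
    also have "ennreal (\<gamma> ^ m) * ennreal ?B = ennreal (\<gamma> ^ m * ?B)" using \<gamma> B0 by (intro ennreal_mult[symmetric]) auto
    finally show ?thesis .
  qed
  have tW: "(\<integral>\<^sup>+\<omega>. ennreal (?W \<omega>) \<partial>base.paths) \<le> ennreal (1 / (1 - \<gamma>))"
  proof -
    have "(\<integral>\<^sup>+\<omega>. ennreal (?W \<omega>) \<partial>base.paths) = ennreal (\<integral>\<omega>. ?W \<omega> \<partial>base.paths)"
      by (intro nn_integral_eq_integral Bochner_Integration.integrable_sum integrable_exp_partial_sum AE_I2 sum_nonneg) auto
    also have "(\<integral>\<omega>. ?W \<omega> \<partial>base.paths) = (\<Sum>k\<in>{1..n - m}. \<gamma> ^ k)"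
      by (subst Bochner_Integration.integral_sum) (simp_all add: integrable_exp_partial_sum integral_exp_partial_sum)
    also have "ennreal \<dots> \<le> ennreal (1 / (1 - \<gamma>))" by (intro ennreal_leI power_sum_le) simp
    finally show ?thesis .
  qed
  have pw: "?e \<omega> * ?q \<omega> \<le> reversed_formula \<omega> m n + (?e \<omega> * ?g \<omega>) * ?W (\<lambda>i. \<omega> (m + i))" for \<omega>
  proof -
    define b Q e W where "b = early_expsum \<omega> m" and "Q = expsum \<omega> m" and "e = ?e \<omega>" and "W = ?W (\<lambda>i. \<omega> (m + i))"
    have b: "1 \<le> b" using early_expsum_ge_1[OF m(1)] by (simp add: b_def)
    have e: "0 < e" by (simp add: e_def)
    have Q: "Q = b + e" by (simp add: Q_def b_def e_def expsum_early)
    have W: "0 \<le> W" unfolding W_def by (intro sum_nonneg) auto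
    have T: "expsum \<omega> n = Q + e * W"
    proof -
      have "expsum \<omega> n = (\<Sum>k\<in>{..m} \<union> {m + 1..n}. exp (partial_sum \<omega> k))"
        unfolding expsum_def using m by (intro sum.cong) auto
      also have "\<dots> = Q + (\<Sum>k\<in>{m + 1..n}. exp (partial_sum \<omega> k))"
        unfolding Q_def expsum_def by (rule sum.union_disjoint) auto
      also have "(\<Sum>k\<in>{m + 1..n}. exp (partial_sum \<omega> k)) = (\<Sum>k\<in>{1..n - m}. exp (partial_sum \<omega> (m + k)))"
        using m by (intro sum.reindex_bij_witness[of _ "\<lambda>k. m + k" "\<lambda>k. k - m"]) auto
      also have "\<dots> = e * W"
        unfolding e_def W_def sum_distrib_left by (intro sum.cong refl) (simp add: partial_sum_shift flip: exp_add)
      finally show ?thesis .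
    qed
    have pos: "Q > 0" "Q + e * W > 0" "Q + e * W \<ge> 1" using b e Q W by (auto intro!: add_pos_nonneg add_increasing2)
    have "1 / Q\<^sup>2 - e * W / (Q\<^sup>2 * (Q + e * W)) = 1 / (Q * (Q + e * W))"
    proof -
      have "1 / Q\<^sup>2 - (D - Q) / (Q\<^sup>2 * D) = 1 / (Q * D)" if "D > 0" for D
        using that pos(1) by (simp add: field_simps power2_eq_square)
      from this[OF pos(2)] show ?thesis by simp
    qed
    also have "\<dots> \<le> 1 / (b * (Q + e * W))"
      using b e Q pos by (intro divide_left_mono mult_right_mono mult_pos_pos) auto
    finally have 1: "1 / Q\<^sup>2 \<le> 1 / (b * (Q + e * W)) + e * W / (Q\<^sup>2 * (Q + e * W))" by linarith
    have "e * W / (Q\<^sup>2 * (Q + e * W)) \<le> e * W / (Q\<^sup>2 * 1)"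
      using e W pos by (intro divide_left_mono mult_left_mono mult_pos_pos mult_nonneg_nonneg) auto
    with 1 have "1 / Q\<^sup>2 \<le> 1 / (b * (Q + e * W)) + e * W / Q\<^sup>2" by simp
    then have "e * (1 / Q\<^sup>2) \<le> e * (1 / (b * (Q + e * W)) + e * W / Q\<^sup>2)" using e by (intro mult_left_mono) auto
    also have "\<dots> = e / (b * (Q + e * W)) + e * (e / Q\<^sup>2) * W" by (simp add: distrib_left)
    finally show ?thesis unfolding reversed_formula_def T by (simp add: b_def Q_def e_def W_def)
  qed
  have [measurable]: "(\<lambda>\<omega>. ?W (\<lambda>i. \<omega> (m + i))) \<in> borel_measurable base.paths"
    by (rule measurable_compose[OF base.measurable_reindex, where g = ?W]) measurable
  have "ennreal (\<gamma> ^ m * ?A) \<le> (\<integral>\<^sup>+\<omega>. ennreal (reversed_formula \<omega> m n) + (ennreal (?e \<omega>) * ennreal (?g \<omega>)) * ennreal (?W (\<lambda>i. \<omega> (m + i))) \<partial>base.paths)"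
    unfolding tA[symmetric]
  proof (intro nn_integral_mono)
    fix \<omega>
    have "ennreal (?e \<omega>) * ennreal (?q \<omega>) = ennreal (?e \<omega> * ?q \<omega>)" by (intro ennreal_mult[symmetric]) auto
    also have "\<dots> \<le> ennreal (reversed_formula \<omega> m n + (?e \<omega> * ?g \<omega>) * ?W (\<lambda>i. \<omega> (m + i)))" by (intro ennreal_leI pw)
    also have "\<dots> = ennreal (reversed_formula \<omega> m n) + (ennreal (?e \<omega>) * ennreal (?g \<omega>)) * ennreal (?W (\<lambda>i. \<omega> (m + i)))"
    proof -
      have W: "0 \<le> ?W (\<lambda>i. \<omega> (m + i))" by (intro sum_nonneg) auto
      have g: "0 \<le> ?g \<omega>" by simp
      show ?thesis
        using reversed_formula_bounds(1)[OF m, of \<omega>] W g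
        by (simp only: ennreal_plus ennreal_mult mult_nonneg_nonneg exp_ge_zero)
    qed
    finally show "ennreal (?e \<omega>) * ennreal (?q \<omega>) \<le> ennreal (reversed_formula \<omega> m n) + (ennreal (?e \<omega>) * ennreal (?g \<omega>)) * ennreal (?W (\<lambda>i. \<omega> (m + i)))" .
  qed
  also have "\<dots> = ennreal (clan_prob m n) + (\<integral>\<^sup>+\<omega>. (ennreal (?e \<omega>) * ennreal (?g \<omega>)) * ennreal (?W (\<lambda>i. \<omega> (m + i))) \<partial>base.paths)"
    unfolding nn_integral_clan_prob[OF m, symmetric] by (intro nn_integral_add) measurable
  also have "(\<integral>\<^sup>+\<omega>. (ennreal (?e \<omega>) * ennreal (?g \<omega>)) * ennreal (?W (\<lambda>i. \<omega> (m + i))) \<partial>base.paths)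
      = (\<integral>\<^sup>+\<omega>. ennreal (?e \<omega>) * ennreal (?g \<omega>) \<partial>base.paths) * (\<integral>\<^sup>+\<omega>. ennreal (?W \<omega>) \<partial>base.paths)"
  proof (rule base.nn_integral_split_product[where f = "\<lambda>\<omega>. ennreal (?e \<omega>) * ennreal (?g \<omega>)" and g = "\<lambda>\<omega>. ennreal (?W \<omega>)"])
    fix \<omega> \<omega>' :: "nat \<Rightarrow> real"
    have "expsum (comb_seq m \<omega> \<omega>') m = expsum \<omega> m" by (rule expsum_cong) (simp add: comb_seq_def)
    then show "ennreal (?e (comb_seq m \<omega> \<omega>')) * ennreal (?g (comb_seq m \<omega> \<omega>')) = ennreal (?e \<omega>) * ennreal (?g \<omega>)"
      by (simp add: partial_sum_comb_seq_le)
  qed measurable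
  also have "ennreal (clan_prob m n) + (\<integral>\<^sup>+\<omega>. ennreal (?e \<omega>) * ennreal (?g \<omega>) \<partial>base.paths) * (\<integral>\<^sup>+\<omega>. ennreal (?W \<omega>) \<partial>base.paths)
      \<le> ennreal (clan_prob m n) + ennreal (\<gamma> ^ m * ?B) * ennreal (1 / (1 - \<gamma>))"
    unfolding tB by (intro add_left_mono mult_left_mono tW) simp
  also have "ennreal (\<gamma> ^ m * ?B) * ennreal (1 / (1 - \<gamma>)) = ennreal (\<gamma> ^ m * ?B * (1 / (1 - \<gamma>)))"
    using \<gamma> B0 by (intro ennreal_mult[symmetric] mult_nonneg_nonneg) auto
  also have "ennreal (clan_prob m n) + \<dots> = ennreal (clan_prob m n + \<gamma> ^ m * ?B * (1 / (1 - \<gamma>)))"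
    using \<gamma> B0 clan_prob_nonneg[OF m] by (intro ennreal_plus[symmetric] mult_nonneg_nonneg) auto
  finally have "\<gamma> ^ m * ?A \<le> clan_prob m n + \<gamma> ^ m * ?B * (1 / (1 - \<gamma>))"
    using \<gamma> B0 clan_prob_nonneg[OF m]
    by (subst (asm) ennreal_le_iff) (auto intro!: add_nonneg_nonneg mult_nonneg_nonneg)
  then show ?thesis by (simp add: algebra_simps)
qed

end

section \<open>The main theorem\<close>

lemma exp_tangent: "exp x - x * exp x \<le> (1 :: real)" "exp x - x * exp x = 1 \<Longrightarrow> x = (0 :: real)"
proof -
  have "1 - x \<le> exp (- x)" using exp_ge_add_one_self[of "- x"] by simp
  then have "exp x * (1 - x) \<le> exp x * exp (- x)" by (intro mult_left_mono) auto
  then show "exp x - x * exp x \<le> 1" by (simp add: algebra_simps flip: exp_add)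
  assume eq: "exp x - x * exp x = 1"
  then have "exp x * (1 - x) = 1" by (simp add: algebra_simps)
  then have e: "1 - x = exp (- x)" by (simp add: exp_minus field_simps)
  then have "ln (1 - x) = (1 - x) - 1" by simp
  moreover have "0 < 1 - x" unfolding e by simp
  ultimately have "1 - x = 1" by (intro ln_eq_minus_one) auto
  then show "x = 0" by simp
qed

context bpire
begin

lemma sets_L: "sets L = sets Delta"
  using env_law[of 1] by (metis le_refl sets_distr)

lemma prob_L: "prob_space L"
  using env_law[of 1] prob_space_distr[OF F_measurable[of 1]] by simp

lemma log_mean_measurable_L [measurable]: "log_mean \<in> borel_measurable L"
  using measurable_log_mean by (simp add: measurable_cong_sets[OF sets_L refl])

lemma prob_clan_event_reversed:
  assumes geo: "AE f in L. geometric_offspring f" and m: "1 \<le> m" "m \<le> n"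
  shows "measure M (clan_event M xi (n - m) n)
    = (\<integral>\<omega>. reversed_formula \<omega> m n \<partial>(\<Pi>\<^sub>M i\<in>(UNIV::nat set). distr L borel log_mean))"
proof -
  define \<nu> where "\<nu> = distr L borel log_mean"
  interpret L: prob_space L by (rule prob_L)
  have prob: "prob_space \<nu>" unfolding \<nu>_def by (rule L.prob_space_distr[OF log_mean_measurable_L])
  have sets: "sets \<nu> = sets borel" by (simp add: \<nu>_def)
  interpret W: iid_walk \<nu> by (rule iid_walk.intro[OF prob sets])
  have tr: "distr M W.paths (\<lambda>\<omega> i. log_mean (F (Suc i) \<omega>)) = W.paths"
    unfolding \<nu>_def by (rule distr_iid_sequence[OF env_indep env_law measurable_log_mean])
  have "measure M (clan_event M xi (n - m) n) = (\<integral>\<omega>. clan_formula (env_walk \<omega>) (n - m) n \<partial>M)"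
    using m by (intro prob_clan_event[OF geo]) auto
  also have "\<dots> = (\<integral>\<omega>. clan_formula (partial_sum (\<lambda>i. log_mean (F (Suc i) \<omega>))) (n - m) n \<partial>M)"
    by (simp add: env_walk_def[abs_def])
  also have "\<dots> = (\<integral>\<omega>. clan_formula (partial_sum \<omega>) (n - m) n \<partial>distr M W.paths (\<lambda>\<omega> i. log_mean (F (Suc i) \<omega>)))"
  proof (rule integral_distr[symmetric])
    have "(\<lambda>\<omega>. \<lambda>i\<in>UNIV. log_mean (F (Suc i) \<omega>)) \<in> measurable M (\<Pi>\<^sub>M i\<in>(UNIV::nat set). borel)"
      by (intro measurable_restrict measurable_compose[OF F_measurable measurable_log_mean]) auto
    then have "(\<lambda>\<omega> i. log_mean (F (Suc i) \<omega>)) \<in> measurable M (\<Pi>\<^sub>M i\<in>(UNIV::nat set). borel)"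
      by (simp add: restrict_def)
    moreover have "sets W.paths = sets (\<Pi>\<^sub>M i\<in>(UNIV::nat set). (borel :: real measure))"
      by (intro sets_PiM_cong) (auto simp: \<nu>_def)
    ultimately show "(\<lambda>\<omega> i. log_mean (F (Suc i) \<omega>)) \<in> measurable M W.paths"
      using measurable_cong_sets[OF refl] by blast
  qed measurable
  also have "\<dots> = (\<integral>\<omega>. reversed_formula \<omega> m n \<partial>W.paths)"
    unfolding tr by (rule W.integral_clan_formula[OF m])
  finally show ?thesis by (simp add: \<nu>_def)
qed

end

lemma attracted_imp_spitzer_walk:
  assumes prob: "prob_space (tilted_law L)" and lm: "log_mean \<in> borel_measurable (tilted_law L)"
    and attracted: "attracted_to_two_sided_stable L \<alpha>" and "0 < \<alpha>"
  shows "spitzer_walk (distr (tilted_law L) borel log_mean) (positivity_parameter L)"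
proof -
  define \<nu> where "\<nu> = distr (tilted_law L) borel log_mean"
  have prob_\<nu>: "prob_space \<nu>" unfolding \<nu>_def by (rule prob_space.prob_space_distr[OF prob lm])
  have sets_\<nu>: "sets \<nu> = sets borel" by (simp add: \<nu>_def)
  interpret W: iid_walk \<nu> by (rule iid_walk.intro[OF prob_\<nu> sets_\<nu>])
  obtain c l1 \<mu> where c: "\<And>n. 1 \<le> n \<Longrightarrow> 0 < c n" "mono_on {1..} c" "slowly_varying l1"
      "\<And>n. 1 \<le> n \<Longrightarrow> c n = real n powr (1 / \<alpha>) * l1 (real n)"
    and \<mu>: "stable_law \<alpha> \<mu>" "two_sided \<mu>"
    and conv: "weak_conv_m (\<lambda>n. distr (tilted_env L) borel (\<lambda>e. walk n e / c n)) \<mu>"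
    using attracted unfolding attracted_to_two_sided_stable_def by blast
  interpret E: prob_space "tilted_env L"
    unfolding tilted_env_def by (intro prob_space_PiM prob)
  have coord: "E.indep_vars (\<lambda>_. tilted_law L) (\<lambda>i e. e i) {1..}"
    unfolding tilted_env_def by (rule indep_vars_PiM_coordinates[OF prob]) auto
  have coord_law: "distr (tilted_env L) (tilted_law L) (\<lambda>e. e n) = tilted_law L" if "1 \<le> n" for n
    unfolding tilted_env_def by (rule distr_PiM_component) (use that prob in auto)
  have tr: "distr (tilted_env L) W.paths (\<lambda>e i. log_mean (e (Suc i))) = W.paths"
    unfolding \<nu>_def by (rule E.distr_iid_sequence[OF coord coord_law lm])
  have e_meas: "(\<lambda>e. e n) \<in> measurable (tilted_env L) (tilted_law L)" if "1 \<le> n" for n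
    unfolding tilted_env_def using that by (intro measurable_component_singleton) auto
  have walk_meas: "walk n \<in> borel_measurable (tilted_env L)" for n
    unfolding walk_def[abs_def]
    by (intro borel_measurable_sum measurable_compose[OF e_meas lm]) auto
  have walk_eq: "walk n e = partial_sum (\<lambda>i. log_mean (e (Suc i))) n" for n e
    unfolding walk_def partial_sum_def
    by (rule sum.reindex_bij_witness[of _ Suc "\<lambda>k. k - 1"]) auto
  have tr_meas: "(\<lambda>e i. log_mean (e (Suc i))) \<in> measurable (tilted_env L) W.paths"
  proof -
    have "(\<lambda>e. \<lambda>i\<in>UNIV. log_mean (e (Suc i))) \<in> measurable (tilted_env L) (\<Pi>\<^sub>M i\<in>(UNIV::nat set). borel)"
      by (intro measurable_restrict measurable_compose[OF e_meas lm]) auto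
    then have "(\<lambda>e i. log_mean (e (Suc i))) \<in> measurable (tilted_env L) (\<Pi>\<^sub>M i\<in>(UNIV::nat set). borel)"
      by (simp add: restrict_def)
    moreover have "sets W.paths = sets (\<Pi>\<^sub>M i\<in>(UNIV::nat set). (borel :: real measure))"
      by (intro sets_PiM_cong) (auto simp: \<nu>_def)
    ultimately show ?thesis using measurable_cong_sets[OF refl] by blast
  qed
  have transfer: "measure W.paths {\<omega>. Q (partial_sum \<omega> n)} = E.prob {e \<in> space (tilted_env L). Q (walk n e)}"
    if [measurable]: "Measurable.pred borel Q" for Q n
  proof -
    have "{\<omega>. Q (partial_sum \<omega> n)} \<in> sets W.paths" by (intro W.sets_Collect_paths) measurable
    then have "measure (distr (tilted_env L) W.paths (\<lambda>e i. log_mean (e (Suc i)))) {\<omega>. Q (partial_sum \<omega> n)}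
      = E.prob ((\<lambda>e i. log_mean (e (Suc i))) -` {\<omega>. Q (partial_sum \<omega> n)} \<inter> space (tilted_env L))"
      by (rule measure_distr[OF tr_meas])
    also have "(\<lambda>e i. log_mean (e (Suc i))) -` {\<omega>. Q (partial_sum \<omega> n)} \<inter> space (tilted_env L) = {e \<in> space (tilted_env L). Q (walk n e)}"
      by (auto simp: walk_eq)
    finally show ?thesis unfolding tr .
  qed
  have c_top: "filterlim c at_top sequentially"
    using \<open>0 < \<alpha>\<close> by (intro regularly_varying_at_top[OF c]) auto
  have \<mu>_real: "real_distribution \<mu>" using \<mu>(1) by (simp add: stable_law_def)
  note weak = E.scaled_weak_limit[OF walk_meas c(1) c_top \<mu>_real stable_law_no_atoms[OF \<mu>] conv]
  define \<rho> where "\<rho> = 1 - measure \<mu> {..0}"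
  have \<rho>_eq: "positivity_parameter L = \<rho>"
    unfolding positivity_parameter_def \<rho>_def by (rule limI) (rule weak(1))
  interpret \<mu>: real_distribution \<mu> by (rule \<mu>_real)
  have \<rho>01: "0 < \<rho>" "\<rho> < 1"
  proof -
    have "measure \<mu> {..0} \<noteq> 1" "measure \<mu> {0..} \<noteq> 1" using \<mu>(2) by (auto simp: two_sided_def)
    moreover have "measure \<mu> {..0} \<le> 1" by simp
    ultimately show "0 < \<rho>" unfolding \<rho>_def by linarith
    have "measure \<mu> {0..} = 1 - measure \<mu> {..<0}"
      using \<mu>.prob_compl[of "{..<0}"] by (simp add: Compl_eq_Diff_UNIV[symmetric])
    then have "0 < measure \<mu> {..<0}" using \<open>measure \<mu> {0..} \<noteq> 1\<close> by (simp add: less_le)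
    also have "\<dots> \<le> measure \<mu> {..0}" by (intro \<mu>.finite_measure_mono) auto
    finally show "\<rho> < 1" by (simp add: \<rho>_def)
  qed
  show ?thesis
    unfolding \<rho>_eq \<nu>_def[symmetric]
  proof (intro spitzer_walk.intro W.iid_walk_axioms spitzer_walk_axioms.intro)
    show "(\<lambda>n. measure W.paths {\<omega>. 0 < partial_sum \<omega> n}) \<longlonglongrightarrow> \<rho>"
      using weak(1) transfer[of "\<lambda>x. 0 < x"] by (simp add: \<rho>_def)
    show "(\<lambda>n. measure W.paths {\<omega>. \<bar>partial_sum \<omega> n\<bar> \<le> K}) \<longlonglongrightarrow> 0" for K
      using weak(2)[of K] transfer[of "\<lambda>x. \<bar>x\<bar> \<le> K"] by simp
  qed (use \<rho>01 in auto)
qed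

lemma (in tilted_walks) clan_prob_asymptotics:
  assumes "spitzer_walk \<nu> \<rho>"
  shows "\<exists>l R lo hi. slowly_varying l \<and> 0 < R \<and> lo \<longlonglongrightarrow> R \<and> hi \<longlonglongrightarrow> R \<and>
    (\<forall>m n. 1 \<le> m \<longrightarrow> m \<le> n \<longrightarrow> lo m \<le> real m powr \<rho> * l (real m) * clan_prob m n / \<gamma> ^ m
      \<and> real m powr \<rho> * l (real m) * clan_prob m n / \<gamma> ^ m \<le> hi m)"
proof -
  interpret S: spitzer_walk \<nu> \<rho> by fact
  obtain l R where l: "slowly_varying l" and R: "0 < R"
    and u: "(\<lambda>n. real n powr \<rho> * l (real n) * S.total_functional n) \<longlonglongrightarrow> R"
    and v: "(\<lambda>n. real n powr \<rho> * l (real n) * S.end_functional n) \<longlonglongrightarrow> 0"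
    using S.functional_asymptotics by blast
  define lo where "lo m = real m powr \<rho> * l (real m) * (S.total_functional m - 1 / (1 - \<gamma>) * S.end_functional m)" for m
  define hi where "hi m = real m powr \<rho> * l (real m) * (S.total_functional m + S.end_functional m)" for m
  have "(\<lambda>m. real m powr \<rho> * l (real m) * S.total_functional m - 1 / (1 - \<gamma>) * (real m powr \<rho> * l (real m) * S.end_functional m)) \<longlonglongrightarrow> R - 1 / (1 - \<gamma>) * 0"
    by (intro tendsto_intros u v)
  then have lo: "lo \<longlonglongrightarrow> R" by (simp add: lo_def[abs_def] algebra_simps)
  have hi: "hi \<longlonglongrightarrow> R" using tendsto_add[OF u v] by (simp add: hi_def[abs_def] algebra_simps)
  have sandwich: "lo m \<le> real m powr \<rho> * l (real m) * clan_prob m n / \<gamma> ^ m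
      \<and> real m powr \<rho> * l (real m) * clan_prob m n / \<gamma> ^ m \<le> hi m"
    if m: "1 \<le> m" "m \<le> n" for m n
  proof -
    have lp: "0 \<le> real m powr \<rho> * l (real m)" using l m(1) by (auto simp: slowly_varying_def intro!: mult_nonneg_nonneg less_imp_le)
    have g: "0 < \<gamma> ^ m" using \<gamma> by simp
    have a: "S.total_functional m - 1 / (1 - \<gamma>) * S.end_functional m \<le> clan_prob m n / \<gamma> ^ m"
      using clan_prob_lower[OF m] g
      by (simp add: S.total_functional_def S.end_functional_def pos_le_divide_eq mult.commute)
    have b: "clan_prob m n / \<gamma> ^ m \<le> S.total_functional m + S.end_functional m"
      using clan_prob_upper[OF m] g
      by (simp add: S.total_functional_def S.end_functional_def pos_divide_le_eq mult.commute)
    have "lo m \<le> real m powr \<rho> * l (real m) * (clan_prob m n / \<gamma> ^ m)"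
      unfolding lo_def by (rule mult_left_mono[OF a lp])
    moreover have "real m powr \<rho> * l (real m) * (clan_prob m n / \<gamma> ^ m) \<le> hi m"
      unfolding hi_def by (rule mult_left_mono[OF b lp])
    ultimately show ?thesis by simp
  qed
  from l R lo hi sandwich show ?thesis by blast
qed

theorem theorem2:
  fixes M :: "'a measure"
    and L :: "nat measure measure"
    and F :: "nat \<Rightarrow> 'a \<Rightarrow> nat measure"
    and xi :: "nat \<Rightarrow> nat \<Rightarrow> 'a \<Rightarrow> nat"
    and \<alpha> :: real
  assumes "bpire M L F xi"
    and "AE f in L. geometric_offspring f"
    and "integrable L log_mean" and "(\<integral>f. log_mean f \<partial>L) < 0"
    and "integrable L (\<lambda>f. log_mean f * exp (log_mean f))"
    and "(\<integral>f. log_mean f * exp (log_mean f) \<partial>L) = 0"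
    and "1 < \<alpha>" and "\<alpha> \<le> 2"
    and "nonlattice (tilted_law L) log_mean"
    and "attracted_to_two_sided_stable L \<alpha>"
  shows "(\<forall>N\<ge>1. \<exists>r>0. (\<lambda>n. measure M (clan_event M xi (n - N) n)) \<longlonglongrightarrow> r) \<and>
    (\<exists>l R. slowly_varying l \<and> 0 < R \<and>
       ((\<lambda>(i, n). real (n - i) powr positivity_parameter L * l (real (n - i))
            * measure M (clan_event M xi i n) / env_gamma L ^ (n - i)) \<longlongrightarrow> R)
         (filtercomap (\<lambda>(i, n). n - i) at_top))"
proof -
  interpret bpire M L F xi by fact
  interpret L: prob_space L by (rule prob_L)
  define \<gamma> where "\<gamma> = env_gamma L"
  define \<nu>0 where "\<nu>0 = distr L borel log_mean"
  define \<nu> where "\<nu> = distr (tilted_law L) borel log_mean"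
  have int_exp: "integrable L (\<lambda>f. exp (log_mean f))"
  proof (rule Bochner_Integration.integrable_bound)
    show "integrable L (\<lambda>f. exp 1 + \<bar>log_mean f * exp (log_mean f)\<bar>)"
      using assms(5) by (intro Bochner_Integration.integrable_add integrable_abs) auto
    show "AE f in L. norm (exp (log_mean f)) \<le> norm (exp 1 + \<bar>log_mean f * exp (log_mean f)\<bar>)"
    proof (intro AE_I2)
      fix f
      let ?x = "log_mean f"
      have "exp ?x \<le> exp 1 + \<bar>?x * exp ?x\<bar>"
      proof (cases "?x \<le> 1")
        case True
        then have "exp ?x \<le> exp 1" by simp
        then show ?thesis by linarith
      next
        case False
        then have "1 * exp ?x \<le> ?x * exp ?x" by (intro mult_right_mono) auto
        then show ?thesis by (simp add: abs_mult add_increasing)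
      qed
      then show "norm (exp ?x) \<le> norm (exp 1 + \<bar>?x * exp ?x\<bar>)" by simp
    qed
  qed measurable
  have \<gamma>_eq: "\<gamma> = (\<integral>f. exp (log_mean f) \<partial>L)" by (simp add: \<gamma>_def env_gamma_def)
  have \<gamma>_pos: "0 < \<gamma>"
  proof -
    have "\<gamma> \<noteq> 0"
    proof
      assume "\<gamma> = 0"
      then have "AE f in L. exp (log_mean f) = 0"
        unfolding \<gamma>_eq using integral_nonneg_eq_0_iff_AE[OF int_exp] by simp
      then show False by simp
    qed
    moreover have "0 \<le> \<gamma>" unfolding \<gamma>_eq by (intro integral_nonneg_AE) auto
    ultimately show ?thesis by simp
  qed
  have \<gamma>_less: "\<gamma> < 1"
  proof -
    let ?d = "\<lambda>f. 1 - (exp (log_mean f) - log_mean f * exp (log_mean f))"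
    have int: "integrable L ?d" using int_exp assms(5) by auto
    have val: "(\<integral>f. ?d f \<partial>L) = 1 - \<gamma>"
      using int_exp assms(5,6) L.prob_space by (simp add: \<gamma>_eq Bochner_Integration.integral_diff)
    have nn: "0 \<le> ?d f" for f using exp_tangent(1)[of "log_mean f"] by simp
    have "0 \<le> (\<integral>f. ?d f \<partial>L)" by (intro integral_nonneg_AE AE_I2 nn)
    moreover have "(\<integral>f. ?d f \<partial>L) \<noteq> 0"
    proof
      assume "(\<integral>f. ?d f \<partial>L) = 0"
      then have "AE f in L. ?d f = 0" using integral_nonneg_eq_0_iff_AE[OF int] nn by simp
      then have "AE f in L. log_mean f = 0"
        by eventually_elim (rule exp_tangent(2), simp)
      then have "(\<integral>f. log_mean f \<partial>L) = (\<integral>f. 0 \<partial>L)" by (intro integral_cong_AE) auto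
      then show False using assms(4) by simp
    qed
    ultimately show ?thesis using val by linarith
  qed
  have tilted_sets: "sets (tilted_law L) = sets Delta" by (simp add: tilted_law_def sets_L)
  have lm_tilted [measurable]: "log_mean \<in> borel_measurable (tilted_law L)"
    using measurable_log_mean by (simp add: measurable_cong_sets[OF tilted_sets refl])
  have prob_tilted: "prob_space (tilted_law L)"
  proof
    have "emeasure (tilted_law L) (space (tilted_law L)) = (\<integral>\<^sup>+f. ennreal (exp (log_mean f) / \<gamma>) \<partial>L)"
      unfolding tilted_law_def \<gamma>_def[symmetric] by (subst emeasure_density) (auto intro!: nn_integral_cong)
    also have "\<dots> = ennreal (\<integral>f. exp (log_mean f) / \<gamma> \<partial>L)"
      using int_exp \<gamma>_pos by (intro nn_integral_eq_integral) auto
    also have "(\<integral>f. exp (log_mean f) / \<gamma> \<partial>L) = 1" using \<gamma>_pos by (simp add: \<gamma>_eq[symmetric])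
    finally show "emeasure (tilted_law L) (space (tilted_law L)) = 1" by simp
  qed
  interpret T: prob_space "tilted_law L" by (rule prob_tilted)
  have tw: "tilted_walks \<nu>0 \<nu> \<gamma>"
  proof (intro tilted_walks.intro iid_walk.intro tilted_walks_axioms.intro)
    show "prob_space \<nu>0" unfolding \<nu>0_def by (rule L.prob_space_distr) measurable
    show "prob_space \<nu>" unfolding \<nu>_def by (rule T.prob_space_distr) measurable
    show "\<nu> = density \<nu>0 (\<lambda>x. ennreal (exp x / \<gamma>))"
      unfolding \<nu>_def \<nu>0_def tilted_law_def \<gamma>_def[symmetric] by (subst density_distr) auto
    show "sets \<nu>0 = sets borel" unfolding \<nu>0_def by (rule sets_distr)
    show "sets \<nu> = sets borel" unfolding \<nu>_def by (rule sets_distr)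
  qed (fact \<gamma>_pos \<gamma>_less)+
  have P_eq: "measure M (clan_event M xi (n - m) n) = tilted_walks.clan_prob \<nu>0 m n" if "1 \<le> m" "m \<le> n" for m n
    unfolding tilted_walks.clan_prob_def[OF tw] unfolding \<nu>0_def by (rule prob_clan_event_reversed[OF assms(2) that])
  have part1: "\<exists>r>0. (\<lambda>n. measure M (clan_event M xi (n - N) n)) \<longlonglongrightarrow> r" if N: "1 \<le> N" for N
  proof -
    obtain r where r: "r > 0" "(\<lambda>n. tilted_walks.clan_prob \<nu>0 N n) \<longlonglongrightarrow> r" using tilted_walks.clan_prob_limit[OF tw N] by blast
    have "\<forall>\<^sub>F n in sequentially. tilted_walks.clan_prob \<nu>0 N n = measure M (clan_event M xi (n - N) n)"
      using eventually_ge_at_top[of N] by eventually_elim (rule P_eq[OF N, symmetric])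
    from Lim_transform_eventually[OF r(2) this] r(1) show ?thesis by blast
  qed
  define \<rho> where "\<rho> = positivity_parameter L"
  have sw: "spitzer_walk \<nu> \<rho>"
    unfolding \<nu>_def \<rho>_def using assms(7)
    by (intro attracted_imp_spitzer_walk[OF prob_tilted lm_tilted assms(10)]) simp
  obtain l R lo hi where l: "slowly_varying l" and R: "0 < R" and lo: "lo \<longlonglongrightarrow> R" and hi: "hi \<longlonglongrightarrow> R"
    and sand: "\<And>m n. 1 \<le> m \<Longrightarrow> m \<le> n \<Longrightarrow>
        lo m \<le> real m powr \<rho> * l (real m) * tilted_walks.clan_prob \<nu>0 m n / \<gamma> ^ m
        \<and> real m powr \<rho> * l (real m) * tilted_walks.clan_prob \<nu>0 m n / \<gamma> ^ m \<le> hi m"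
    using tilted_walks.clan_prob_asymptotics[OF tw sw] by blast
  have sandwich: "lo (n - i) \<le> real (n - i) powr \<rho> * l (real (n - i)) * measure M (clan_event M xi i n) / \<gamma> ^ (n - i)
      \<and> real (n - i) powr \<rho> * l (real (n - i)) * measure M (clan_event M xi i n) / \<gamma> ^ (n - i) \<le> hi (n - i)"
    if "1 \<le> n - i" for i n
    using sand[OF that, of n] P_eq[OF that, of n] that by simp
  let ?F = "filtercomap (\<lambda>(i, n). n - i) at_top :: (nat \<times> nat) filter"
  have "((\<lambda>(i, n). real (n - i) powr \<rho> * l (real (n - i)) * measure M (clan_event M xi i n) / \<gamma> ^ (n - i)) \<longlongrightarrow> R) ?F"
  proof (rule tendsto_sandwich)
    have ev: "\<forall>\<^sub>F z in ?F. 1 \<le> (case z of (i, n) \<Rightarrow> n - i)"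
      by (intro eventually_filtercomapI eventually_ge_at_top)
    show "\<forall>\<^sub>F z in ?F. lo (case z of (i, n) \<Rightarrow> n - i) \<le> (case z of (i, n) \<Rightarrow> real (n - i) powr \<rho> * l (real (n - i)) * measure M (clan_event M xi i n) / \<gamma> ^ (n - i))"
      using ev
    proof eventually_elim
      case (elim z)
      obtain i n where z: "z = (i, n)" by (cases z)
      show ?case using sandwich[of n i] elim unfolding z prod.case by blast
    qed
    show "\<forall>\<^sub>F z in ?F. (case z of (i, n) \<Rightarrow> real (n - i) powr \<rho> * l (real (n - i)) * measure M (clan_event M xi i n) / \<gamma> ^ (n - i)) \<le> hi (case z of (i, n) \<Rightarrow> n - i)"
      using ev
    proof eventually_elim
      case (elim z)
      obtain i n where z: "z = (i, n)" by (cases z)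
      show ?case using sandwich[of n i] elim unfolding z prod.case by blast
    qed
    show "((\<lambda>z. lo (case z of (i, n) \<Rightarrow> n - i)) \<longlongrightarrow> R) ?F"
      by (rule filterlim_compose[OF lo filterlim_filtercomap])
    show "((\<lambda>z. hi (case z of (i, n) \<Rightarrow> n - i)) \<longlongrightarrow> R) ?F"
      by (rule filterlim_compose[OF hi filterlim_filtercomap])
  qed
  then have part2: "\<exists>l R. slowly_varying l \<and> 0 < R \<and>
       ((\<lambda>(i, n). real (n - i) powr positivity_parameter L * l (real (n - i))
            * measure M (clan_event M xi i n) / env_gamma L ^ (n - i)) \<longlongrightarrow> R) ?F"
    using l R unfolding \<rho>_def \<gamma>_def by blast
  from part1 part2 show ?thesis by blast
qed

end
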